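(* Let $\alpha>0$, $0<\beta<1/2$, $1\le p,q\le\infty$ and $f:\mathbb{Z}\to\mathbb{R}$ be such that $f\in\Lambda_H^{\alpha,p,q}\cap\ell_{-\beta}$. Then $(-\Delta_d)^{-\beta}f\in\Lambda_H^{\alpha+2\beta,p,q}$.
   Context: $[x]$ denotes the integer part of $x$; $\|\cdot\|_p$ is the norm of $\ell^p(\mathbb{Z})$. Weighted space: $\mu=\sum_{n\in\mathbb{Z}}\frac{1}{1+|n|}\delta_n$ ($\delta_n$ the Dirac measure at $n$). So $g\in\ell^q(\mathbb{Z},\mu)$ means $\sum_{n}|g(n)|^q\frac{1}{1+|n|}<\infty$ if $1\le q<\infty$, and $\ell^\infty(\mathbb{Z},\mu)=\ell^\infty(\mathbb{Z})$. The expression $\frac{f}{1+|\cdot|^\alpha}$ is the sequence $n\mapsto \frac{f(n)}{1+|n|^\alpha}$. Discrete Laplacian: $\Delta_df(n)=f(n+1)-2f(n)+f(n-1)$. Heat semigroup: $e^{t\Delta_d}f(n)=\sum_{j\in\mathbb{Z}}G(t,n-j)f(j)$, with $G(t,n)=e^{-2t}I_n(2t)$, $t>0$, $n\in\mathbb{Z}$, and $I_n$ the modified Bessel function of the first kind of order $n$. Mixed norms: for a function $F$ of $t>0$ with values in sequences on $\mathbb{Z}$, $\|F\|_{p,q}=\left(\int_0^\infty\|F(t)\|_p^q\frac{dt}{t}\right)^{1/q}$ for $1\le q<\infty$ and $\|F\|_{p,\infty}=\operatorname{ess\,sup}_{t>0}\|F(t)\|_p$. For $\alpha>0$, $\Lambda_H^{\alpha,p,q}$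 is the set of $f:\mathbb{Z}\to\mathbb{R}$ with $\frac{f}{1+|\cdot|^\alpha}\in\ell^q(\mathbb{Z},\mu)$ and $\|t^{k-\alpha/2}\partial_t^ke^{t\Delta_d}f\|_{p,q}<\infty$, where $k=[\alpha/2]+1$. $\ell_{-\beta}=\left\{u:\mathbb{Z}\to\mathbb{R}:\ \sum_{m\in\mathbb{Z}}\frac{|u(m)|}{(1+|m|)^{1-2\beta}}<\infty\right\}$. Negative fractional power of the discrete Laplacian, $0<\beta<1/2$: $(-\Delta_d)^{-\beta}f(n)=\frac{1}{\Gamma(\beta)}\int_0^\infty e^{\tau\Delta_d}f(n)\frac{d\tau}{\tau^{1-\beta}}$, $n\in\mathbb{Z}$ (well defined for $f\in\ell_{-\beta}$). *)

theory Defs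
  imports "HOL-Probability.Essential_Supremum"
begin

text \<open>
  All norms take values in \<^typ>\<open>ennreal\<close>, so that an infinite norm is really \<open>\<infinity>\<close>. Exponents
  \<open>1 \<le> p \<le> \<infinity>\<close> are of type \<^typ>\<open>ennreal\<close> as well.
\<close>

definition ennpowr :: "ennreal \<Rightarrow> real \<Rightarrow> ennreal" where
  "ennpowr x r = (if x = \<infinity> then \<infinity> else ennreal (enn2real x powr r))"
  \<comment> \<open>only used with \<open>r > 0\<close>\<close>

definition Lnorm :: "ennreal \<Rightarrow> 'a measure \<Rightarrow> ('a \<Rightarrow> ennreal) \<Rightarrow> ennreal" where
  "Lnorm p M g =
     (if p = \<infinity> then esssup M g
      else ennpowr (\<integral>\<^sup>+ x. ennpowr (g x) (enn2real p) \<partial>M) (1 / enn2real p))"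

definition lp_norm :: "ennreal \<Rightarrow> (int \<Rightarrow> real) \<Rightarrow> ennreal" where
  "lp_norm p u = Lnorm p (count_space UNIV) (\<lambda>n. ennreal \<bar>u n\<bar>)"

definition mu :: "int measure" where
  "mu = density (count_space UNIV) (\<lambda>n. ennreal (1 / (1 + \<bar>real_of_int n\<bar>)))"

definition in_lq_mu :: "ennreal \<Rightarrow> (int \<Rightarrow> real) \<Rightarrow> bool" where
  "in_lq_mu q g \<longleftrightarrow> Lnorm q mu (\<lambda>n. ennreal \<bar>g n\<bar>) < \<infinity>"

text \<open>
  The measure \<open>dt/t\<close> on \<open>(0,\<infinity>)\<close>. It has the same null sets as Lebesgue measure, so the
  essential supremum may be taken with respect to it.
\<close>

definition dt_over_t :: "real measure" where
  "dt_over_t = density (restrict_space lborel {0<..}) (\<lambda>t. ennreal (1 / t))"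

definition mixed_norm :: "ennreal \<Rightarrow> ennreal \<Rightarrow> (real \<Rightarrow> int \<Rightarrow> real) \<Rightarrow> ennreal" where
  "mixed_norm p q F = Lnorm q dt_over_t (\<lambda>t. lp_norm p (F t))"

text \<open>
  For a negative integer \<open>n\<close> the terms with \<open>m + n + 1 \<le> 0\<close> vanish, since \<^const>\<open>rGamma\<close> is zero
  at the poles of \<^const>\<open>Gamma\<close>.
\<close>

definition bessel_I :: "int \<Rightarrow> real \<Rightarrow> real" where
  "bessel_I n z =
     (\<Sum>m. rGamma (real m + real_of_int n + 1) / fact m * (z / 2) powi (2 * int m + n))"

definition heat_kernel :: "real \<Rightarrow> int \<Rightarrow> real" where
  "heat_kernel t n = exp (- 2 * t) * bessel_I n (2 * t)"

definition heat_semigroup :: "real \<Rightarrow> (int \<Rightarrow> real) \<Rightarrow> int \<Rightarrow> real" where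
  "heat_semigroup t f n = (\<Sum>\<^sub>\<infinity>j. heat_kernel t (n - j) * f j)"

definition heat_semigroup_deriv :: "nat \<Rightarrow> real \<Rightarrow> (int \<Rightarrow> real) \<Rightarrow> int \<Rightarrow> real" where
  "heat_semigroup_deriv k t f n = (deriv ^^ k) (\<lambda>s. heat_semigroup s f n) t"

definition Lambda_H :: "real \<Rightarrow> ennreal \<Rightarrow> ennreal \<Rightarrow> (int \<Rightarrow> real) set" where
  "Lambda_H \<alpha> p q =
     {f. in_lq_mu q (\<lambda>n. f n / (1 + \<bar>real_of_int n\<bar> powr \<alpha>)) \<and>
         (let k = nat \<lfloor>\<alpha> / 2\<rfloor> + 1
          in mixed_norm p q
               (\<lambda>t n. t powr (real k - \<alpha> / 2) * heat_semigroup_deriv k t f n) < \<infinity>)}"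

definition ell_minus :: "real \<Rightarrow> (int \<Rightarrow> real) set" where
  "ell_minus \<beta> =
     {u. (\<lambda>m. \<bar>u m\<bar> / (1 + \<bar>real_of_int m\<bar>) powr (1 - 2 * \<beta>)) summable_on UNIV}"

definition neg_frac_laplacian :: "real \<Rightarrow> (int \<Rightarrow> real) \<Rightarrow> int \<Rightarrow> real" where
  "neg_frac_laplacian \<beta> f n =
     1 / Gamma \<beta> * (LBINT \<tau>:{0<..}. heat_semigroup \<tau> f n / \<tau> powr (1 - \<beta>))"

end

theory Submission
  imports Defs
begin

text \<open>
  Put \<open>h = \<Delta>\<^sup>l f\<close>, where \<open>\<Delta>\<close> is the discrete Laplacian. Time derivatives of the heat evolution are
  evolutions of iterated Laplacians, \<open>\<partial>\<^sub>t\<^sup>l e\<^sup>t\<^sup>\<Delta> f = e\<^sup>t\<^sup>\<Delta> h\<close>, and the potential operator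
  \<open>(-\<Delta>)\<^sup>-\<^sup>\<beta>\<close> commutes with \<open>\<Delta>\<close> and only averages over later times (\<open>heat_pot\<close>):
  \<open>e\<^sup>t\<^sup>\<Delta> (-\<Delta>)\<^sup>-\<^sup>\<beta> h = 1 / \<Gamma>(\<beta>) \<integral> e\<^sup>(\<^sup>t\<^sup>+\<^sup>\<tau>\<^sup>)\<^sup>\<Delta> h \<tau>\<^sup>\<beta>\<^sup>-\<^sup>1 d\<tau>\<close>. By Minkowski's inequality in
  \<open>\<ell>\<^sup>p\<close> (\<open>ell_minkowski\<close>) the \<open>\<ell>\<^sup>p\<close> norm of the left-hand side is at most the same average of
  \<open>v(s)\<close>, the \<open>\<ell>\<^sup>p\<close> norm of \<open>e\<^sup>s\<^sup>\<Delta> h\<close>. With \<open>a = l - \<alpha>/2\<close> and \<open>w(s) = s\<^sup>a v(s)\<close> the substitution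
  \<open>\<tau> = t\<rho>\<close> turns \<open>t\<^sup>a\<^sup>-\<^sup>\<beta>\<close> times that average into \<open>\<integral> \<kappa>(\<rho>) w(t(1+\<rho>)) d\<rho>\<close> with
  \<open>\<kappa>(\<rho>) = \<rho>\<^sup>\<beta>\<^sup>-\<^sup>1 (1+\<rho>)\<^sup>-\<^sup>a\<close>. Since \<open>dt/t\<close> is invariant under dilations and \<open>\<kappa>\<close> is integrable for
  \<open>a > \<beta> > 0\<close>, this average of dilates stays in \<open>L\<^sup>q(dt/t)\<close> (\<open>Lnorm_dt_average\<close>,
  \<open>weighted_pot_finite\<close>).

  The order \<open>l\<close> of the derivative that belongs to \<open>\<alpha> + 2\<beta>\<close> is either the order \<open>k\<close> that belongs to
  \<open>\<alpha>\<close>, or \<open>k + 1\<close>. In the second case \<open>w \<in> L\<^sup>q(dt/t)\<close> has to be deduced from the hypothesis on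
  derivatives of order \<open>k\<close>, by the smoothing estimate \<open>\<parallel>\<Delta> e\<^sup>s\<^sup>\<Delta> u\<parallel> \<le> (8/s) \<parallel>e\<^sup>(\<^sup>s\<^sup>/\<^sup>2\<^sup>)\<^sup>\<Delta> u\<parallel>\<close>
  for \<open>u = \<Delta>\<^sup>k f\<close> (\<open>heat_norm_lap_le\<close>). The Laplacian is a product of two differences, and one difference of the heat
  kernel \<open>G(t,\<cdot>)\<close> has \<open>\<ell>\<^sup>1\<close> norm \<open>2 G(t,0) \<le> 2 / sqrt(2t)\<close>, because \<open>G(t,\<cdot>)\<close> is even and decreases away from
  \<open>0\<close> (\<open>heat_delta_variation\<close>, \<open>heat_delta_0_le\<close>).

  The growth condition is a statement about the convolution kernel of \<open>(-\<Delta>)\<^sup>-\<^sup>\<beta>\<close>, which decays at least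
  like \<open>|n|\<^sup>2\<^sup>\<beta>\<^sup>-\<^sup>1\<close> (\<open>riesz_kernel_le\<close>). The contribution to site \<open>n\<close> of the values \<open>f(m)\<close> with \<open>|m|\<close> much larger
  than \<open>|n|\<close> is bounded, by the hypothesis \<open>f \<in> \<ell>\<^sub>-\<^sub>\<beta>\<close>; the remaining part of the kernel satisfies the
  conditions of Schur's test on \<open>\<ell>\<^sup>q(\<mu>)\<close> (\<open>near_rows\<close>, \<open>near_cols\<close>, \<open>schur_finite\<close>).

  All analysis of the semigroup rests on the series \<open>e\<^sup>t\<^sup>\<Delta> = e\<^sup>-\<^sup>2\<^sup>t \<Sum> t\<^sup>N/N! T\<^sup>N\<close>, where \<open>T\<close> adds
  the values at the two neighbours. It converges on sequences of quadratic growth and makes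
  differentiation and the semigroup law statements about power series; \<open>heat_kernel_eq\<close> identifies its
  kernel with the Bessel function kernel.
\<close>

section \<open>The heat semigroup as an exponential series\<close>

definition nbr :: "(int \<Rightarrow> real) \<Rightarrow> int \<Rightarrow> real" where
  "nbr h n = h (n + 1) + h (n - 1)"

definition lap :: "(int \<Rightarrow> real) \<Rightarrow> int \<Rightarrow> real" where
  "lap h n = h (n + 1) - 2 * h n + h (n - 1)"

text \<open>
  Quadratic growth covers everything to which the semigroup is applied: sequences in \<open>ell_minus\<close> and
  their potentials grow sublinearly, and \<open>1 + n\<^sup>2\<close> serves to compute the variance of the heat kernel.
  The weight \<open>1 + n\<^sup>2\<close> is multiplied by at most \<open>4\<close> under \<open>nbr\<close>, so the exponential series converges.
\<close>

definition quad :: "(int \<Rightarrow> real) \<Rightarrow> bool" where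
  "quad h \<longleftrightarrow> (\<exists>C. \<forall>n. \<bar>h n\<bar> \<le> C * (1 + (real_of_int n)\<^sup>2))"

text \<open>
  This is \<open>exp (t lap)\<close>, written as \<open>exp (- 2 t) exp (t nbr)\<close> since \<open>lap = nbr - 2\<close>. The operator \<open>nbr\<close>
  preserves nonnegativity, so for \<open>t \<ge> 0\<close> all series are controlled by those of \<open>\<bar>h\<bar>\<close>. The definition
  makes sense for every real \<open>t\<close>, hence derivatives in \<open>t\<close> are two-sided everywhere.
\<close>

definition heat :: "real \<Rightarrow> (int \<Rightarrow> real) \<Rightarrow> int \<Rightarrow> real" where
  "heat t h n = exp (- 2 * t) * (\<Sum>N. t ^ N / fact N * (nbr ^^ N) h n)"

definition delta :: "int \<Rightarrow> real" where
  "delta j = (if j = 0 then 1 else 0)"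

lemma quadI: "(\<And>n. \<bar>h n\<bar> \<le> C * (1 + (real_of_int n)\<^sup>2)) \<Longrightarrow> quad h"
  unfolding quad_def by blast

lemma quad_obtain:
  assumes "quad h"
  obtains C where "C \<ge> 0" "\<And>n. \<bar>h n\<bar> \<le> C * (1 + (real_of_int n)\<^sup>2)"
proof -
  obtain C where C: "\<And>n. \<bar>h n\<bar> \<le> C * (1 + (real_of_int n)\<^sup>2)" using assms unfolding quad_def by blast
  from C[of 0] have "C \<ge> 0" by simp
  then show ?thesis using C that by blast
qed

lemma quad_delta: "quad delta"
  by (rule quadI[where C=1]) (auto simp: delta_def)

lemma quad_add: assumes "quad h" "quad g" shows "quad (\<lambda>n. h n + g n)"
proof -
  obtain C D where "\<And>n. \<bar>h n\<bar> \<le> C * (1 + (real_of_int n)\<^sup>2)" "\<And>n. \<bar>g n\<bar> \<le> D * (1 + (real_of_int n)\<^sup>2)"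
    using assms unfolding quad_def by blast
  then have "\<bar>h n + g n\<bar> \<le> (C + D) * (1 + (real_of_int n)\<^sup>2)" for n
    by (smt (verit, best) distrib_right)
  then show ?thesis by (rule quadI)
qed

lemma quad_cmult: assumes "quad h" shows "quad (\<lambda>n. c * h n)"
proof -
  obtain C where "\<And>n. \<bar>h n\<bar> \<le> C * (1 + (real_of_int n)\<^sup>2)"
    using assms unfolding quad_def by blast
  then have "\<bar>c * h n\<bar> \<le> (\<bar>c\<bar> * C) * (1 + (real_of_int n)\<^sup>2)" for n
    by (simp add: abs_mult mult.assoc mult_left_mono)
  then show ?thesis by (rule quadI)
qed

lemma quad_shift: assumes "quad h" shows "quad (\<lambda>n. h (n + a))"
proof -
  obtain C where "C \<ge> 0" and C: "\<And>n. \<bar>h n\<bar> \<le> C * (1 + (real_of_int n)\<^sup>2)"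
    using quad_obtain[OF assms] by blast
  have "\<bar>h (n + a)\<bar> \<le> (C * (2 * (1 + (real_of_int a)\<^sup>2))) * (1 + (real_of_int n)\<^sup>2)" for n
  proof -
    have "1 + (real_of_int n + real_of_int a)\<^sup>2 \<le> 2 * (1 + (real_of_int a)\<^sup>2) * (1 + (real_of_int n)\<^sup>2)"
    proof -
      have "2 * real_of_int n * real_of_int a \<le> (real_of_int n)\<^sup>2 + (real_of_int a)\<^sup>2"
        by (rule sum_squares_bound)
      moreover have "0 \<le> (real_of_int n)\<^sup>2 * (real_of_int a)\<^sup>2" by simp
      moreover have "2 * (1 + (real_of_int a)\<^sup>2) * (1 + (real_of_int n)\<^sup>2)
        = 2 + 2 * (real_of_int a)\<^sup>2 + 2 * (real_of_int n)\<^sup>2 + 2 * ((real_of_int n)\<^sup>2 * (real_of_int a)\<^sup>2)"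
        by (simp add: algebra_simps)
      moreover have "(real_of_int n + real_of_int a)\<^sup>2 = (real_of_int n)\<^sup>2 + (real_of_int a)\<^sup>2 + 2 * real_of_int n * real_of_int a"
        by (rule power2_sum)
      ultimately show ?thesis by linarith
    qed
    then have "C * (1 + (real_of_int n + real_of_int a)\<^sup>2) \<le> C * (2 * (1 + (real_of_int a)\<^sup>2) * (1 + (real_of_int n)\<^sup>2))"
      using \<open>C \<ge> 0\<close> by (rule mult_left_mono)
    then show ?thesis using C[of "n + a"] by (simp add: mult.assoc)
  qed
  then show ?thesis by (rule quadI)
qed

lemma lap_eq_nbr: "lap h n = nbr h n - 2 * h n"
  by (simp add: lap_def nbr_def)

lemma quad_nbr: "quad h \<Longrightarrow> quad (nbr h)"
  using quad_add[OF quad_shift[of h 1] quad_shift[of h "-1"]] by (simp add: nbr_def[abs_def])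

lemma quad_lap: "quad h \<Longrightarrow> quad (lap h)"
  using quad_add[OF quad_nbr[of h] quad_cmult[of h "-2"]] by (simp add: lap_eq_nbr[abs_def])

lemma quad_lap_pow: "quad h \<Longrightarrow> quad ((lap ^^ k) h)"
  by (induction k) (auto intro: quad_lap)

lemma nbr_pow_bound:
  assumes "\<And>n. \<bar>h n\<bar> \<le> C * (1 + (real_of_int n)\<^sup>2)"
  shows "\<bar>(nbr ^^ N) h n\<bar> \<le> C * 4 ^ N * (1 + (real_of_int n)\<^sup>2)"
proof (induction N arbitrary: n)
  case (Suc N)
  have "0 \<le> C" using assms[of 0] by simp
  have "\<bar>(nbr ^^ Suc N) h n\<bar> \<le> \<bar>(nbr ^^ N) h (n + 1)\<bar> + \<bar>(nbr ^^ N) h (n - 1)\<bar>"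
    by (simp add: nbr_def)
  also have "\<dots> \<le> C * 4 ^ N * (1 + (real_of_int (n + 1))\<^sup>2) + C * 4 ^ N * (1 + (real_of_int (n - 1))\<^sup>2)"
    by (intro add_mono Suc.IH)
  also have "\<dots> = C * 4 ^ N * (4 + 2 * (real_of_int n)\<^sup>2)"
    by (simp add: power2_eq_square algebra_simps)
  also have "\<dots> \<le> C * 4 ^ N * (4 * (1 + (real_of_int n)\<^sup>2))"
    using \<open>0 \<le> C\<close> by (intro mult_left_mono) auto
  finally show ?case by (simp only: power_Suc mult.assoc mult.left_commute[of 4])
qed (use assms in auto)

lemma nbr_nonneg: "(\<And>n. h n \<ge> 0) \<Longrightarrow> (nbr ^^ N) h n \<ge> 0"
  by (induction N arbitrary: n) (auto simp: nbr_def)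

lemma nbr_pow_add: "(nbr ^^ N) (\<lambda>n. h n + g n) n = (nbr ^^ N) h n + (nbr ^^ N) g n"
  by (induction N arbitrary: n) (auto simp: nbr_def)

lemma nbr_pow_cmult: "(nbr ^^ N) (\<lambda>n. c * h n) n = c * (nbr ^^ N) h n"
  by (induction N arbitrary: n) (auto simp: nbr_def algebra_simps)

lemma nbr_pow_shift: "(nbr ^^ N) (\<lambda>n. h (n + a)) n = (nbr ^^ N) h (n + a)"
  by (induction N arbitrary: n) (auto simp: nbr_def algebra_simps)

lemma nbr_pow_Suc: "(nbr ^^ Suc N) h = (nbr ^^ N) (nbr h)"
  by (simp only: funpow_Suc_right o_apply)

lemma heat_summable:
  assumes "quad h"
  shows "summable (\<lambda>N. norm (t ^ N / fact N * (nbr ^^ N) h n))"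
proof -
  obtain C where C: "\<And>n. \<bar>h n\<bar> \<le> C * (1 + (real_of_int n)\<^sup>2)"
    using assms unfolding quad_def by blast
  show ?thesis
  proof (rule summable_comparison_test)
    show "\<exists>N0. \<forall>N\<ge>N0. norm (norm (t ^ N / fact N * (nbr ^^ N) h n))
        \<le> (C * (1 + (real_of_int n)\<^sup>2)) * ((4 * \<bar>t\<bar>) ^ N /\<^sub>R fact N)"
    proof (intro exI allI impI)
      fix N
      have "\<bar>t\<bar> ^ N / fact N * \<bar>(nbr ^^ N) h n\<bar> \<le> \<bar>t\<bar> ^ N / fact N * (C * 4 ^ N * (1 + (real_of_int n)\<^sup>2))"
        by (intro mult_left_mono nbr_pow_bound C) auto
      then show "norm (norm (t ^ N / fact N * (nbr ^^ N) h n))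
        \<le> (C * (1 + (real_of_int n)\<^sup>2)) * ((4 * \<bar>t\<bar>) ^ N /\<^sub>R fact N)"
        by (simp add: abs_mult power_abs power_mult_distrib divide_inverse mult_ac)
    qed
    show "summable (\<lambda>N. (C * (1 + (real_of_int n)\<^sup>2)) * ((4 * \<bar>t\<bar>) ^ N /\<^sub>R fact N))"
      by (intro summable_mult summable_exp_generic)
  qed
qed

lemmas heat_summable_real = summable_norm_cancel[OF heat_summable]

lemma heat_sums:
  assumes "quad h"
  shows "(\<lambda>N. t ^ N / fact N * (nbr ^^ N) h n) sums (exp (2 * t) * heat t h n)"
  using summable_sums[OF heat_summable_real[OF assms]] by (simp add: heat_def mult.assoc[symmetric] exp_minus)

lemma heat_unique:
  assumes "(\<lambda>N. t ^ N / fact N * (nbr ^^ N) h n) sums s"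
  shows "heat t h n = exp (- 2 * t) * s"
  using sums_unique[OF assms] by (simp add: heat_def)

lemma exp_cancel: "exp (- 2 * t) * (exp (2 * t) * x) = (x::real)"
  by (simp add: mult.assoc[symmetric] exp_add[symmetric])

lemma heat_add:
  assumes "quad h" "quad g"
  shows "heat t (\<lambda>n. h n + g n) n = heat t h n + heat t g n"
proof -
  have "heat t (\<lambda>n. h n + g n) n = exp (- 2 * t) * (exp (2 * t) * heat t h n + exp (2 * t) * heat t g n)"
    using sums_add[OF heat_sums[OF assms(1)] heat_sums[OF assms(2)], of t n t n]
    by (intro heat_unique) (simp add: nbr_pow_add distrib_left)
  then show ?thesis by (simp only: distrib_left exp_cancel)
qed

lemma heat_cmult:
  assumes "quad h"
  shows "heat t (\<lambda>n. c * h n) n = c * heat t h n"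
proof -
  have "heat t (\<lambda>n. c * h n) n = exp (- 2 * t) * (c * (exp (2 * t) * heat t h n))"
    using sums_mult[OF heat_sums[OF assms(1)], of c t n]
    by (intro heat_unique) (simp add: nbr_pow_cmult mult_ac)
  then show ?thesis by (simp only: mult.left_commute[of c] exp_cancel)
qed

lemma heat_shift: "heat t (\<lambda>n. h (n + a)) n = heat t h (n + a)"
  by (simp add: heat_def nbr_pow_shift)

lemma heat_diff:
  assumes "quad h" "quad g"
  shows "heat t (\<lambda>n. h n - g n) n = heat t h n - heat t g n"
  using heat_add[OF assms(1) quad_cmult[OF assms(2), of "-1"]] heat_cmult[OF assms(2), of t "-1"] by simp

lemma heat_nbr:
  assumes "quad h" shows "heat t (nbr h) n = nbr (heat t h) n"
  using heat_add[OF quad_shift[OF assms, of 1] quad_shift[OF assms, of "-1"], of t n]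
  by (simp add: nbr_def[abs_def] heat_shift[of t h 1] heat_shift[of t h "-1", simplified])

lemma heat_lap:
  assumes "quad h" shows "heat t (lap h) n = lap (heat t h) n"
  using heat_diff[OF quad_nbr[OF assms] quad_cmult[OF assms, of 2], of t n] heat_cmult[OF assms, of t 2 n]
  by (simp add: lap_eq_nbr[abs_def] heat_nbr[OF assms])

lemma heat_0: "quad h \<Longrightarrow> heat 0 h n = h n"
proof -
  have "(\<lambda>N. 0 ^ N / fact N * (nbr ^^ N) h n) sums (\<Sum>N\<in>{0}. 0 ^ N / fact N * (nbr ^^ N) h n)"
    by (rule sums_finite) auto
  then show ?thesis using heat_unique[of 0 h n] by simp
qed

lemma heat_nonneg: assumes "quad h" "t \<ge> 0" "\<And>n. h n \<ge> 0" shows "heat t h n \<ge> 0"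
proof -
  have "0 \<le> exp (2 * t) * heat t h n"
    using sums_le[OF _ sums_zero heat_sums[OF assms(1)]] assms nbr_nonneg[of h] by simp
  then show ?thesis by (simp add: zero_le_mult_iff)
qed

lemma heat_mono:
  assumes "quad h" "quad g" "t \<ge> 0" "\<And>n. h n \<le> g n" shows "heat t h n \<le> heat t g n"
proof -
  have "0 \<le> heat t (\<lambda>n. g n - h n) n"
    using assms quad_add[OF assms(2) quad_cmult[OF assms(1), of "-1"]] by (intro heat_nonneg) auto
  then show ?thesis using heat_diff[OF assms(2,1)] by simp
qed

text \<open>
  Termwise differentiation of the power series \<open>exp (2 t) heat t h n\<close> replaces \<open>h\<close> by \<open>nbr h\<close>; the
  factor \<open>exp (- 2 t)\<close> contributes the remaining \<open>- 2 h\<close> of the Laplacian.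
\<close>

lemma heat_has_derivative:
  assumes "quad h"
  shows "((\<lambda>t. heat t h n) has_field_derivative heat t (lap h) n) (at t)"
proof -
  define c where "c N = (nbr ^^ N) h n / fact N" for N
  have e: "(\<Sum>N. c N * s ^ N) = exp (2 * s) * heat s h n" for s
    using sums_unique[OF heat_sums[OF assms, of s n]] by (simp add: c_def mult_ac)
  have "((\<lambda>s. \<Sum>N. c N * s ^ N) has_field_derivative (\<Sum>N. diffs c N * t ^ N)) (at t)"
  proof (rule termdiffs_strong_converges_everywhere)
    fix y show "summable (\<lambda>N. c N * y ^ N)"
      using heat_summable_real[OF assms, of y n] by (simp add: c_def mult_ac)
  qed
  moreover have "diffs c N * t ^ N = t ^ N / fact N * (nbr ^^ N) (nbr h) n" for N
    unfolding diffs_def c_def nbr_pow_Suc[of N h] fact_Suc by (simp del: of_nat_Suc)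
  ultimately have d: "((\<lambda>s. exp (2 * s) * heat s h n) has_field_derivative
      exp (2 * t) * heat t (nbr h) n) (at t)"
    using sums_unique[OF heat_sums[OF quad_nbr[OF assms], of t n]] by (simp add: e)
  have "((\<lambda>s. exp (- 2 * s) * (exp (2 * s) * heat s h n)) has_field_derivative
      exp (- 2 * t) * (exp (2 * t) * heat t (nbr h) n) + (exp (- 2 * t) * (- 2)) * (exp (2 * t) * heat t h n)) (at t)"
    by (rule DERIV_cong[OF DERIV_mult[OF _ d]]) (auto intro!: derivative_eq_intros)
  moreover have "heat t (lap h) n = heat t (nbr h) n - 2 * heat t h n"
    using heat_lap[OF assms] heat_nbr[OF assms] by (simp add: lap_eq_nbr)
  moreover have "(exp (- 2 * t) * (- 2)) * (exp (2 * t) * heat t h n) = - 2 * heat t h n"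
    by (simp only: mult.assoc mult.left_commute[of "-2"] exp_cancel)
  ultimately show ?thesis by (simp only: exp_cancel) simp
qed

lemma heat_continuous: "quad h \<Longrightarrow> continuous_on A (\<lambda>t. heat t h n)"
  by (rule DERIV_continuous_on[OF has_field_derivative_at_within[OF heat_has_derivative]])

lemma heat_measurable: "quad h \<Longrightarrow> (\<lambda>t. heat t h n) \<in> borel_measurable borel"
  by (rule borel_measurable_continuous_onI[OF heat_continuous])

lemma heat_abs_le:
  assumes "quad h" "t \<ge> 0" shows "\<bar>heat t h n\<bar> \<le> heat t (\<lambda>n. \<bar>h n\<bar>) n"
proof -
  have q: "quad (\<lambda>n. \<bar>h n\<bar>)" using assms unfolding quad_def by simp
  have "heat t (\<lambda>n. - 1 * h n) n = - heat t h n" using heat_cmult[OF assms(1), of t "-1"] by simp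
  then show ?thesis
    using heat_mono[OF assms(1) q assms(2)] heat_mono[OF quad_cmult[OF assms(1), of "-1"] q assms(2)]
    by (smt (verit))
qed

text \<open>
  Explicit solution of the heat equation for data whose Laplacian does not change in time. It gives
  the mass \<open>1\<close> (\<open>heat_const\<close>) and the variance \<open>2 t\<close> (\<open>heat_sq\<close>) of the heat kernel.
\<close>

lemma heat_const_deriv:
  assumes "quad h" "\<And>s. heat s (lap h) n = c" shows "heat t h n = h n + c * t"
proof -
  have "((\<lambda>t. heat t h n - c * t) has_field_derivative 0) (at t)" for t
    using heat_has_derivative[OF assms(1), of n t] assms(2)
    by (auto intro!: derivative_eq_intros)
  then have "heat t h n - c * t = heat 0 h n - c * 0"
    using DERIV_isconst_all[of "\<lambda>t. heat t h n - c * t" t 0] by simp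
  then show ?thesis using heat_0[OF assms(1)] by simp
qed

lemma heat_zero: "heat t (\<lambda>n. 0) n = 0"
  using heat_cmult[OF quad_delta, of t 0 n] by simp

lemma quad_const: "quad (\<lambda>n. c)"
  by (rule quadI[where C="\<bar>c\<bar>"]) (auto simp: algebra_simps)

lemma heat_const: "heat t (\<lambda>n. c) n = c"
proof -
  have "heat t (\<lambda>n. c) n = c + 0 * t"
    by (rule heat_const_deriv[OF quad_const]) (simp add: lap_def[abs_def] heat_zero)
  then show ?thesis by simp
qed

lemma quad_sq: "quad (\<lambda>n. 1 + (real_of_int n)\<^sup>2)"
  by (rule quadI[where C=1]) simp

lemma heat_sq: "heat t (\<lambda>n. 1 + (real_of_int n)\<^sup>2) n = 1 + (real_of_int n)\<^sup>2 + 2 * t"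
proof (rule heat_const_deriv[OF quad_sq])
  fix s
  have "lap (\<lambda>n. 1 + (real_of_int n)\<^sup>2) = (\<lambda>n. 2)"
    by (auto simp: lap_def power2_eq_square algebra_simps)
  then show "heat s (lap (\<lambda>n. 1 + (real_of_int n)\<^sup>2)) n = 2" by (simp add: heat_const)
qed

lemma quad_heat: assumes "quad h" "t \<ge> 0" shows "quad (heat t h)"
proof -
  obtain C where C: "C \<ge> 0" "\<And>n. \<bar>h n\<bar> \<le> C * (1 + (real_of_int n)\<^sup>2)" using quad_obtain[OF assms(1)] by blast
  have "\<bar>heat t h n\<bar> \<le> (C * (1 + 2 * t)) * (1 + (real_of_int n)\<^sup>2)" for n
  proof -
    have "\<bar>heat t h n\<bar> \<le> heat t (\<lambda>n. \<bar>h n\<bar>) n" by (rule heat_abs_le[OF assms])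
    also have "\<dots> \<le> heat t (\<lambda>n. C * (1 + (real_of_int n)\<^sup>2)) n"
      using assms C(2) by (intro heat_mono quad_cmult quad_sq) (auto simp: quad_def)
    also have "\<dots> = C * (1 + (real_of_int n)\<^sup>2 + 2 * t)" by (simp only: heat_cmult[OF quad_sq] heat_sq)
    also have "\<dots> \<le> C * ((1 + 2 * t) * (1 + (real_of_int n)\<^sup>2))"
      using C(1) assms(2) by (intro mult_left_mono) (auto simp: algebra_simps)
    finally show ?thesis by (simp add: mult.assoc)
  qed
  then show ?thesis by (rule quadI)
qed

lemma heat_deriv_pow:
  assumes "quad h"
  shows "(deriv ^^ k) (\<lambda>s. heat s h n) = (\<lambda>t. heat t ((lap ^^ k) h) n)"
proof (induction k)
  case (Suc k)
  show ?case
    using DERIV_imp_deriv[OF heat_has_derivative[OF quad_lap_pow[OF assms, of k], of n]] Suc by auto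
qed auto

section \<open>Convolution with the Bessel kernel, and the semigroup law\<close>

text \<open>
  Fubini's theorem for double series, with absolute convergence expressed through row sums.
\<close>

lemma has_sum_interchange:
  fixes F :: "'a \<Rightarrow> 'b \<Rightarrow> real"
  assumes abs: "\<And>x. ((\<lambda>y. \<bar>F x y\<bar>) has_sum a x) UNIV" "a summable_on UNIV"
    and rows: "\<And>x. ((\<lambda>y. F x y) has_sum r x) UNIV" "(r has_sum S) UNIV"
    and cols: "\<And>y. ((\<lambda>x. F x y) has_sum c y) UNIV"
  shows "(c has_sum S) UNIV"
proof -
  have "(\<lambda>(x, y). \<bar>F x y\<bar>) summable_on (SIGMA x:UNIV. UNIV)"
    by (rule summable_on_SigmaI[where g = a]) (use abs in auto)
  then have "Infinite_Sum.abs_summable_on (\<lambda>(x, y). F x y) (SIGMA x:UNIV. UNIV)"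
    by (simp add: case_prod_unfold)
  then have s: "(\<lambda>(x, y). F x y) summable_on (SIGMA x:UNIV. UNIV)"
    by (rule abs_summable_summable)
  have "((\<lambda>(x, y). F x y) has_sum S) (SIGMA x:UNIV. UNIV)"
    by (rule has_sum_SigmaI[OF _ rows(2) s]) (use rows in auto)
  then have "((\<lambda>(y, x). F x y) has_sum S) (SIGMA y:UNIV. UNIV)"
    by (subst has_sum_reindex_bij_witness[where i = prod.swap and j = prod.swap
          and h = "\<lambda>(x, y). F x y" and T = "SIGMA x:UNIV. UNIV" and s' = S]) auto
  then show ?thesis
    by (rule has_sum_SigmaD) (use cols in auto)
qed

text \<open>
  The operator \<open>nbr\<close> commutes with translations, so its powers are convolutions with their response to
  the unit impulse.
\<close>

lemma nbr_pow_delta_has_sum: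
  "((\<lambda>j. (nbr ^^ N) delta (n - j) * h j) has_sum (nbr ^^ N) h n) UNIV"
proof (induction N arbitrary: n)
  case 0
  have "((\<lambda>j. delta (n - j) * h j) has_sum h n) {n}"
    by (rule has_sum_finiteI) (auto simp: delta_def)
  then have "((\<lambda>j. delta (n - j) * h j) has_sum h n) UNIV"
    by (subst has_sum_cong_neutral[where T = "{n}" and g = "\<lambda>j. delta (n - j) * h j"]) (auto simp: delta_def)
  then show ?case by simp
next
  case (Suc N)
  have "(nbr ^^ Suc N) delta (n - j) * h j =
      (nbr ^^ N) delta (n + 1 - j) * h j + (nbr ^^ N) delta (n - 1 - j) * h j" for j
    by (simp add: nbr_def algebra_simps)
  moreover have "(nbr ^^ Suc N) h n = (nbr ^^ N) h (n + 1) + (nbr ^^ N) h (n - 1)"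
    by (simp add: nbr_def)
  ultimately show ?case
    using has_sum_add[OF Suc.IH[of "n + 1"] Suc.IH[of "n - 1"]] by (simp only:)
qed

lemma quad_abs: "quad h \<Longrightarrow> quad (\<lambda>n. \<bar>h n\<bar>)"
  by (simp add: quad_def)

lemma heat_has_sum_series:
  assumes "quad h"
  shows "((\<lambda>N. t ^ N / fact N * (nbr ^^ N) h n) has_sum (exp (2 * t) * heat t h n)) UNIV"
  by (rule norm_summable_imp_has_sum[OF heat_summable[OF assms] heat_sums[OF assms]])

lemma heat_has_sum:
  assumes "0 \<le> t" "quad h"
  shows "((\<lambda>j. heat t delta (n - j) * h j) has_sum heat t h n) UNIV"
proof -
  have nn: "(nbr ^^ N) delta j \<ge> 0" for N j by (rule nbr_nonneg) (simp add: delta_def)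
  have "((\<lambda>j. (exp (2 * t) * heat t delta (n - j)) * h j) has_sum (exp (2 * t) * heat t h n)) UNIV"
  proof (rule has_sum_interchange[where F = "\<lambda>N j. t ^ N / fact N * ((nbr ^^ N) delta (n - j) * h j)"])
    show "((\<lambda>j. \<bar>t ^ N / fact N * ((nbr ^^ N) delta (n - j) * h j)\<bar>) has_sum
        t ^ N / fact N * (nbr ^^ N) (\<lambda>n. \<bar>h n\<bar>) n) UNIV" for N
      using has_sum_cmult_right[OF nbr_pow_delta_has_sum[of N n "\<lambda>n. \<bar>h n\<bar>"], of "t ^ N / fact N"] assms(1) nn
      by (simp add: abs_mult)
    show "(\<lambda>N. t ^ N / fact N * (nbr ^^ N) (\<lambda>n. \<bar>h n\<bar>) n) summable_on UNIV"
      using heat_has_sum_series[OF quad_abs[OF assms(2)]] summable_on_def by blast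
    show "((\<lambda>j. t ^ N / fact N * ((nbr ^^ N) delta (n - j) * h j)) has_sum
        t ^ N / fact N * (nbr ^^ N) h n) UNIV" for N
      by (rule has_sum_cmult_right[OF nbr_pow_delta_has_sum])
    show "((\<lambda>N. t ^ N / fact N * (nbr ^^ N) h n) has_sum (exp (2 * t) * heat t h n)) UNIV"
      by (rule heat_has_sum_series[OF assms(2)])
    show "((\<lambda>N. t ^ N / fact N * ((nbr ^^ N) delta (n - j) * h j)) has_sum
        (exp (2 * t) * heat t delta (n - j)) * h j) UNIV" for j
      using has_sum_cmult_left[OF heat_has_sum_series[OF quad_delta], of t "n - j" "h j"]
      by (simp only: mult.assoc)
  qed
  from has_sum_cmult_right[OF this, of "exp (- 2 * t)"]
  show ?thesis by (simp only: mult.assoc exp_cancel)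
qed

lemma heat_nbr_pow: "quad h \<Longrightarrow> heat t ((nbr ^^ N) h) n = (nbr ^^ N) (heat t h) n"
proof (induction N arbitrary: h)
  case (Suc N)
  have "heat t (nbr h) = nbr (heat t h)" using heat_nbr[OF Suc.prems] by auto
  then show ?case using Suc.IH[OF quad_nbr[OF Suc.prems]] by (simp only: nbr_pow_Suc)
qed simp

text \<open>
  Expanding both exponential series gives a double series in \<open>(N, M)\<close> whose terms contain \<open>h\<close> only
  through \<open>nbr\<^sup>N\<^sup>+\<^sup>M h\<close>. Summing along the diagonals \<open>N + M = k\<close> produces \<open>(t + s)\<^sup>k\<close> by the binomial
  theorem. Absolute convergence comes from the quadratic growth of \<open>h\<close>, with majorant
  \<open>(4t)\<^sup>N/N! (4s)\<^sup>M/M!\<close>.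
\<close>

lemma heat_semigroup_law:
  assumes "quad h" "0 \<le> t" "0 \<le> s"
  shows "heat t (heat s h) n = heat (t + s) h n"
proof -
  let ?S = "exp (2 * t) * (exp (2 * s) * heat t (heat s h) n)"
  define x where "x k = (nbr ^^ k) h n" for k
  define F where "F N M = t ^ N / fact N * (s ^ M / fact M * x (N + M))" for N M
  obtain C where C: "C \<ge> 0" "\<And>n. \<bar>h n\<bar> \<le> C * (1 + (real_of_int n)\<^sup>2)" using quad_obtain[OF assms(1)] by blast
  define D where "D = C * (1 + (real_of_int n)\<^sup>2)"
  have D: "D \<ge> 0" using C by (simp add: D_def)
  have x: "\<bar>x k\<bar> \<le> D * 4 ^ k" for k
    using nbr_pow_bound[of h C k n] C by (simp add: x_def D_def mult_ac)
  have ex: "((\<lambda>M. r ^ M / fact M) has_sum exp r) UNIV" if "r \<ge> 0" for r :: real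
    using that exp_converges[of r] by (intro sums_nonneg_imp_has_sum) (auto simp: divide_inverse mult.commute)
  have "(\<lambda>(N, M). (4 * t) ^ N / fact N * ((4 * s) ^ M / fact M) * D) summable_on (SIGMA N:UNIV. UNIV)"
  proof (rule summable_on_SigmaI[where g = "\<lambda>N. (4 * t) ^ N / fact N * (exp (4 * s) * D)"])
    show "((\<lambda>y. case (N, y) of (N, M) \<Rightarrow> (4 * t) ^ N / fact N * ((4 * s) ^ M / fact M) * D) has_sum
       (4 * t) ^ N / fact N * (exp (4 * s) * D)) UNIV" for N
      using has_sum_cmult_right[OF has_sum_cmult_left[OF ex[of "4 * s"], of D], of "(4 * t) ^ N / fact N"] assms(3)
      by (simp add: mult.assoc)
    show "(\<lambda>N. (4 * t) ^ N / fact N * (exp (4 * s) * D)) summable_on UNIV"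
      using has_sum_cmult_left[OF ex[of "4 * t"], of "exp (4 * s) * D"] assms(2) summable_on_def by auto
  qed (use D assms in auto)
  then have "Infinite_Sum.abs_summable_on (\<lambda>(N, M). (4 * t) ^ N / fact N * ((4 * s) ^ M / fact M) * D) (SIGMA N:UNIV. UNIV)"
    using D assms by (simp add: case_prod_unfold)
  then have "Infinite_Sum.abs_summable_on (\<lambda>(N, M). F N M) (SIGMA N:UNIV. UNIV)"
  proof (rule Infinite_Sum.abs_summable_on_comparison_test)
    have "\<bar>F N M\<bar> \<le> (4 * t) ^ N / fact N * ((4 * s) ^ M / fact M) * D" for N M
    proof -
      have "\<bar>F N M\<bar> = (t ^ N / fact N * (s ^ M / fact M)) * \<bar>x (N + M)\<bar>"
        using assms by (simp add: F_def abs_mult)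
      also have "\<dots> \<le> (t ^ N / fact N * (s ^ M / fact M)) * (D * 4 ^ (N + M))"
        using assms by (intro mult_left_mono x) auto
      also have "\<dots> = (4 * t) ^ N / fact N * ((4 * s) ^ M / fact M) * D"
        by (simp add: power_mult_distrib power_add)
      finally show ?thesis .
    qed
    then show "norm (case y of (N, M) \<Rightarrow> F N M) \<le> norm (case y of (N, M) \<Rightarrow> (4 * t) ^ N / fact N * ((4 * s) ^ M / fact M) * D)" for y
      using D assms by (auto simp: case_prod_unfold)
  qed
  then have sF: "(\<lambda>(N, M). F N M) summable_on (SIGMA N:UNIV. UNIV)"
    by (rule abs_summable_summable)
  have "((\<lambda>(N, M). F N M) has_sum ?S) (SIGMA N:UNIV. UNIV)"
  proof (rule has_sum_SigmaI[OF _ _ sF])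
    show "((\<lambda>M. case (N, M) of (N, M) \<Rightarrow> F N M) has_sum t ^ N / fact N * (exp (2 * s) * (nbr ^^ N) (heat s h) n)) UNIV" for N
    proof -
      have "(nbr ^^ M) ((nbr ^^ N) h) n = x (N + M)" for M
        by (simp add: x_def funpow_add[symmetric] add.commute flip: o_apply[of "nbr ^^ M"])
      moreover have "quad ((nbr ^^ N) h)" by (induction N) (auto intro: quad_nbr assms)
      ultimately have "((\<lambda>M. s ^ M / fact M * x (N + M)) has_sum exp (2 * s) * heat s ((nbr ^^ N) h) n) UNIV"
        using heat_has_sum_series[of "(nbr ^^ N) h" s n] by simp
      from has_sum_cmult_right[OF this, of "t ^ N / fact N"] show ?thesis
        by (simp add: F_def heat_nbr_pow[OF assms(1)])
    qed
    have "((\<lambda>N. exp (2 * s) * (t ^ N / fact N * (nbr ^^ N) (heat s h) n)) has_sum exp (2 * s) * (exp (2 * t) * heat t (heat s h) n)) UNIV"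
      by (intro has_sum_cmult_right heat_has_sum_series quad_heat assms)
    then show "((\<lambda>N. t ^ N / fact N * (exp (2 * s) * (nbr ^^ N) (heat s h) n)) has_sum ?S) UNIV"
      by (simp only: mult.left_commute)
  qed
  then have *: "((\<lambda>(k, N). F N (k - N)) has_sum ?S) (SIGMA k:UNIV. {..k})"
    by (subst has_sum_reindex_bij_witness[where j = "\<lambda>(k, N). (N, k - N)" and i = "\<lambda>(N, M). (N + M, N)"
          and h = "\<lambda>(N, M). F N M" and T = "SIGMA N:UNIV. UNIV"
          and s' = ?S]) auto
  have "((\<lambda>k. (t + s) ^ k / fact k * x k) has_sum ?S) UNIV"
  proof (rule has_sum_SigmaD[OF *])
    fix k
    have "(\<Sum>N\<le>k. F N (k - N)) = (\<Sum>N\<le>k. (t ^ N /\<^sub>R fact N) * (s ^ (k - N) /\<^sub>R fact (k - N))) * x k"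
      unfolding sum_distrib_right by (rule sum.cong) (auto simp: F_def divide_inverse mult_ac)
    also have "\<dots> = (t + s) ^ k / fact k * x k"
      using exp_series_add_commuting[of t s k] by (simp add: divide_inverse mult_ac)
    finally show "((\<lambda>y. case (k, y) of (k, N) \<Rightarrow> F N (k - N)) has_sum (t + s) ^ k / fact k * x k) {..k}"
      by (intro has_sum_finiteI) auto
  qed
  then have "?S = exp (2 * (t + s)) * heat (t + s) h n"
    using heat_has_sum_series[OF assms(1), of "t + s" n] has_sum_unique unfolding x_def by blast
  then have "exp (2 * (t + s)) * heat t (heat s h) n = exp (2 * (t + s)) * heat (t + s) h n"
    by (simp add: exp_add[symmetric] mult.assoc[symmetric] distrib_left)
  then show ?thesis by simp
qed

text \<open>
  Pascal's triangle: of \<open>N\<close> steps of length one, \<open>k\<close> go to the right and end at \<open>2k - N\<close>; sites of the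
  other parity are not reached.
\<close>

lemma nbr_pow_delta:
  "(nbr ^^ N) delta (2 * k - int N) = (if 0 \<le> k then of_nat (N choose nat k) else 0)"
  "(nbr ^^ N) delta (2 * k - int N + 1) = 0"
proof (induction N arbitrary: k)
  case 0
  { case 1 show ?case by (cases "nat k") (auto simp: delta_def) }
  { case 2
    have "2 * k + 1 \<noteq> 0" by presburger
    then show ?case by (auto simp: delta_def) }
next
  case (Suc N)
  have e: "(nbr ^^ Suc N) delta m = (nbr ^^ N) delta (m + 1) + (nbr ^^ N) delta (m - 1)" for m
    by (simp add: nbr_def)
  have *: "(nbr ^^ Suc N) delta (2 * k - int (Suc N)) = (if 0 \<le> k then of_nat (Suc N choose nat k) else 0)" for k
  proof -
    have "2 * k - int (Suc N) + 1 = 2 * k - int N" "2 * k - int (Suc N) - 1 = 2 * (k - 1) - int N" by auto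
    then have "(nbr ^^ Suc N) delta (2 * k - int (Suc N)) = (nbr ^^ N) delta (2 * k - int N) + (nbr ^^ N) delta (2 * (k - 1) - int N)"
      unfolding e by (simp only:)
    also have "\<dots> = (if 0 \<le> k then of_nat (Suc N choose nat k) else 0)"
    proof (cases "k \<ge> 1")
      case True
      then have "nat k = Suc (nat (k - 1))" by auto
      then show ?thesis using True unfolding Suc.IH by simp
    next
      case False
      then show ?thesis unfolding Suc.IH by (cases "k = 0") auto
    qed
    finally show ?thesis .
  qed
  { case 1 show ?case by (rule *) }
  have **: "(nbr ^^ Suc N) delta (2 * k - int (Suc N) + 1) = 0" for k
  proof -
    have "2 * k - int (Suc N) + 1 + 1 = 2 * k - int N + 1" "2 * k - int (Suc N) + 1 - 1 = 2 * (k - 1) - int N + 1" by auto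
    then show ?thesis
      unfolding e using Suc.IH by (simp only:)
  qed
  { case 2 show ?case by (rule **) }
qed

text \<open>
  The index \<open>m\<close> of the Bessel series counts steps to the left, so the corresponding term of the
  exponential series has \<open>N = 2m + n\<close> steps. Terms of the exponential series that are not of this form
  vanish by \<open>nbr_pow_delta\<close>, and Bessel terms with \<open>m + n < 0\<close> vanish because of the reciprocal Gamma
  function.
\<close>

lemma heat_kernel_eq:
  assumes "t > 0" shows "heat_kernel t n = heat t delta n"
proof -
  define c where "c N = t ^ N / fact N * (nbr ^^ N) delta n" for N
  define A where "A = {m::nat. 0 \<le> int m + n}"
  \<comment> \<open>the number of steps that belongs to the Bessel index \<open>m\<close>\<close>
  define e where "e m = nat (2 * int m + n)" for m
  have inj: "inj_on e A" by (auto simp: inj_on_def A_def e_def)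
  have c0: "c N = 0" if "N \<notin> e ` A" for N
  proof (cases "even (n + int N)")
    case True
    then obtain k where "n + int N = 2 * k" by (elim evenE)
    then have k: "n = 2 * k - int N" by simp
    show ?thesis
    proof (cases "0 \<le> k \<and> k \<le> int N")
      case True
      then have "nat (int N - k) \<in> A" "e (nat (int N - k)) = N" using k by (auto simp: A_def e_def)
      then show ?thesis using that by (metis imageI)
    next
      case False
      then show ?thesis unfolding c_def k nbr_pow_delta by auto
    qed
  next
    case False
    then obtain k where "n + int N = 2 * k + 1" by (elim oddE)
    then have k: "n = 2 * k - int N + 1" by simp
    show ?thesis unfolding c_def k nbr_pow_delta by simp
  qed
  have "(c has_sum (exp (2 * t) * heat t delta n)) UNIV"
    unfolding c_def by (rule heat_has_sum_series[OF quad_delta])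
  then have "(c has_sum (exp (2 * t) * heat t delta n)) (e ` A)"
    by (subst has_sum_cong_neutral[where T = UNIV and g = c]) (auto simp: c0)
  then have *: "((c \<circ> e) has_sum (exp (2 * t) * heat t delta n)) A"
    by (simp only: has_sum_reindex[OF inj])
  define T where "T m = rGamma (real m + real_of_int n + 1) / fact m * (2 * t / 2) powi (2 * int m + n)" for m :: nat
  have T0: "T m = 0" if "m \<notin> A" for m
  proof -
    have "rGamma (real m + real_of_int n + 1) = rGamma (of_int (int m + n + 1))" by simp
    also have "\<dots> = 0" using that unfolding rGamma_of_int by (auto simp: A_def)
    finally show ?thesis by (simp add: T_def)
  qed
  have T1: "(c \<circ> e) m = T m" if "m \<in> A" for m
  proof -
    define r where "r = nat (int m + n)"
    have n: "n = int r - int m" using that by (simp add: r_def A_def)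
    have "rGamma (real m + real_of_int n + 1) = rGamma (of_int (int r + 1))" by (simp add: n)
    also have "\<dots> = inverse (fact r)" unfolding rGamma_of_int by simp
    finally have 1: "rGamma (real m + real_of_int n + 1) = inverse (fact r)" .
    have 2: "(2 * t / 2) powi (2 * int m + n) = t ^ (m + r)"
      by (simp add: n power_int_def nat_add_distrib flip: of_nat_add)
    have 3: "e m = m + r" by (simp add: e_def n)
    have 4: "n = 2 * int r - int (m + r)" by (simp add: n)
    have "(c \<circ> e) m = t ^ (m + r) / fact (m + r) * of_nat (m + r choose r)"
      unfolding o_apply c_def 3 4 nbr_pow_delta by simp
    also have "\<dots> = t ^ (m + r) / (fact r * fact m)"
      by (subst binomial_fact) auto
    also have "\<dots> = T m" unfolding T_def 1 2 by (simp add: field_simps)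
    finally show ?thesis .
  qed
  have "(T has_sum (exp (2 * t) * heat t delta n)) UNIV"
    using * by (subst has_sum_cong_neutral[where T = A and g = "c \<circ> e"]) (auto simp: T0 T1[symmetric])
  then have "bessel_I n (2 * t) = exp (2 * t) * heat t delta n"
    unfolding bessel_I_def T_def[symmetric] by (rule sums_unique[OF has_sum_imp_sums, symmetric])
  then show ?thesis by (simp only: heat_kernel_def exp_cancel)
qed

lemma heat_semigroup_eq:
  assumes "t > 0" "quad h" shows "heat_semigroup t h n = heat t h n"
  unfolding heat_semigroup_def heat_kernel_eq[OF assms(1)]
  by (rule infsumI[OF heat_has_sum]) (use assms in auto)

lemma heat_semigroup_deriv_eq:
  assumes "t > 0" "quad h" shows "heat_semigroup_deriv k t h n = heat t ((lap ^^ k) h) n"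
proof -
  have "\<forall>\<^sub>F s in nhds t. heat_semigroup s h n = heat s h n"
    using eventually_nhds_in_open[of "{0<..}" t] assms
    by (auto elim!: eventually_mono simp: heat_semigroup_eq)
  then have "(deriv ^^ k) (\<lambda>s. heat_semigroup s h n) t = (deriv ^^ k) (\<lambda>s. heat s h n) t"
    by (rule higher_deriv_cong_ev) simp
  then show ?thesis unfolding heat_semigroup_deriv_def heat_deriv_pow[OF assms(2)] .
qed

section \<open>Size and smoothness of the heat kernel\<close>

text \<open>
  This is \<open>lap + 4\<close>, the product of \<open>1\<close> plus a translation and \<open>1\<close> plus the inverse translation. Unlike
  \<open>nbr\<close>, whose powers alternate between the two parities, it maps even sequences that decrease away from
  the origin to such sequences.
\<close>

definition smear :: "(int \<Rightarrow> real) \<Rightarrow> int \<Rightarrow> real" where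
  "smear h n = nbr h n + 2 * h n"

text \<open>
  Induction step of the binomial theorem for \<open>(c + T)\<^sup>k\<close>, where \<open>y i\<close> stands for the value of \<open>T\<^sup>i\<close>.
\<close>

lemma binomial_step:
  fixes y :: "nat \<Rightarrow> real"
  shows "(\<Sum>i\<le>k. of_nat (k choose i) * c ^ (k - i) * y (Suc i)) + c * (\<Sum>i\<le>k. of_nat (k choose i) * c ^ (k - i) * y i)
    = (\<Sum>i\<le>Suc k. of_nat (Suc k choose i) * c ^ (Suc k - i) * y i)"
proof -
  have 1: "(\<Sum>i\<le>Suc k. of_nat (Suc k choose i) * c ^ (Suc k - i) * y i) =
      c ^ Suc k * y 0 + (\<Sum>i\<le>k. of_nat (k choose i) * c ^ (k - i) * y (Suc i))
       + (\<Sum>i\<le>k. of_nat (k choose Suc i) * c ^ (k - i) * y (Suc i))"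
    by (subst sum.atMost_Suc_shift) (simp add: algebra_simps sum.distrib)
  have "c * (\<Sum>i\<le>k. of_nat (k choose i) * c ^ (k - i) * y i) = (\<Sum>i\<le>k. of_nat (k choose i) * c ^ (Suc k - i) * y i)"
    unfolding sum_distrib_left by (rule sum.cong) (auto simp: Suc_diff_le)
  also have "\<dots> = (\<Sum>i\<le>Suc k. of_nat (k choose i) * c ^ (Suc k - i) * y i)"
    by simp
  also have "\<dots> = c ^ Suc k * y 0 + (\<Sum>i\<le>k. of_nat (k choose Suc i) * c ^ (k - i) * y (Suc i))"
    by (subst sum.atMost_Suc_shift) simp
  finally show ?thesis unfolding 1 by simp
qed

lemma smear_pow: "(smear ^^ k) h n = (\<Sum>i\<le>k. of_nat (k choose i) * 2 ^ (k - i) * (nbr ^^ i) h n)"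
proof (induction k arbitrary: n)
  case (Suc k)
  have "(smear ^^ Suc k) h n = ((smear ^^ k) h (n + 1) + (smear ^^ k) h (n - 1)) + 2 * (smear ^^ k) h n"
    by (simp add: smear_def nbr_def)
  also have "(smear ^^ k) h (n + 1) + (smear ^^ k) h (n - 1)
      = (\<Sum>i\<le>k. of_nat (k choose i) * 2 ^ (k - i) * (nbr ^^ Suc i) h n)"
    unfolding Suc.IH by (simp add: sum.distrib[symmetric] nbr_def algebra_simps)
  finally show ?case using binomial_step[of k 2 "\<lambda>i. (nbr ^^ i) h n"] by (simp only: Suc.IH)
qed simp

text \<open>
  Since \<open>nbr = smear - 2\<close>, the semigroup is also \<open>exp (- 4 t) exp (t smear)\<close>; the Cauchy product of the
  series for \<open>exp (t nbr)\<close> and \<open>exp (2 t)\<close> is the series for \<open>exp (t smear)\<close>.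
\<close>

lemma heat_smear_sums:
  assumes "quad h"
  shows "(\<lambda>k. t ^ k / fact k * (smear ^^ k) h n) sums (exp (4 * t) * heat t h n)"
proof -
  have e: "summable (\<lambda>k. norm ((2 * t) ^ k /\<^sub>R fact k))" by (rule summable_norm_exp)
  have "(\<lambda>k. \<Sum>i\<le>k. t ^ i / fact i * (nbr ^^ i) h n * ((2 * t) ^ (k - i) /\<^sub>R fact (k - i))) sums
     ((\<Sum>k. t ^ k / fact k * (nbr ^^ k) h n) * (\<Sum>k. (2 * t) ^ k /\<^sub>R fact k))"
    by (rule Cauchy_product_sums[OF heat_summable[OF assms] e])
  also have "(\<Sum>k. t ^ k / fact k * (nbr ^^ k) h n) = exp (2 * t) * heat t h n"
    using sums_unique[OF heat_sums[OF assms]] by simp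
  also have "(\<Sum>k. (2 * t) ^ k /\<^sub>R fact k) = exp (2 * t)" by (simp add: exp_def)
  also have "exp (2 * t) * heat t h n * exp (2 * t) = exp (4 * t) * heat t h n"
  proof -
    have "exp (4 * t) = exp (2 * t) * exp (2 * t)" by (simp flip: exp_add)
    then show ?thesis by (simp only: mult_ac)
  qed
  also have "(\<lambda>k. \<Sum>i\<le>k. t ^ i / fact i * (nbr ^^ i) h n * ((2 * t) ^ (k - i) /\<^sub>R fact (k - i)))
     = (\<lambda>k. t ^ k / fact k * (smear ^^ k) h n)"
  proof
    fix k
    have "t ^ i / fact i * (nbr ^^ i) h n * ((2 * t) ^ (k - i) /\<^sub>R fact (k - i))
      = t ^ k / fact k * (of_nat (k choose i) * 2 ^ (k - i) * (nbr ^^ i) h n)" if "i \<le> k" for i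
    proof -
      have "t ^ k = t ^ i * t ^ (k - i)" using that by (simp flip: power_add)
      then show ?thesis using that
        by (simp add: binomial_fact power_mult_distrib field_simps)
    qed
    then show "(\<Sum>i\<le>k. t ^ i / fact i * (nbr ^^ i) h n * ((2 * t) ^ (k - i) /\<^sub>R fact (k - i)))
      = t ^ k / fact k * (smear ^^ k) h n"
      unfolding smear_pow sum_distrib_left by (intro sum.cong) auto
  qed
  finally show ?thesis .
qed

text \<open>
  For \<open>n \<ge> 1\<close> each of the three terms of \<open>smear\<close> decreases; at \<open>n = 0\<close> the value at \<open>-1\<close> has first to be
  reflected to \<open>1\<close>, which is why evenness is proved in the same induction.
\<close>

lemma smear_delta_unimodal:
  "(smear ^^ k) delta (- n) = (smear ^^ k) delta n"
  "0 \<le> n \<Longrightarrow> (smear ^^ k) delta (n + 1) \<le> (smear ^^ k) delta n"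
proof (induction k arbitrary: n)
  case 0
  { case 1 show ?case by (simp add: delta_def) }
  { case 2 then show ?case by (simp add: delta_def) }
next
  case (Suc k)
  let ?h = "(smear ^^ k) delta"
  have e: "(smear ^^ Suc k) delta m = ?h (m + 1) + ?h (m - 1) + 2 * ?h m" for m
    by (simp add: smear_def nbr_def)
  { case 1
    have "- n + 1 = - (n - 1)" "- n - 1 = - (n + 1)" by auto
    then have "?h (- n + 1) = ?h (n - 1)" "?h (- n - 1) = ?h (n + 1)"
      by (simp_all only: Suc.IH(1))
    then show ?case using Suc.IH(1)[of n] unfolding e by simp }
  { case 2
    show ?case
    proof (cases "n = 0")
      case True
      have "?h (1 + 1) \<le> ?h 1" "?h (0 + 1) \<le> ?h 0" by (rule Suc.IH(2); simp)+
      moreover have "?h (- 1) = ?h 1" by (rule Suc.IH(1))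
      ultimately show ?thesis unfolding e True by simp
    next
      case False
      have "?h (n + 1 + 1) \<le> ?h (n + 1)" "?h (n + 1) \<le> ?h n" "?h (n - 1 + 1) \<le> ?h (n - 1)"
        by (rule Suc.IH(2), use 2 False in simp)+
      then show ?thesis unfolding e by simp
    qed }
qed

lemma heat_delta_even: "heat t delta (- n) = heat t delta n"
proof -
  have "exp (4 * t) * heat t delta (- n) = exp (4 * t) * heat t delta n"
    using heat_smear_sums[OF quad_delta, of t "- n"] heat_smear_sums[OF quad_delta, of t n]
    unfolding smear_delta_unimodal by (rule sums_unique2)
  then show ?thesis by simp
qed

lemma heat_delta_step:
  assumes "0 \<le> t" "0 \<le> n" shows "heat t delta (n + 1) \<le> heat t delta n"
proof -
  have "exp (4 * t) * heat t delta (n + 1) \<le> exp (4 * t) * heat t delta n"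
    by (rule sums_le[OF _ heat_smear_sums[OF quad_delta] heat_smear_sums[OF quad_delta]])
       (use assms in \<open>intro mult_left_mono smear_delta_unimodal(2); simp\<close>)
  then show ?thesis by simp
qed

lemma heat_delta_nonneg: "0 \<le> t \<Longrightarrow> 0 \<le> heat t delta n"
  by (rule heat_nonneg[OF quad_delta]) (auto simp: delta_def)

lemma heat_delta_abs: "heat t delta \<bar>n\<bar> = heat t delta n"
  using heat_delta_even[of t n] by (simp add: abs_if)

lemma heat_delta_antimono:
  assumes "0 \<le> t" "\<bar>m\<bar> \<le> \<bar>n\<bar>" shows "heat t delta n \<le> heat t delta m"
proof -
  have "decseq (\<lambda>k. heat t delta (int k))"
  proof (rule decseq_SucI)
    fix k show "heat t delta (int (Suc k)) \<le> heat t delta (int k)"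
      using heat_delta_step[OF assms(1), of "int k"] by (metis of_nat_0_le_iff of_nat_Suc add.commute)
  qed
  from decseqD[OF this, of "nat \<bar>m\<bar>" "nat \<bar>n\<bar>"]
  have "heat t delta (int (nat \<bar>n\<bar>)) \<le> heat t delta (int (nat \<bar>m\<bar>))"
    using assms(2) by simp
  then show ?thesis by (simp add: heat_delta_abs)
qed

abbreviation int_sum :: "(int \<Rightarrow> ennreal) \<Rightarrow> ennreal" (binder "\<Sum>\<^sub>\<int>" 10) where
  "int_sum F \<equiv> integral\<^sup>N (count_space UNIV) F"

lemma nn_integral_int_split:
  fixes \<phi> :: "int \<Rightarrow> ennreal"
  shows "(\<Sum>\<^sub>\<int>i. \<phi> i) = (\<Sum>k. \<phi> (int k)) + (\<Sum>k. \<phi> (- 1 - int k))"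
proof -
  have "(\<Sum>\<^sub>\<int>i. \<phi> i) = (\<integral>\<^sup>+i\<in>{0..} \<union> {..<0}. \<phi> i \<partial>count_space UNIV)"
    by (rule nn_integral_cong) (auto split: split_indicator)
  also have "\<dots> = (\<integral>\<^sup>+i\<in>{0..}. \<phi> i \<partial>count_space UNIV) + (\<integral>\<^sup>+i\<in>{..<0}. \<phi> i \<partial>count_space UNIV)"
    by (rule nn_integral_disjoint_pair_countspace) auto
  also have "(\<integral>\<^sup>+i\<in>{0..}. \<phi> i \<partial>count_space UNIV) = (\<integral>\<^sup>+i. \<phi> i \<partial>count_space {0..})"
    by (simp add: nn_integral_count_space_indicator)
  also have "\<dots> = (\<integral>\<^sup>+k. \<phi> (int k) \<partial>count_space UNIV)"
    by (rule nn_integral_bij_count_space[symmetric]) (rule bij_betwI[where g = nat], auto)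
  also have "(\<integral>\<^sup>+i\<in>{..<0}. \<phi> i \<partial>count_space UNIV) = (\<integral>\<^sup>+i. \<phi> i \<partial>count_space {..<0})"
    by (simp add: nn_integral_count_space_indicator)
  also have "\<dots> = (\<integral>\<^sup>+k. \<phi> (- 1 - int k) \<partial>count_space UNIV)"
    by (rule nn_integral_bij_count_space[symmetric]) (rule bij_betwI[where g = "\<lambda>i. nat (- 1 - i)"], auto)
  finally show ?thesis by (simp add: nn_integral_count_space_nat)
qed

text \<open>
  The kernel is even and decreases away from \<open>0\<close>, so on each half line the absolute differences
  telescope to the value at \<open>0\<close>.
\<close>

lemma heat_delta_variation:
  assumes "0 \<le> t"
  shows "(\<Sum>\<^sub>\<int>i. ennreal \<bar>heat t delta (i + 1) - heat t delta i\<bar>) \<le> ennreal (2 * heat t delta 0)"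
proof -
  let ?G = "heat t delta"
  have "(\<Sum>k. ennreal (?G (int k) - ?G (int k + 1))) \<le> ennreal (?G 0)"
  proof (rule suminf_le_const)
    fix n
    have "(\<Sum>k<n. ennreal (?G (int k) - ?G (int k + 1))) = ennreal (\<Sum>k<n. ?G (int k) - ?G (int k + 1))"
      by (rule sum_ennreal) (use heat_delta_step[OF assms] in auto)
    also have "(\<Sum>k<n. ?G (int k) - ?G (int k + 1)) = ?G 0 - ?G (int n)"
      by (induction n) (auto simp: add.commute)
    also have "ennreal \<dots> \<le> ennreal (?G 0)"
      using heat_delta_nonneg[OF assms] by (intro ennreal_leI) auto
    finally show "(\<Sum>k<n. ennreal (?G (int k) - ?G (int k + 1))) \<le> ennreal (?G 0)" .
  qed (rule summableI)
  moreover have "\<bar>?G (int k + 1) - ?G (int k)\<bar> = ?G (int k) - ?G (int k + 1)" for k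
    using heat_delta_step[OF assms, of "int k"] by auto
  moreover have "\<bar>?G (- 1 - int k + 1) - ?G (- 1 - int k)\<bar> = ?G (int k) - ?G (int k + 1)" for k
    using heat_delta_step[OF assms, of "int k"] heat_delta_even[of t "int k"] heat_delta_even[of t "int k + 1"]
    by (simp add: algebra_simps)
  ultimately have "(\<Sum>\<^sub>\<int>i. ennreal \<bar>?G (i + 1) - ?G i\<bar>) \<le> ennreal (?G 0) + ennreal (?G 0)"
    unfolding nn_integral_int_split by (simp only: add_mono)
  also have "\<dots> = ennreal (2 * ?G 0)"
    using heat_delta_nonneg[OF assms, of 0] by (simp flip: ennreal_plus)
  finally show ?thesis .
qed

text \<open>
  Squaring makes the induction work: the quotient of successive left-hand sides is
  \<open>4 (2m + 3) (2m + 1) / (m + 1)\<^sup>2\<close>, which is less than \<open>16\<close>.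
\<close>

lemma central_binomial_bound: "(2 * real m + 1) * (real (2 * m choose m))\<^sup>2 \<le> 16 ^ m"
proof (induction m)
  case (Suc m)
  let ?c = "real (2 * m choose m)"
  have "real (2 * Suc m choose Suc m) * (real m + 1) = 2 * (2 * real m + 1) * ?c"
  proof -
    have "Suc m * (2 * Suc m choose Suc m) = (2 * Suc m) * (Suc (2 * m) choose m)"
      using Suc_times_binomial_eq[of "Suc (2 * m)" m] by simp
    moreover have "Suc m * (Suc (2 * m) choose m) = Suc (2 * m) * (2 * m choose m)"
      using binomial_absorb_comp[of "Suc (2 * m)" m] by (simp add: Suc_diff_le)
    ultimately have "Suc m * (Suc m * (2 * Suc m choose Suc m)) = Suc m * (2 * (Suc (2 * m) * (2 * m choose m)))"
      by (metis mult.assoc mult.left_commute)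
    then have "Suc m * (2 * Suc m choose Suc m) = 2 * (Suc (2 * m) * (2 * m choose m))"
      by (rule Suc_mult_cancel1[THEN iffD1])
    then have "real (Suc m * (2 * Suc m choose Suc m)) = real (2 * (Suc (2 * m) * (2 * m choose m)))"
      by (rule arg_cong)
    then show ?thesis by (simp add: algebra_simps del: binomial_Suc_Suc)
  qed
  then have c: "real (2 * Suc m choose Suc m) = 2 * (2 * real m + 1) * ?c / (real m + 1)"
    by (simp add: field_simps del: binomial_Suc_Suc)
  have "(2 * real (Suc m) + 1) * (real (2 * Suc m choose Suc m))\<^sup>2
      = (4 * ((2 * real m + 3) * (2 * real m + 1)) / (real m + 1)\<^sup>2) * ((2 * real m + 1) * ?c\<^sup>2)"
    unfolding c power_divide power_mult_distrib by (simp add: power2_eq_square algebra_simps)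
  also have "\<dots> \<le> 16 * 16 ^ m"
  proof (intro mult_mono Suc.IH)
    show "4 * ((2 * real m + 3) * (2 * real m + 1)) / (real m + 1)\<^sup>2 \<le> 16"
    proof (subst pos_divide_le_eq)
      show "0 < (real m + 1)\<^sup>2" by simp
    qed (simp add: power2_eq_square algebra_simps)
  qed auto
  finally show ?case by simp
qed simp

lemma nbr_pow_delta_0_le: "(nbr ^^ N) delta 0 \<le> 2 ^ N / sqrt (real N + 1)"
proof (cases "even N")
  case True
  then obtain m where N: "N = 2 * m" by (elim evenE)
  have "(nbr ^^ N) delta 0 = real (2 * m choose m)"
    using nbr_pow_delta(1)[of N "int m"] by (simp add: N)
  also have "\<dots> \<le> 4 ^ m / sqrt (2 * real m + 1)"
  proof -
    have "sqrt ((2 * real m + 1) * (real (2 * m choose m))\<^sup>2) \<le> sqrt (16 ^ m)"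
      by (rule real_sqrt_le_mono[OF central_binomial_bound])
    also have "sqrt (16 ^ m) = (4::real) ^ m"
      by (rule real_sqrt_unique) (auto simp: power_mult[symmetric] power2_eq_square power_mult_distrib[symmetric])
    finally have "sqrt (2 * real m + 1) * real (2 * m choose m) \<le> 4 ^ m" by (simp only: real_sqrt_mult real_sqrt_abs abs_of_nat)
    then show ?thesis by (simp add: pos_le_divide_eq mult.commute)
  qed
  also have "\<dots> = 2 ^ N / sqrt (real N + 1)" by (simp add: N power_mult)
  finally show ?thesis .
next
  case False
  then obtain m where N: "N = 2 * m + 1" by (elim oddE)
  have "(nbr ^^ N) delta 0 = 0"
    using nbr_pow_delta(2)[of N "int m"] by (simp add: N)
  then show ?thesis by simp
qed

text \<open>
  The heat kernel at the origin is the mean of \<open>2\<^sup>-\<^sup>N nbr\<^sup>N delta 0 \<le> 1 / sqrt (N + 1)\<close> when \<open>N\<close> has the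
  Poisson distribution with parameter \<open>2t\<close>. The inequality of the arithmetic and geometric mean, with
  \<open>l = sqrt (2 t)\<close>, bounds \<open>1 / sqrt (N + 1)\<close> by \<open>(l / (N + 1) + 1 / l) / 2\<close>, and the Poisson mean of
  \<open>1 / (N + 1)\<close> is less than \<open>1 / (2 t)\<close>.
\<close>

lemma heat_delta_0_le:
  assumes "t > 0" shows "heat t delta 0 \<le> 1 / sqrt (2 * t)"
proof -
  define l where "l = sqrt (2 * t)"
  have l: "l > 0" "l * l = 2 * t" using assms by (auto simp: l_def)
  have e: "(\<lambda>N. (2 * t) ^ N / fact N) sums exp (2 * t)"
    using exp_converges[of "2 * t"] by (simp add: divide_inverse mult.commute)
  then have "(\<lambda>N. (2 * t) ^ Suc N / fact (Suc N)) sums (exp (2 * t) - (2 * t) ^ 0 / fact 0)"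
    by (subst sums_Suc_iff) simp
  then have "(\<lambda>N. inverse (2 * t) * ((2 * t) ^ Suc N / fact (Suc N))) sums (inverse (2 * t) * (exp (2 * t) - 1))"
    by (intro sums_mult) simp
  moreover have "inverse (2 * t) * ((2 * t) ^ Suc N / fact (Suc N)) = (2 * t) ^ N / fact (Suc N)" for N
    using assms by (simp add: field_simps)
  ultimately have e': "(\<lambda>N. (2 * t) ^ N / fact (Suc N)) sums (inverse (2 * t) * (exp (2 * t) - 1))"
    by (simp only:)
  \<comment> \<open>Arithmetic-geometric mean inequality for each term of the series.\<close>
  have b: "t ^ N / fact N * (nbr ^^ N) delta 0 \<le> l / 2 * ((2 * t) ^ N / fact (Suc N)) + 1 / (2 * l) * ((2 * t) ^ N / fact N)" for N
  proof -
    define x where "x = 1 / sqrt (real N + 1)"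
    have x: "x > 0" "x * x = 1 / (real N + 1)" by (auto simp: x_def)
    have "x \<le> l / 2 * (x * x) + 1 / (2 * l)"
    proof -
      have "0 \<le> (l * x - 1)\<^sup>2" by simp
      then have "x * (2 * l) \<le> l * l * (x * x) + 1" by (simp add: power2_eq_square algebra_simps)
      then have "x \<le> (l * l * (x * x) + 1) / (2 * l)" using l(1) by (subst pos_le_divide_eq) auto
      also have "\<dots> = l / 2 * (x * x) + 1 / (2 * l)" using l(1) by (simp add: add_divide_distrib)
      finally show ?thesis .
    qed
    then have x': "x \<le> l / 2 * (1 / (real N + 1)) + 1 / (2 * l)" by (simp add: x)
    have "t ^ N / fact N * (nbr ^^ N) delta 0 \<le> t ^ N / fact N * (2 ^ N * x)"
      using nbr_pow_delta_0_le[of N] assms by (intro mult_left_mono) (auto simp: x_def)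
    also have "\<dots> = (2 * t) ^ N / fact N * x" by (simp add: power_mult_distrib)
    also have "\<dots> \<le> (2 * t) ^ N / fact N * (l / 2 * (1 / (real N + 1)) + 1 / (2 * l))"
      using assms by (intro mult_left_mono x') auto
    also have "\<dots> = l / 2 * ((2 * t) ^ N / fact (Suc N)) + 1 / (2 * l) * ((2 * t) ^ N / fact N)"
    proof -
      have "(2 * t) ^ N / fact (Suc N) = (2 * t) ^ N / fact N * (1 / (real N + 1))"
        by (simp add: add.commute)
      then show ?thesis by (simp only: distrib_left mult_ac)
    qed
    finally show ?thesis .
  qed
  have "exp (2 * t) * heat t delta 0 \<le> l / 2 * (inverse (2 * t) * (exp (2 * t) - 1)) + 1 / (2 * l) * exp (2 * t)"
    by (rule sums_le[OF b heat_sums[OF quad_delta] sums_add[OF sums_mult[OF e'] sums_mult[OF e]]])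
  also have "\<dots> \<le> l / 2 * (inverse (2 * t) * exp (2 * t)) + 1 / (2 * l) * exp (2 * t)"
    using l assms by (intro add_right_mono mult_left_mono) auto
  also have "l / 2 * (inverse (2 * t) * exp (2 * t)) = 1 / (2 * l) * exp (2 * t)"
  proof -
    have "inverse (2 * t) = 1 / (l * l)" unfolding l(2) by (rule inverse_eq_divide)
    then show ?thesis using l(1) by (simp only:) simp
  qed
  also have "1 / (2 * l) * exp (2 * t) + 1 / (2 * l) * exp (2 * t) = exp (2 * t) * (1 / l)"
    by (simp add: field_simps)
  finally have "exp (2 * t) * heat t delta 0 \<le> exp (2 * t) * (1 / l)" .
  then show ?thesis unfolding l_def by (rule mult_left_le_imp_le) simp
qed

lemma sum_sq_lower: "(1 + real N) ^ 3 / 4 \<le> (\<Sum>j\<in>{- int N..int N}. 1 + (real_of_int j)\<^sup>2)"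
proof (induction N)
  case (Suc N)
  have "{- int (Suc N)..int (Suc N)} = insert (- int (Suc N)) (insert (int (Suc N)) {- int N..int N})"
    by auto
  then have "(\<Sum>j\<in>{- int (Suc N)..int (Suc N)}. 1 + (real_of_int j)\<^sup>2)
     = 2 * (1 + (real N + 1)\<^sup>2) + (\<Sum>j\<in>{- int N..int N}. 1 + (real_of_int j)\<^sup>2)"
    by (simp add: power2_eq_square algebra_simps)
  moreover have "(1 + real (Suc N)) ^ 3 / 4 \<le> 2 * (1 + (real N + 1)\<^sup>2) + (1 + real N) ^ 3 / 4"
  proof -
    define y where "y = real N + 1"
    have "(y + 1) ^ 3 = y ^ 3 + 3 * y\<^sup>2 + 3 * y + 1"
      by (simp add: power2_eq_square power3_eq_cube algebra_simps)
    moreover have "0 \<le> (y - 1)\<^sup>2" by simp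
    then have "2 * y \<le> 1 + y\<^sup>2" by (simp add: power2_diff)
    moreover have "0 \<le> y\<^sup>2" by simp
    ultimately have "(y + 1) ^ 3 \<le> 8 * (1 + y\<^sup>2) + y ^ 3" unfolding distrib_left by linarith
    then show ?thesis by (simp add: y_def algebra_simps)
  qed
  ultimately show ?case using Suc.IH by linarith
qed simp

text \<open>
  Chebyshev's inequality for a decreasing kernel: at all sites \<open>j\<close> with \<open>\<bar>j\<bar> \<le> \<bar>n\<bar>\<close> the kernel is at least
  its value at \<open>n\<close>, the weights \<open>1 + j\<^sup>2\<close> of these sites add up to the order of \<open>\<bar>n\<bar>\<^sup>3\<close>, and the total
  weighted mass is \<open>1 + 2t\<close>.
\<close>

lemma heat_delta_decay:
  assumes "0 \<le> t" shows "heat t delta n \<le> 4 * (1 + 2 * t) / (1 + \<bar>real_of_int n\<bar>) ^ 3"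
proof -
  define N where "N = nat \<bar>n\<bar>"
  have N: "real N = \<bar>real_of_int n\<bar>" by (simp add: N_def)
  have hs: "((\<lambda>j. heat t delta (0 - j) * (1 + (real_of_int j)\<^sup>2)) has_sum (1 + 2 * t)) UNIV"
    using heat_has_sum[OF assms quad_sq, of 0] by (simp add: heat_sq)
  have "heat t delta n * ((1 + real N) ^ 3 / 4) \<le> heat t delta n * (\<Sum>j\<in>{- int N..int N}. 1 + (real_of_int j)\<^sup>2)"
    by (intro mult_left_mono sum_sq_lower heat_delta_nonneg assms)
  also have "\<dots> = (\<Sum>j\<in>{- int N..int N}. heat t delta n * (1 + (real_of_int j)\<^sup>2))"
    by (rule sum_distrib_left)
  also have "\<dots> \<le> (\<Sum>j\<in>{- int N..int N}. heat t delta (0 - j) * (1 + (real_of_int j)\<^sup>2))"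
    by (intro sum_mono mult_right_mono heat_delta_antimono assms) (auto simp: N_def)
  also have "\<dots> \<le> 1 + 2 * t"
    by (rule finite_sum_le_has_sum[OF hs]) (auto intro!: mult_nonneg_nonneg heat_delta_nonneg assms)
  finally show ?thesis by (simp add: N field_simps)
qed

text \<open>
  The measure \<open>\<tau>\<^sup>\<beta>\<^sup>-\<^sup>1 d\<tau>\<close> on the positive half line, extended by \<open>0\<close> so that it lives on all of \<open>\<real>\<close>.
\<close>

definition riesz :: "real \<Rightarrow> real measure" where
  "riesz \<beta> = density lborel (\<lambda>\<tau>. ennreal (if 0 < \<tau> then \<tau> powr (\<beta> - 1) else 0))"

lemma sets_riesz [measurable_cong, simp]: "sets (riesz \<beta>) = sets borel"
  and space_riesz [simp]: "space (riesz \<beta>) = UNIV"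
  by (auto simp: riesz_def)

lemma sigma_finite_riesz: "sigma_finite_measure (riesz \<beta>)"
  unfolding riesz_def
  by (subst sigma_finite_measure.sigma_finite_iff_density_finite[OF sigma_finite_lborel]) auto

lemma AE_riesz_pos: "AE \<tau> in riesz \<beta>. 0 < \<tau>"
  unfolding riesz_def by (subst AE_density) (auto split: if_splits)

lemma nn_integral_riesz:
  "f \<in> borel_measurable borel \<Longrightarrow>
   (\<integral>\<^sup>+\<tau>. f \<tau> \<partial>riesz \<beta>) = (\<integral>\<^sup>+\<tau>. ennreal (if 0 < \<tau> then \<tau> powr (\<beta> - 1) else 0) * f \<tau> \<partial>lborel)"
  unfolding riesz_def by (subst nn_integral_density) auto

text \<open>
  Decay of the convolution kernel of the negative fractional power. Diffusion reaches the site \<open>n\<close> at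
  times of order \<open>D\<^sup>2\<close>, where \<open>D = 1 + \<bar>n\<bar>\<close>. For \<open>\<tau> \<le> D\<^sup>2\<close> the kernel is at most \<open>4 (1 + 2\<tau>) / D\<^sup>3\<close>, for
  later times it is at most \<open>\<tau>\<close> to the power \<open>-1/2\<close>, and both parts contribute the order \<open>2\<beta> - 1\<close> in \<open>D\<close>.
\<close>

lemma riesz_kernel_le:
  assumes "0 < \<beta>" "\<beta> < 1 / 2"
  obtains C where "C > 0"
    "\<And>n. (\<integral>\<^sup>+\<tau>. ennreal (heat \<tau> delta n) \<partial>riesz \<beta>) \<le> ennreal (C * (1 + \<bar>real_of_int n\<bar>) powr (2 * \<beta> - 1))"
proof
  define C where "C = 4 * (1 / \<beta> + 2 / (\<beta> + 1)) + 1 / (1 / 2 - \<beta>)"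
  show "C > 0" using assms by (auto simp: C_def intro!: add_pos_pos)
  fix n
  define D where "D = 1 + \<bar>real_of_int n\<bar>"
  have D: "D \<ge> 1" by (simp add: D_def)
  define f where "f \<tau> = 4 / D ^ 3 * (\<tau> powr (\<beta> - 1) + 2 * \<tau> powr \<beta>)" for \<tau>
  define g where "g \<tau> = \<tau> powr (\<beta> - 3 / 2)" for \<tau> :: real
  let ?I = "4 / D ^ 3 * (D ^ 3 * D powr (2 * \<beta> - 1) * D powr (- 2) / (\<beta> - 1 + 1) + 2 * (D ^ 3 * D powr (2 * \<beta> - 1) / (\<beta> + 1)))"
  have "(f has_integral 4 / D ^ 3 * ((D\<^sup>2) powr (\<beta> - 1 + 1) / (\<beta> - 1 + 1) + 2 * ((D\<^sup>2) powr (\<beta> + 1) / (\<beta> + 1)))) {0..D\<^sup>2}"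
    unfolding f_def using assms
    by (intro has_integral_mult_right has_integral_add has_integral_powr_from_0) auto
  also have "(D\<^sup>2) powr (\<beta> - 1 + 1) = D ^ 3 * D powr (2 * \<beta> - 1) * D powr (- 2)"
    using D by (simp add: powr_powr powr_add[symmetric] flip: powr_numeral)
  also have "(D\<^sup>2) powr (\<beta> + 1) = D ^ 3 * D powr (2 * \<beta> - 1)"
    using D by (simp add: powr_powr powr_add[symmetric] algebra_simps flip: powr_numeral)
  finally have f: "(f has_integral ?I) {0..D\<^sup>2}" .
  have "(g has_integral - ((D\<^sup>2) powr (\<beta> - 3 / 2 + 1)) / (\<beta> - 3 / 2 + 1)) {D\<^sup>2..}"
    unfolding g_def using assms D by (intro has_integral_powr_to_inf) auto
  also have "- ((D\<^sup>2) powr (\<beta> - 3 / 2 + 1)) / (\<beta> - 3 / 2 + 1) = D powr (2 * \<beta> - 1) * (1 / (1 / 2 - \<beta>))"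
  proof -
    have "(D\<^sup>2) powr (\<beta> - 3 / 2 + 1) = D powr (2 * \<beta> - 1)"
      using D by (simp add: powr_powr algebra_simps flip: powr_numeral)
    then show ?thesis using assms by (simp add: field_simps)
  qed
  finally have g: "(g has_integral D powr (2 * \<beta> - 1) * (1 / (1 / 2 - \<beta>))) {D\<^sup>2..}" .
  have "(\<integral>\<^sup>+\<tau>. ennreal (heat \<tau> delta n) \<partial>riesz \<beta>)
     = (\<integral>\<^sup>+\<tau>. ennreal (if 0 < \<tau> then \<tau> powr (\<beta> - 1) else 0) * ennreal (heat \<tau> delta n) \<partial>lborel)"
    using heat_measurable[OF quad_delta] by (intro nn_integral_riesz) simp
  also have "\<dots> \<le> (\<integral>\<^sup>+\<tau>. ennreal (f \<tau>) * indicator {0..D\<^sup>2} \<tau> + ennreal (g \<tau>) * indicator {D\<^sup>2..} \<tau> \<partial>lborel)"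
  proof (rule nn_integral_mono)
    fix \<tau> :: real
    show "ennreal (if 0 < \<tau> then \<tau> powr (\<beta> - 1) else 0) * ennreal (heat \<tau> delta n)
      \<le> ennreal (f \<tau>) * indicator {0..D\<^sup>2} \<tau> + ennreal (g \<tau>) * indicator {D\<^sup>2..} \<tau>"
    proof (cases "0 < \<tau>")
      case True
      show ?thesis
      proof (cases "\<tau> \<le> D\<^sup>2")
        case le: True
        have "\<tau> powr (\<beta> - 1) * heat \<tau> delta n \<le> \<tau> powr (\<beta> - 1) * (4 * (1 + 2 * \<tau>) / D ^ 3)"
          using heat_delta_decay[of \<tau> n] True by (intro mult_left_mono) (auto simp: D_def)
        also have "\<dots> = f \<tau>"
        proof -
          have "\<tau> powr \<beta> = \<tau> powr (\<beta> - 1) * \<tau>" using True by (simp add: powr_diff)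
          then show ?thesis by (simp add: f_def field_simps)
        qed
        finally have "ennreal (\<tau> powr (\<beta> - 1) * heat \<tau> delta n) \<le> ennreal (f \<tau>)" by (rule ennreal_leI)
        then show ?thesis using True le heat_delta_nonneg[of \<tau> n]
          by (simp add: ennreal_mult[symmetric] add_increasing2)
      next
        case False
        have "heat \<tau> delta n \<le> heat \<tau> delta 0" using True by (intro heat_delta_antimono) auto
        also have "\<dots> \<le> 1 / sqrt (2 * \<tau>)" by (rule heat_delta_0_le[OF True])
        also have "\<dots> \<le> 1 / sqrt \<tau>" using True by (intro divide_left_mono) auto
        also have "\<dots> = \<tau> powr (- 1 / 2)" using True by (simp add: powr_half_sqrt powr_minus_divide)
        finally have "\<tau> powr (\<beta> - 1) * heat \<tau> delta n \<le> \<tau> powr (\<beta> - 1) * \<tau> powr (- 1 / 2)"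
          by (intro mult_left_mono) auto
        also have "\<dots> = g \<tau>" by (simp add: g_def powr_add[symmetric])
        finally have "ennreal (\<tau> powr (\<beta> - 1) * heat \<tau> delta n) \<le> ennreal (g \<tau>)" by (rule ennreal_leI)
        then show ?thesis using True False heat_delta_nonneg[of \<tau> n]
          by (simp add: ennreal_mult[symmetric] add_increasing)
      qed
    qed simp
  qed
  also have "\<dots> = (\<integral>\<^sup>+\<tau>. ennreal (f \<tau>) * indicator {0..D\<^sup>2} \<tau> \<partial>lborel) + (\<integral>\<^sup>+\<tau>. ennreal (g \<tau>) * indicator {D\<^sup>2..} \<tau> \<partial>lborel)"
    by (rule nn_integral_add) (auto simp: f_def g_def)
  also have "(\<integral>\<^sup>+\<tau>. ennreal (f \<tau>) * indicator {0..D\<^sup>2} \<tau> \<partial>lborel)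
     = ennreal ?I"
    by (rule nn_integral_has_integral_lebesgue'[OF _ f]) (use D in \<open>auto simp: f_def\<close>)
  also have "(\<integral>\<^sup>+\<tau>. ennreal (g \<tau>) * indicator {D\<^sup>2..} \<tau> \<partial>lborel) = ennreal (D powr (2 * \<beta> - 1) * (1 / (1 / 2 - \<beta>)))"
    by (rule nn_integral_has_integral_lebesgue'[OF _ g]) (auto simp: g_def)
  also have "?I
     = D powr (2 * \<beta> - 1) * (4 * (D powr (- 2) / \<beta> + 2 / (\<beta> + 1)))"
    using D by (simp add: field_simps)
  also have "ennreal \<dots> \<le> ennreal (D powr (2 * \<beta> - 1) * (4 * (1 / \<beta> + 2 / (\<beta> + 1))))"
  proof -
    have "D powr (- 2) \<le> 1" using D powr_mono[of "-2" 0 D] by simp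
    then show ?thesis using assms
      by (intro ennreal_leI mult_left_mono add_right_mono divide_right_mono) auto
  qed
  finally show "(\<integral>\<^sup>+\<tau>. ennreal (heat \<tau> delta n) \<partial>riesz \<beta>) \<le> ennreal (C * (1 + \<bar>real_of_int n\<bar>) powr (2 * \<beta> - 1))"
    using assms D by (simp add: C_def D_def[symmetric] algebra_simps flip: ennreal_plus)
qed

section \<open>Integral inequalities for sequence norms\<close>

lemma ennpowr_ennreal: "0 \<le> a \<Longrightarrow> ennpowr (ennreal a) r = ennreal (a powr r)"
  by (simp add: ennpowr_def)

lemma ennpowr_top [simp]: "ennpowr top r = top"
  by (simp add: ennpowr_def)

lemma ennpowr_0 [simp]: "ennpowr 0 r = 0"
  by (simp add: ennpowr_def)

lemma ennpowr_1 [simp]: "ennpowr 1 r = 1"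
  by (simp add: ennpowr_def)

lemma ennpowr_eq_top_iff [simp]: "ennpowr x r = top \<longleftrightarrow> x = top"
  by (simp add: ennpowr_def)

lemma ennpowr_less_top_iff [simp]: "ennpowr x r < top \<longleftrightarrow> x < top"
  by (simp add: less_top[symmetric])

lemma ennpowr_mono: "0 \<le> r \<Longrightarrow> x \<le> y \<Longrightarrow> ennpowr x r \<le> ennpowr y r"
  by (cases x; cases y) (auto simp: ennpowr_ennreal ennreal_leI powr_mono2 top_unique)

lemma ennpowr_mult: "0 < r \<Longrightarrow> ennpowr (x * y) r = ennpowr x r * ennpowr y r"
proof (cases x; cases y)
  fix a b assume "0 < r" "0 \<le> a" "x = ennreal a" "0 \<le> b" "y = ennreal b"
  then show ?thesis by (simp add: ennpowr_ennreal powr_mult flip: ennreal_mult)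
next
  fix a assume a: "0 < r" "0 \<le> a" "x = ennreal a" "y = top"
  then show ?thesis by (cases "a = 0") (auto simp: ennpowr_ennreal ennreal_mult_top)
next
  fix a assume a: "0 < r" "0 \<le> a" "y = ennreal a" "x = top"
  then show ?thesis by (cases "a = 0") (auto simp: ennpowr_ennreal ennreal_top_mult)
qed auto

lemma ennpowr_ennpowr: "ennpowr (ennpowr x r) s = ennpowr x (r * s)"
  by (cases x) (auto simp: ennpowr_ennreal powr_powr)

lemma ennpowr_one [simp]: "ennpowr x 1 = x"
  by (cases x) (auto simp: ennpowr_ennreal)

lemma measurable_ennpowr [measurable]:
  "f \<in> borel_measurable M \<Longrightarrow> (\<lambda>x. ennpowr (f x) r) \<in> borel_measurable M"
proof -
  assume [measurable]: "f \<in> borel_measurable M"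
  have "{x \<in> space M. f x = top} = f -` {top} \<inter> space M" by auto
  also have "\<dots> \<in> sets M" by measurable
  finally have [measurable]: "{x \<in> space M. f x = \<infinity>} \<in> sets M" by simp
  show ?thesis unfolding ennpowr_def by (intro measurable_If) auto
qed

text \<open>
  The convex function \<open>x \<mapsto> x\<^sup>q\<close> lies above its tangent at \<open>s\<close>.
\<close>

lemma powr_tangent:
  fixes x s q :: real
  assumes "1 \<le> q" "0 \<le> x" "0 < s"
  shows "q * s powr (q - 1) * x \<le> x powr q + (q - 1) * s powr q"
proof (cases "q = 1 \<or> x = 0")
  case False
  then have q: "q > 1" and x: "x > 0" using assms by auto
  have "(x powr q) powr (1 / q) * (s powr q) powr (1 - 1 / q) \<le> (1 / q) * x powr q + (1 - 1 / q) * s powr q"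
    using q x assms by (intro Youngs_inequality_0) auto
  moreover have "(s powr q) powr (1 - 1 / q) = s powr (q - 1)"
  proof -
    have "q * (1 - 1 / q) = q - 1" using q by (simp add: right_diff_distrib)
    then show ?thesis by (simp only: powr_powr)
  qed
  ultimately have "x * s powr (q - 1) \<le> (1 / q) * x powr q + (1 - 1 / q) * s powr q"
    using q x by (simp add: powr_powr)
  then have "q * (x * s powr (q - 1)) \<le> q * ((1 / q) * x powr q + (1 - 1 / q) * s powr q)"
    using q by (intro mult_left_mono) auto
  also have "\<dots> = x powr q + (q - 1) * s powr q" using q by (simp add: field_simps)
  finally show ?thesis by (simp add: mult_ac)
qed (use assms in auto)

lemma ennpowr_tangent:
  assumes "1 \<le> q" "0 < s"
  shows "ennreal (q * s powr (q - 1)) * x \<le> ennpowr x q + ennreal ((q - 1) * s powr q)"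
proof (cases x)
  case (real a)
  have "ennreal (q * s powr (q - 1) * a) \<le> ennreal (a powr q + (q - 1) * s powr q)"
    using real assms by (intro ennreal_leI powr_tangent) auto
  then show ?thesis using real assms by (simp add: ennpowr_ennreal ennreal_mult ennreal_plus)
qed simp

text \<open>
  Jensen's inequality for a density of total mass at most \<open>1\<close>. Integrating the tangent inequality at the
  point \<open>s\<close> equal to the mean gives the claim; the constant term \<open>(q - 1) s\<^sup>q\<close> is nonnegative, so mass
  less than \<open>1\<close> only helps. If the mean is infinite, the tangent at \<open>1\<close> shows that the right-hand side is
  infinite too.
\<close>

lemma ennpowr_nn_integral_le:
  assumes q: "1 \<le> q" and [measurable]: "K \<in> borel_measurable N" "w \<in> borel_measurable N"
    and K: "(\<integral>\<^sup>+y. K y \<partial>N) \<le> 1"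
  shows "ennpowr (\<integral>\<^sup>+y. K y * w y \<partial>N) q \<le> (\<integral>\<^sup>+y. K y * ennpowr (w y) q \<partial>N)"
proof -
  define I where "I = (\<integral>\<^sup>+y. K y * w y \<partial>N)"
  define J where "J = (\<integral>\<^sup>+y. K y * ennpowr (w y) q \<partial>N)"
  have *: "ennreal (q * s powr (q - 1)) * I \<le> J + ennreal ((q - 1) * s powr q)" if s: "0 < s" for s
  proof -
    have "ennreal (q * s powr (q - 1)) * I = (\<integral>\<^sup>+y. K y * (ennreal (q * s powr (q - 1)) * w y) \<partial>N)"
      unfolding I_def by (subst nn_integral_cmult[symmetric]) (auto simp: mult_ac)
    also have "\<dots> \<le> (\<integral>\<^sup>+y. K y * ennpowr (w y) q + ennreal ((q - 1) * s powr q) * K y \<partial>N)"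
    proof (rule nn_integral_mono)
      fix y
      have "K y * (ennreal (q * s powr (q - 1)) * w y) \<le> K y * (ennpowr (w y) q + ennreal ((q - 1) * s powr q))"
        by (intro mult_left_mono ennpowr_tangent q s) auto
      then show "K y * (ennreal (q * s powr (q - 1)) * w y) \<le> K y * ennpowr (w y) q + ennreal ((q - 1) * s powr q) * K y"
        by (simp add: distrib_left mult.commute)
    qed
    also have "\<dots> = J + ennreal ((q - 1) * s powr q) * (\<integral>\<^sup>+y. K y \<partial>N)"
      unfolding J_def by (subst nn_integral_add) (auto simp: nn_integral_cmult)
    also have "\<dots> \<le> J + ennreal ((q - 1) * s powr q) * 1"
      by (intro add_left_mono mult_left_mono K) auto
    finally show ?thesis by simp
  qed
  have "ennpowr I q \<le> J"
  proof (cases I)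
    case (real s)
    show ?thesis
    proof (cases "s = 0")
      case False
      then have s: "s > 0" using real by simp
      have e: "s powr (q - 1) * s = s powr q" using s by (simp add: powr_diff)
      show ?thesis
      proof (cases J)
        case (real j)
        have "ennreal (q * s powr (q - 1) * s) \<le> ennreal (j + (q - 1) * s powr q)"
          using *[OF s] real \<open>I = ennreal s\<close> s q by (simp add: ennreal_mult ennreal_plus)
        then have "q * (s powr (q - 1) * s) \<le> j + (q - 1) * s powr q"
          using real q by (subst (asm) ennreal_le_iff) auto
        then have "s powr q \<le> j" unfolding e by (simp add: algebra_simps)
        then show ?thesis using real \<open>I = ennreal s\<close> s by (simp add: ennpowr_ennreal ennreal_leI)
      qed simp
    qed (use real in simp)
  next
    case top
    then have "J = top" using *[of 1] q by (simp add: ennreal_mult_top top_unique)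
    then show ?thesis by simp
  qed
  then show ?thesis by (simp only: I_def J_def)
qed

lemma ennpowr_nn_integral_mass_le:
  assumes q: "1 \<le> q" and [measurable]: "K \<in> borel_measurable N" "w \<in> borel_measurable N"
    and R: "0 < R" "(\<integral>\<^sup>+y. K y \<partial>N) \<le> ennreal R"
  shows "ennpowr (\<integral>\<^sup>+y. K y * w y \<partial>N) q
    \<le> ennpowr (ennreal R) q * ennreal (1 / R) * (\<integral>\<^sup>+y. K y * ennpowr (w y) q \<partial>N)"
proof -
  have RR: "ennreal (1 / R) * ennreal R = 1" using R(1) by (simp flip: ennreal_mult)
  have "ennreal (1 / R) * (\<integral>\<^sup>+y. K y \<partial>N) \<le> ennreal (1 / R) * ennreal R" by (intro mult_left_mono R) simp
  then have mass: "(\<integral>\<^sup>+y. ennreal (1 / R) * K y \<partial>N) \<le> 1" by (simp add: nn_integral_cmult RR)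
  have "(\<integral>\<^sup>+y. K y * w y \<partial>N) = ennreal R * ennreal (1 / R) * (\<integral>\<^sup>+y. K y * w y \<partial>N)"
    using RR by (simp add: mult.commute)
  also have "\<dots> = ennreal R * (\<integral>\<^sup>+y. ennreal (1 / R) * K y * w y \<partial>N)"
    by (simp add: nn_integral_cmult mult.assoc)
  finally have "ennpowr (\<integral>\<^sup>+y. K y * w y \<partial>N) q
      = ennpowr (ennreal R) q * ennpowr (\<integral>\<^sup>+y. ennreal (1 / R) * K y * w y \<partial>N) q"
    using q by (simp add: ennpowr_mult)
  also have "\<dots> \<le> ennpowr (ennreal R) q * (\<integral>\<^sup>+y. ennreal (1 / R) * K y * ennpowr (w y) q \<partial>N)"
    by (intro mult_left_mono ennpowr_nn_integral_le q mass) auto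
  also have "\<dots> = ennpowr (ennreal R) q * ennreal (1 / R) * (\<integral>\<^sup>+y. K y * ennpowr (w y) q \<partial>N)"
    by (simp add: nn_integral_cmult mult.assoc)
  finally show ?thesis .
qed

text \<open>
  Sequences with values in \<^typ>\<open>ennreal\<close> are convenient here because sums and integrals of such
  sequences need no convergence hypotheses.
\<close>

abbreviation ell :: "ennreal \<Rightarrow> (int \<Rightarrow> ennreal) \<Rightarrow> ennreal" where
  "ell p g \<equiv> Lnorm p (count_space UNIV) g"

lemma esssup_count_space: "esssup (count_space (UNIV :: int set)) (g :: int \<Rightarrow> ennreal) = (SUP n. g n)"
proof (rule antisym)
  show "esssup (count_space UNIV) g \<le> (SUP n. g n)"
    by (rule esssup_I) (auto intro: SUP_upper)
  show "(SUP n. g n) \<le> esssup (count_space UNIV) g"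
    using esssup_AE[of g "count_space UNIV"] by (auto simp: AE_count_space intro: SUP_least)
qed

lemma ell_top: "ell top g = (SUP n. g n)"
  by (simp add: Lnorm_def esssup_count_space)

lemma ell_real:
  assumes "p \<noteq> top" shows "ell p g = ennpowr (\<Sum>\<^sub>\<int>n. ennpowr (g n) (enn2real p)) (1 / enn2real p)"
  using assms by (simp add: Lnorm_def)

lemma enn2real_ge_1: "1 \<le> p \<Longrightarrow> p \<noteq> top \<Longrightarrow> 1 \<le> enn2real p"
  using enn2real_mono[of 1 p] by (simp add: less_top)

lemma ell_pow:
  assumes "1 \<le> p" "p \<noteq> top"
  shows "ennpowr (ell p g) (enn2real p) = (\<Sum>\<^sub>\<int>n. ennpowr (g n) (enn2real p))"
  using enn2real_ge_1[OF assms] by (simp add: ell_real[OF assms(2)] ennpowr_ennpowr)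

lemma ell_mono:
  assumes "\<And>n. g n \<le> h n" shows "ell p g \<le> ell p h"
proof (cases "p = top")
  case False
  then show ?thesis unfolding ell_real[OF False]
    by (intro ennpowr_mono nn_integral_mono assms) auto
qed (auto simp: ell_top intro!: SUP_mono assms)

lemma ell_ge_point:
  assumes "1 \<le> p" shows "g n \<le> ell p g"
proof (cases "p = top")
  case False
  let ?p = "enn2real p"
  have p: "1 \<le> ?p" by (rule enn2real_ge_1[OF assms False])
  have "g n = ennpowr (ennpowr (g n) ?p) (1 / ?p)" using p by (simp add: ennpowr_ennpowr)
  also have "\<dots> \<le> ell p g" unfolding ell_real[OF False]
    using p by (intro ennpowr_mono nn_integral_ge_point) auto
  finally show ?thesis .
qed (auto simp: ell_top intro: SUP_upper)

lemma ell_eq_0: "ell p (\<lambda>n. 0) = 0"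
  by (cases "p = top") (auto simp: ell_top ell_real)

lemma ell_cmult:
  assumes "1 \<le> p" shows "ell p (\<lambda>n. c * g n) = c * ell p g"
proof (cases "p = top")
  case True
  then show ?thesis by (simp add: ell_top SUP_mult_left_ennreal)
next
  case False
  have p: "1 \<le> enn2real p" by (rule enn2real_ge_1[OF assms False])
  then show ?thesis unfolding ell_real[OF False]
    by (simp add: ennpowr_mult nn_integral_cmult ennpowr_ennpowr)
qed

lemma ell_shift: "ell p (\<lambda>n. g (n - i)) = ell p g"
proof -
  have b: "bij_betw (\<lambda>n. n - i) UNIV UNIV" by (rule bij_betwI[where g = "\<lambda>n. n + i"]) auto
  show ?thesis
  proof (cases "p = top")
    case True
    have "range (\<lambda>n. g (n - i)) = range g"
    proof -
      have "range (\<lambda>n. g (n - i)) = g ` range (\<lambda>n. n - i)" by (simp only: image_image)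
      then show ?thesis unfolding bij_betw_imp_surj_on[OF b] .
    qed
    then show ?thesis by (simp add: True ell_top)
  next
    case False
    then show ?thesis unfolding ell_real[OF False]
      using nn_integral_bij_count_space[OF b, of "\<lambda>n. ennpowr (g n) (enn2real p)"] by simp
  qed
qed

lemma measurable_ell [measurable (raw)]:
  assumes [measurable]: "\<And>n. F n \<in> borel_measurable N"
  shows "(\<lambda>y. ell p (\<lambda>n. F n y)) \<in> borel_measurable N"
proof (cases "p = top")
  case True
  then show ?thesis by (simp add: ell_top)
next
  case False
  then show ?thesis unfolding ell_real[OF False]
    by (intro measurable_ennpowr) (simp add: nn_integral_int_split)
qed

text \<open>
  Minkowski's integral inequality. Let \<open>L y\<close> be the norm of \<open>F\<^sub>y\<close> and \<open>I\<close> the integral of \<open>L\<close>. Then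
  \<open>F\<^sub>y = I * K y * w\<^sub>y\<close>, where \<open>w\<^sub>y = F\<^sub>y / L y\<close> is a unit vector and \<open>K = L / I\<close> is a probability density.
  Jensen's inequality applied to the average of \<open>w\<^sub>y n\<close> for each \<open>n\<close>, followed by summation over \<open>n\<close>,
  shows that an average of unit vectors has norm at most \<open>1\<close>.
\<close>

lemma ell_minkowski:
  assumes p: "1 \<le> p" and [measurable]: "\<And>n. F n \<in> borel_measurable N"
  shows "ell p (\<lambda>n. \<integral>\<^sup>+y. F n y \<partial>N) \<le> (\<integral>\<^sup>+y. ell p (\<lambda>n. F n y) \<partial>N)"
proof (cases "p = top")
  case True
  show ?thesis unfolding True ell_top
    by (intro SUP_least nn_integral_mono) (auto intro: SUP_upper)
next
  case False
  define r where "r = enn2real p"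
  have r: "1 \<le> r" unfolding r_def by (rule enn2real_ge_1[OF p False])
  define L where "L y = ell p (\<lambda>n. F n y)" for y
  define I where "I = (\<integral>\<^sup>+y. L y \<partial>N)"
  have L[measurable]: "L \<in> borel_measurable N" unfolding L_def by measurable
  have FL: "F n y \<le> L y" for n y unfolding L_def by (rule ell_ge_point[OF p])
  have "ell p (\<lambda>n. \<integral>\<^sup>+y. F n y \<partial>N) \<le> I"
  proof (cases "I = 0 \<or> I = top")
    case True
    then show ?thesis
    proof
      assume "I = 0"
      moreover have "(\<integral>\<^sup>+y. F n y \<partial>N) \<le> I" for n unfolding I_def by (intro nn_integral_mono FL)
      ultimately have "(\<integral>\<^sup>+y. F n y \<partial>N) = 0" for n by (metis le_zero_eq)
      then show ?thesis by (simp add: ell_eq_0)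
    qed simp
  next
    case fin: False
    then have I: "I \<noteq> 0" "I \<noteq> top" by auto
    define K where "K y = L y / I" for y
    define w where "w n y = F n y / L y" for n y
    have [measurable]: "K \<in> borel_measurable N" "\<And>n. w n \<in> borel_measurable N"
      unfolding K_def w_def by measurable
    have K: "(\<integral>\<^sup>+y. K y \<partial>N) \<le> 1"
      unfolding K_def using I by (simp add: nn_integral_divide I_def[symmetric] ennreal_divide_self less_top)
    have Lfin: "AE y in N. L y \<noteq> top"
      using nn_integral_noteq_infinite[OF L] I by (simp add: I_def)
    \<comment> \<open>If \<open>L y = 0\<close>, then \<open>F n y = 0\<close> for all \<open>n\<close>, and the convention \<open>0 / 0 = 0\<close> in \<^typ>\<open>ennreal\<close> is harmless.\<close>
    have eq: "F n y = I * (K y * w n y)" if "L y \<noteq> top" for n y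
    proof (cases "L y = 0")
      case True
      then show ?thesis using FL[of n y] by (simp add: K_def)
    next
      case False
      have "I * (L y / I * (F n y / L y)) = (I * (L y / I)) * (F n y / L y)" by (simp only: mult.assoc)
      also have "I * (L y / I) = L y" using I by (simp add: ennreal_times_divide ennreal_mult_divide_eq mult.commute[of I])
      also have "L y * (F n y / L y) = F n y" using False that
        by (simp add: ennreal_times_divide ennreal_mult_divide_eq mult.commute[of "L y"])
      finally show ?thesis by (simp add: K_def w_def)
    qed
    have w1: "(\<Sum>\<^sub>\<int>n. ennpowr (w n y) r) \<le> 1" if "L y \<noteq> top" for y
    proof (cases "L y = 0")
      case True
      then have "w n y = 0" for n using FL[of n y] by (simp add: w_def)
      then show ?thesis by simp
    next
      case False
      have "(\<Sum>\<^sub>\<int>n. ennpowr (w n y) r) = ennpowr (ell p (\<lambda>n. (1 / L y) * F n y)) r"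
        unfolding r_def ell_pow[OF p \<open>p \<noteq> top\<close>] by (simp add: w_def ennreal_times_divide mult.commute[of "1 / L y"])
      also have "ell p (\<lambda>n. (1 / L y) * F n y) = L y / L y"
        unfolding ell_cmult[OF p] L_def[symmetric] by (simp add: ennreal_times_divide mult.commute[of "1 / L y"])
      also have "\<dots> = 1" using False that by (simp add: ennreal_divide_self less_top)
      finally show ?thesis by simp
    qed
    have "ennpowr (ell p (\<lambda>n. \<integral>\<^sup>+y. F n y \<partial>N)) r = (\<Sum>\<^sub>\<int>n. ennpowr (\<integral>\<^sup>+y. F n y \<partial>N) r)"
      unfolding r_def by (rule ell_pow[OF p False])
    also have "\<dots> = (\<Sum>\<^sub>\<int>n. ennpowr I r * ennpowr (\<integral>\<^sup>+y. K y * w n y \<partial>N) r)"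
    proof (rule nn_integral_cong)
      fix n
      have "(\<integral>\<^sup>+y. F n y \<partial>N) = (\<integral>\<^sup>+y. I * (K y * w n y) \<partial>N)"
        using Lfin by (intro nn_integral_cong_AE) (auto elim!: eventually_mono simp: eq)
      also have "\<dots> = I * (\<integral>\<^sup>+y. K y * w n y \<partial>N)" by (rule nn_integral_cmult) measurable
      finally show "ennpowr (\<integral>\<^sup>+y. F n y \<partial>N) r = ennpowr I r * ennpowr (\<integral>\<^sup>+y. K y * w n y \<partial>N) r"
        using r by (simp add: ennpowr_mult)
    qed
    also have "\<dots> = ennpowr I r * (\<Sum>\<^sub>\<int>n. ennpowr (\<integral>\<^sup>+y. K y * w n y \<partial>N) r)"
      by (rule nn_integral_cmult) simp
    also have "\<dots> \<le> ennpowr I r * (\<Sum>\<^sub>\<int>n. \<integral>\<^sup>+y. K y * ennpowr (w n y) r \<partial>N)"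
      by (intro mult_left_mono nn_integral_mono ennpowr_nn_integral_le r K) auto
    also have "(\<Sum>\<^sub>\<int>n. \<integral>\<^sup>+y. K y * ennpowr (w n y) r \<partial>N)
        = (\<integral>\<^sup>+y. (\<Sum>\<^sub>\<int>n. K y * ennpowr (w n y) r) \<partial>N)"
      by (rule nn_integral_count_space_nn_integral[symmetric]) auto
    also have "\<dots> = (\<integral>\<^sup>+y. K y * (\<Sum>\<^sub>\<int>n. ennpowr (w n y) r) \<partial>N)"
      by (simp add: nn_integral_cmult)
    also have "\<dots> \<le> (\<integral>\<^sup>+y. K y * 1 \<partial>N)"
      using Lfin by (intro nn_integral_mono_AE) (elim eventually_mono, intro mult_left_mono w1, auto)
    also have "\<dots> \<le> 1" using K by simp
    finally have "ennpowr (ell p (\<lambda>n. \<integral>\<^sup>+y. F n y \<partial>N)) r \<le> ennpowr I r"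
      by (simp add: mult_left_mono)
    then have "ennpowr (ennpowr (ell p (\<lambda>n. \<integral>\<^sup>+y. F n y \<partial>N)) r) (1 / r) \<le> ennpowr (ennpowr I r) (1 / r)"
      using r by (elim ennpowr_mono[rotated]) auto
    then show ?thesis using r by (simp add: ennpowr_ennpowr)
  qed
  then show ?thesis by (simp only: I_def L_def)
qed

text \<open>
  Young's inequality for convolution with a summable kernel: Minkowski's inequality for counting
  measure, since translates have the same norm.
\<close>

lemma ell_young:
  assumes p: "1 \<le> p"
  shows "ell p (\<lambda>n. \<Sum>\<^sub>\<int>i. a i * g (n - i)) \<le> (\<Sum>\<^sub>\<int>i. a i) * ell p g"
proof -
  have "ell p (\<lambda>n. \<Sum>\<^sub>\<int>i. a i * g (n - i)) \<le> (\<Sum>\<^sub>\<int>i. ell p (\<lambda>n. a i * g (n - i)))"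
    by (rule ell_minkowski[OF p]) simp
  also have "\<dots> = (\<Sum>\<^sub>\<int>i. a i * ell p g)"
    by (simp add: ell_cmult[OF p] ell_shift)
  also have "\<dots> = (\<Sum>\<^sub>\<int>i. a i) * ell p g"
    by (rule nn_integral_multc) simp
  finally show ?thesis .
qed

section \<open>The potential operator\<close>

lemma has_sum_count_space:
  fixes f :: "'a \<Rightarrow> real"
  assumes "(f has_sum s) UNIV"
  shows "integrable (count_space UNIV) f" "(\<integral>x. f x \<partial>count_space UNIV) = s"
proof -
  have "Infinite_Sum.abs_summable_on f UNIV"
    using assms summable_on_def summable_on_iff_abs_summable_on_real by blast
  then have a: "Infinite_Set_Sum.abs_summable_on f UNIV"
    by (simp only: abs_summable_equivalent)
  then show "integrable (count_space UNIV) f" by (simp add: abs_summable_on_def)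
  show "(\<integral>x. f x \<partial>count_space UNIV) = s"
    using infsetsum_infsum[OF a] infsumI[OF assms] by (simp add: infsetsum_def)
qed

lemma has_sum_nn_integral:
  fixes f :: "'a \<Rightarrow> real"
  assumes "(f has_sum s) UNIV" "\<And>x. 0 \<le> f x"
  shows "(\<integral>\<^sup>+x. ennreal (f x) \<partial>count_space UNIV) = ennreal s"
  using has_sum_count_space[OF assms(1)] assms(2) by (subst nn_integral_eq_integral) auto

definition wt :: "int \<Rightarrow> real" where
  "wt n = 1 + \<bar>real_of_int n\<bar>"

lemma wt_ge_1 [simp]: "1 \<le> wt n" and wt_pos [simp]: "0 < wt n" and wt_nonneg [simp]: "0 \<le> wt n"
  and wt_nonzero [simp]: "wt n \<noteq> 0"
  by (auto simp: wt_def)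

lemma wt_add_le: "wt (n + m) \<le> wt n + wt m - 1"
  by (simp add: wt_def)

lemma wt_minus [simp]: "wt (- n) = wt n" by (simp add: wt_def)

lemma wt_add_le_mult: "wt (n + m) \<le> wt n * wt m"
proof -
  have "0 \<le> (wt n - 1) * (wt m - 1)" by (intro mult_nonneg_nonneg) auto
  then show ?thesis using wt_add_le[of n m] by (simp add: algebra_simps)
qed

text \<open>
  Peetre's inequality, from submultiplicativity of the weight.
\<close>

lemma wt_powr_neg_le:
  assumes "c \<le> 0" shows "wt (n - m) powr c \<le> wt n powr (- c) * wt m powr c"
proof -
  have "(wt n * wt (n - m)) powr c \<le> wt m powr c"
    using assms wt_add_le_mult[of n "- (n - m)"] unfolding wt_minus by (intro powr_mono2') auto
  then have "wt n powr (- c) * (wt n powr c * wt (n - m) powr c) \<le> wt n powr (- c) * wt m powr c"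
    by (intro mult_left_mono) (auto simp: powr_mult)
  also have "wt n powr (- c) * (wt n powr c * wt (n - m) powr c) = wt (n - m) powr c"
    by (simp add: mult.assoc[symmetric] powr_add[symmetric])
  finally show ?thesis .
qed

abbreviation ell_minus_norm :: "real \<Rightarrow> (int \<Rightarrow> real) \<Rightarrow> ennreal" where
  "ell_minus_norm \<beta> u \<equiv> (\<Sum>\<^sub>\<int>m. ennreal (wt m powr (2 * \<beta> - 1) * \<bar>u m\<bar>))"

lemma ell_minus_iff:
  "u \<in> ell_minus \<beta> \<longleftrightarrow> ell_minus_norm \<beta> u < top"
proof -
  have e: "\<bar>u m\<bar> / (1 + \<bar>real_of_int m\<bar>) powr (1 - 2 * \<beta>) = wt m powr (2 * \<beta> - 1) * \<bar>u m\<bar>" for m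
  proof -
    have "wt m powr (2 * \<beta> - 1) = wt m powr (- (1 - 2 * \<beta>))" by simp
    also have "\<dots> = 1 / wt m powr (1 - 2 * \<beta>)" by (rule powr_minus_divide)
    finally show ?thesis by (simp add: wt_def)
  qed
  have "u \<in> ell_minus \<beta> \<longleftrightarrow> (\<lambda>m. wt m powr (2 * \<beta> - 1) * \<bar>u m\<bar>) summable_on UNIV"
    by (simp add: ell_minus_def e)
  also have "\<dots> \<longleftrightarrow> Infinite_Sum.abs_summable_on (\<lambda>m. wt m powr (2 * \<beta> - 1) * \<bar>u m\<bar>) UNIV"
    by (simp add: abs_mult)
  also have "\<dots> \<longleftrightarrow> integrable (count_space UNIV) (\<lambda>m. wt m powr (2 * \<beta> - 1) * \<bar>u m\<bar>)"
    by (simp only: abs_summable_equivalent abs_summable_on_def)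
  also have "\<dots> \<longleftrightarrow> ell_minus_norm \<beta> u < top"
    by (simp add: integrable_iff_bounded abs_mult)
  finally show ?thesis .
qed

lemma ell_minus_obtain:
  assumes "u \<in> ell_minus \<beta>"
  obtains S where "0 \<le> S" "ell_minus_norm \<beta> u = ennreal S"
  using assms unfolding ell_minus_iff
  by (cases "ell_minus_norm \<beta> u") auto

lemma quad_of_sublinear:
  assumes "\<And>n. \<bar>u n\<bar> \<le> C * wt n powr c" "0 \<le> c" "c \<le> 1"
  shows "quad u"
proof (rule quadI)
  fix n
  have "\<bar>u 0\<bar> \<le> C" using assms(1)[of 0] by (simp add: wt_def)
  then have C: "0 \<le> C" by linarith
  have "\<bar>u n\<bar> \<le> C * wt n powr c" by (rule assms(1))
  also have "\<dots> \<le> C * wt n powr 1" using C assms by (intro mult_left_mono powr_mono) auto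
  also have "\<dots> \<le> C * (2 * (1 + (real_of_int n)\<^sup>2))"
  proof (rule mult_left_mono[OF _ C])
    have "0 \<le> (\<bar>real_of_int n\<bar> - 1)\<^sup>2" by simp
    then have "2 * \<bar>real_of_int n\<bar> \<le> 1 + (real_of_int n)\<^sup>2" by (simp add: power2_diff)
    moreover have "0 \<le> (real_of_int n)\<^sup>2" by simp
    ultimately have "1 + \<bar>real_of_int n\<bar> \<le> 2 * (1 + (real_of_int n)\<^sup>2)" unfolding distrib_left by linarith
    then show "wt n powr 1 \<le> 2 * (1 + (real_of_int n)\<^sup>2)" by (simp add: wt_def)
  qed
  finally show "\<bar>u n\<bar> \<le> (C * 2) * (1 + (real_of_int n)\<^sup>2)" by (simp add: mult_ac)
qed

lemma quad_ell_minus: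
  assumes "u \<in> ell_minus \<beta>" "0 < \<beta>" "\<beta> < 1 / 2"
  shows "quad u"
proof -
  obtain S where S: "0 \<le> S" "ell_minus_norm \<beta> u = ennreal S"
    using ell_minus_obtain[OF assms(1)] by blast
  have "\<bar>u n\<bar> \<le> S * wt n powr (1 - 2 * \<beta>)" for n
  proof -
    have "ennreal (wt n powr (2 * \<beta> - 1) * \<bar>u n\<bar>) \<le> ennreal S"
      unfolding S(2)[symmetric] by (rule nn_integral_ge_point) simp
    then have "wt n powr (2 * \<beta> - 1) * \<bar>u n\<bar> \<le> S" using S(1) by simp
    then have "wt n powr (1 - 2 * \<beta>) * (wt n powr (2 * \<beta> - 1) * \<bar>u n\<bar>) \<le> wt n powr (1 - 2 * \<beta>) * S"
      by (intro mult_left_mono) auto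
    also have "wt n powr (1 - 2 * \<beta>) * (wt n powr (2 * \<beta> - 1) * \<bar>u n\<bar>) = \<bar>u n\<bar>"
    proof -
      have "wt n powr (1 - 2 * \<beta>) * wt n powr (2 * \<beta> - 1) = 1" by (simp flip: powr_add)
      then show ?thesis by (simp only: mult.assoc[symmetric] mult_1_left)
    qed
    finally show ?thesis by (simp only: mult.commute)
  qed
  then show ?thesis by (rule quad_of_sublinear) (use assms in auto)
qed

lemma ell_minus_shift:
  assumes "u \<in> ell_minus \<beta>" "\<beta> < 1 / 2"
  shows "(\<lambda>n. u (n + a)) \<in> ell_minus \<beta>"
proof -
  have b: "bij_betw (\<lambda>n. n + a) UNIV UNIV" by (rule bij_betwI[where g = "\<lambda>n. n - a"]) auto
  have "(\<Sum>\<^sub>\<int>m. ennreal (wt m powr (2 * \<beta> - 1) * \<bar>u (m + a)\<bar>))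
    \<le> (\<Sum>\<^sub>\<int>m. ennreal (wt a powr (1 - 2 * \<beta>)) * ennreal (wt (m + a) powr (2 * \<beta> - 1) * \<bar>u (m + a)\<bar>))"
  proof (rule nn_integral_mono)
    fix m
    have "wt m powr (2 * \<beta> - 1) \<le> wt a powr (1 - 2 * \<beta>) * wt (m + a) powr (2 * \<beta> - 1)"
      using wt_powr_neg_le[of "2 * \<beta> - 1" "a" "m + a"] assms(2) wt_minus[of m] by simp
    then have "wt m powr (2 * \<beta> - 1) * \<bar>u (m + a)\<bar> \<le> wt a powr (1 - 2 * \<beta>) * wt (m + a) powr (2 * \<beta> - 1) * \<bar>u (m + a)\<bar>"
      by (rule mult_right_mono) simp
    then show "ennreal (wt m powr (2 * \<beta> - 1) * \<bar>u (m + a)\<bar>)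
       \<le> ennreal (wt a powr (1 - 2 * \<beta>)) * ennreal (wt (m + a) powr (2 * \<beta> - 1) * \<bar>u (m + a)\<bar>)"
      by (simp add: ennreal_leI mult.assoc flip: ennreal_mult)
  qed
  also have "\<dots> = ennreal (wt a powr (1 - 2 * \<beta>)) * (\<Sum>\<^sub>\<int>m. ennreal (wt (m + a) powr (2 * \<beta> - 1) * \<bar>u (m + a)\<bar>))"
    by (rule nn_integral_cmult) simp
  also have "(\<Sum>\<^sub>\<int>m. ennreal (wt (m + a) powr (2 * \<beta> - 1) * \<bar>u (m + a)\<bar>))
     = ell_minus_norm \<beta> u"
    by (rule nn_integral_bij_count_space[OF b, of "\<lambda>m. ennreal (wt m powr (2 * \<beta> - 1) * \<bar>u m\<bar>)"])
  also have "ennreal (wt a powr (1 - 2 * \<beta>)) * \<dots> < top"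
    using assms(1) unfolding ell_minus_iff by (simp add: ennreal_mult_less_top)
  finally show ?thesis unfolding ell_minus_iff .
qed

lemma ell_minus_cmult: "u \<in> ell_minus \<beta> \<Longrightarrow> (\<lambda>n. c * u n) \<in> ell_minus \<beta>"
proof -
  assume u: "u \<in> ell_minus \<beta>"
  have "(\<Sum>\<^sub>\<int>m. ennreal (wt m powr (2 * \<beta> - 1) * \<bar>c * u m\<bar>))
    = (\<Sum>\<^sub>\<int>m. ennreal \<bar>c\<bar> * ennreal (wt m powr (2 * \<beta> - 1) * \<bar>u m\<bar>))"
    by (intro nn_integral_cong) (simp add: abs_mult mult.left_commute flip: ennreal_mult)
  also have "\<dots> = ennreal \<bar>c\<bar> * ell_minus_norm \<beta> u"
    by (rule nn_integral_cmult) simp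
  also have "\<dots> < top" using u unfolding ell_minus_iff by (simp add: ennreal_mult_less_top)
  finally show ?thesis unfolding ell_minus_iff .
qed

lemma ell_minus_add:
  assumes "u \<in> ell_minus \<beta>" "v \<in> ell_minus \<beta>" shows "(\<lambda>n. u n + v n) \<in> ell_minus \<beta>"
proof -
  have "(\<Sum>\<^sub>\<int>m. ennreal (wt m powr (2 * \<beta> - 1) * \<bar>u m + v m\<bar>))
    \<le> (\<Sum>\<^sub>\<int>m. ennreal (wt m powr (2 * \<beta> - 1) * \<bar>u m\<bar>) + ennreal (wt m powr (2 * \<beta> - 1) * \<bar>v m\<bar>))"
    by (intro nn_integral_mono)
       (auto simp: distrib_left[symmetric] simp flip: ennreal_plus intro!: ennreal_leI mult_left_mono)
  also have "\<dots> = ell_minus_norm \<beta> u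
      + (\<Sum>\<^sub>\<int>m. ennreal (wt m powr (2 * \<beta> - 1) * \<bar>v m\<bar>))"
    by (rule nn_integral_add) auto
  also have "\<dots> < top" using assms unfolding ell_minus_iff by simp
  finally show ?thesis unfolding ell_minus_iff .
qed

lemma ell_minus_lap:
  assumes "u \<in> ell_minus \<beta>" "\<beta> < 1 / 2" shows "lap u \<in> ell_minus \<beta>"
  using ell_minus_add[OF ell_minus_add[OF ell_minus_shift[OF assms, of 1] ell_minus_cmult[OF assms(1), of "-2"]]
      ell_minus_shift[OF assms, of "-1"]]
  by (simp add: lap_def[abs_def])

lemma ell_minus_lap_pow:
  assumes "u \<in> ell_minus \<beta>" "\<beta> < 1 / 2" shows "(lap ^^ k) u \<in> ell_minus \<beta>"
  by (induction k) (use assms ell_minus_lap in auto)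

text \<open>
  The negative fractional power without the constant \<open>1 / Gamma \<beta>\<close>.
\<close>

definition potential :: "real \<Rightarrow> (int \<Rightarrow> real) \<Rightarrow> int \<Rightarrow> real" where
  "potential \<beta> f n = (\<integral>\<tau>. heat \<tau> f n \<partial>riesz \<beta>)"

abbreviation wt_conv :: "real \<Rightarrow> (int \<Rightarrow> real) \<Rightarrow> int \<Rightarrow> ennreal" where
  "wt_conv \<beta> f n \<equiv> (\<Sum>\<^sub>\<int>m. ennreal (wt (n - m) powr (2 * \<beta> - 1) * \<bar>f m\<bar>))"

abbreviation abs_potential :: "real \<Rightarrow> (int \<Rightarrow> real) \<Rightarrow> int \<Rightarrow> ennreal" where
  "abs_potential \<beta> f n \<equiv> (\<integral>\<^sup>+\<tau>. ennreal (heat \<tau> (\<lambda>m. \<bar>f m\<bar>) n) \<partial>riesz \<beta>)"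

context
  fixes \<beta> :: real
  assumes \<beta>: "0 < \<beta>" "\<beta> < 1 / 2"
begin

lemma neg_frac_laplacian_eq_pot:
  assumes "f \<in> ell_minus \<beta>"
  shows "neg_frac_laplacian \<beta> f n = 1 / Gamma \<beta> * potential \<beta> f n"
proof -
  have q: "quad f" by (rule quad_ell_minus[OF assms \<beta>])
  have "(LBINT \<tau>:{0<..}. heat_semigroup \<tau> f n / \<tau> powr (1 - \<beta>))
     = (\<integral>\<tau>. (if 0 < \<tau> then \<tau> powr (\<beta> - 1) else 0) *\<^sub>R heat \<tau> f n \<partial>lborel)"
    unfolding set_lebesgue_integral_def
  proof (rule Bochner_Integration.integral_cong[OF refl])
    fix \<tau> :: real
    have "\<tau> powr (\<beta> - 1) = 1 / \<tau> powr (1 - \<beta>)" using powr_minus_divide[of \<tau> "1 - \<beta>"] by simp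
    then show "indicat_real {0<..} \<tau> *\<^sub>R (heat_semigroup \<tau> f n / \<tau> powr (1 - \<beta>))
       = (if 0 < \<tau> then \<tau> powr (\<beta> - 1) else 0) *\<^sub>R heat \<tau> f n"
      by (simp add: heat_semigroup_eq[OF _ q])
  qed
  also have "\<dots> = potential \<beta> f n"
    unfolding potential_def riesz_def using heat_measurable[OF q]
    by (intro integral_density[symmetric]) auto
  finally show ?thesis by (simp add: neg_frac_laplacian_def)
qed

text \<open>
  All quantities are nonnegative, so integral and sum may be interchanged freely; the inner integral is
  then the kernel bounded in \<open>riesz_kernel_le\<close>. This inequality is the source of both the absolute
  convergence of the potential and its growth estimate.
\<close>

lemma pot_abs_bound:
  obtains C where "0 < C"
    "\<And>f n. quad f \<Longrightarrow> abs_potential \<beta> f n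
        \<le> ennreal C * wt_conv \<beta> f n"
proof -
  obtain C where C: "C > 0"
    "\<And>n. (\<integral>\<^sup>+\<tau>. ennreal (heat \<tau> delta n) \<partial>riesz \<beta>) \<le> ennreal (C * wt n powr (2 * \<beta> - 1))"
    using riesz_kernel_le[OF \<beta>] unfolding wt_def by blast
  show ?thesis
  proof
    fix f n assume f: "quad f"
    have [measurable]: "(\<lambda>\<tau>. heat \<tau> delta j) \<in> borel_measurable borel" for j
      by (rule heat_measurable[OF quad_delta])
    have "abs_potential \<beta> f n
      = (\<integral>\<^sup>+\<tau>. (\<Sum>\<^sub>\<int>m. ennreal (heat \<tau> delta (n - m)) * ennreal \<bar>f m\<bar>) \<partial>riesz \<beta>)"
    proof (rule nn_integral_cong_AE, rule eventually_mono[OF AE_riesz_pos])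
      fix \<tau> :: real assume t: "0 < \<tau>"
      have "(\<Sum>\<^sub>\<int>m. ennreal (heat \<tau> delta (n - m) * \<bar>f m\<bar>)) = ennreal (heat \<tau> (\<lambda>m. \<bar>f m\<bar>) n)"
        using t f by (intro has_sum_nn_integral heat_has_sum quad_abs mult_nonneg_nonneg heat_delta_nonneg) auto
      then show "ennreal (heat \<tau> (\<lambda>m. \<bar>f m\<bar>) n) = (\<Sum>\<^sub>\<int>m. ennreal (heat \<tau> delta (n - m)) * ennreal \<bar>f m\<bar>)"
        using t heat_delta_nonneg[of \<tau>] by (simp add: ennreal_mult)
    qed
    also have "\<dots> = (\<Sum>\<^sub>\<int>m. \<integral>\<^sup>+\<tau>. ennreal (heat \<tau> delta (n - m)) * ennreal \<bar>f m\<bar> \<partial>riesz \<beta>)"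
      by (rule nn_integral_count_space_nn_integral) (auto, measurable)
    also have "\<dots> = (\<Sum>\<^sub>\<int>m. (\<integral>\<^sup>+\<tau>. ennreal (heat \<tau> delta (n - m)) \<partial>riesz \<beta>) * ennreal \<bar>f m\<bar>)"
      by (intro nn_integral_cong nn_integral_multc) measurable
    also have "\<dots> \<le> (\<Sum>\<^sub>\<int>m. ennreal (C * wt (n - m) powr (2 * \<beta> - 1)) * ennreal \<bar>f m\<bar>)"
      by (intro nn_integral_mono mult_right_mono C) auto
    also have "\<dots> = (\<Sum>\<^sub>\<int>m. ennreal C * ennreal (wt (n - m) powr (2 * \<beta> - 1) * \<bar>f m\<bar>))"
      using C(1) by (intro nn_integral_cong) (simp add: mult.assoc flip: ennreal_mult)
    also have "\<dots> = ennreal C * wt_conv \<beta> f n"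
      by (rule nn_integral_cmult) simp
    finally show "abs_potential \<beta> f n
        \<le> ennreal C * wt_conv \<beta> f n" .
  qed (rule C)
qed

lemma pot_abs_finite:
  assumes "f \<in> ell_minus \<beta>"
  obtains D where "0 \<le> D"
    "\<And>n. abs_potential \<beta> f n \<le> ennreal (D * wt n powr (1 - 2 * \<beta>))"
proof -
  obtain C where C: "0 < C"
    "\<And>n. abs_potential \<beta> f n
        \<le> ennreal C * wt_conv \<beta> f n"
    by (rule pot_abs_bound) (rule that, assumption, use quad_ell_minus[OF assms \<beta>] in blast)
  obtain S where S: "0 \<le> S" "ell_minus_norm \<beta> f = ennreal S"
    using ell_minus_obtain[OF assms] by blast
  show ?thesis
  proof
    show "0 \<le> C * S" using C S by simp
    fix n
    have "wt_conv \<beta> f n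
       \<le> (\<Sum>\<^sub>\<int>m. ennreal (wt n powr (1 - 2 * \<beta>)) * ennreal (wt m powr (2 * \<beta> - 1) * \<bar>f m\<bar>))"
    proof (rule nn_integral_mono)
      fix m
      have "wt (n - m) powr (2 * \<beta> - 1) * \<bar>f m\<bar> \<le> wt n powr (1 - 2 * \<beta>) * wt m powr (2 * \<beta> - 1) * \<bar>f m\<bar>"
        using wt_powr_neg_le[of "2 * \<beta> - 1" n m] \<beta> by (intro mult_right_mono) auto
      then show "ennreal (wt (n - m) powr (2 * \<beta> - 1) * \<bar>f m\<bar>)
        \<le> ennreal (wt n powr (1 - 2 * \<beta>)) * ennreal (wt m powr (2 * \<beta> - 1) * \<bar>f m\<bar>)"
        by (simp add: ennreal_leI mult.assoc flip: ennreal_mult)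
    qed
    also have "\<dots> = ennreal (wt n powr (1 - 2 * \<beta>)) * ennreal S"
      by (subst nn_integral_cmult) (auto simp: S)
    finally have "ennreal C * wt_conv \<beta> f n
      \<le> ennreal C * (ennreal (wt n powr (1 - 2 * \<beta>)) * ennreal S)" by (rule mult_left_mono) simp
    also have "\<dots> = ennreal (C * S * wt n powr (1 - 2 * \<beta>))"
      using C S by (simp add: ennreal_mult mult_ac)
    finally show "abs_potential \<beta> f n \<le> ennreal (C * S * wt n powr (1 - 2 * \<beta>))"
      using C(2)[of n] by (rule order_trans[rotated])
  qed
qed

lemma pot_le_abs:
  assumes "quad f"
  shows "(\<integral>\<^sup>+\<tau>. ennreal (norm (heat \<tau> f n)) \<partial>riesz \<beta>) \<le> abs_potential \<beta> f n"
  by (rule nn_integral_mono_AE, rule eventually_mono[OF AE_riesz_pos])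
     (auto intro!: ennreal_leI heat_abs_le assms)

lemma pot_integrable:
  assumes "f \<in> ell_minus \<beta>" shows "integrable (riesz \<beta>) (\<lambda>\<tau>. heat \<tau> f n)"
proof -
  have q: "quad f" by (rule quad_ell_minus[OF assms \<beta>])
  obtain D where "\<And>n. abs_potential \<beta> f n \<le> ennreal (D * wt n powr (1 - 2 * \<beta>))"
    using pot_abs_finite[OF assms] by blast
  then have "(\<integral>\<^sup>+\<tau>. ennreal (norm (heat \<tau> f n)) \<partial>riesz \<beta>) \<le> ennreal (D * wt n powr (1 - 2 * \<beta>))"
    using pot_le_abs[OF q, of n] by (rule order_trans[rotated])
  then have "(\<integral>\<^sup>+\<tau>. ennreal (norm (heat \<tau> f n)) \<partial>riesz \<beta>) < \<infinity>"
    using ennreal_less_top by (simp add: le_less_trans)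
  then show ?thesis using heat_measurable[OF q] by (intro integrableI_bounded) auto
qed

lemma pot_abs_le_wt:
  assumes "f \<in> ell_minus \<beta>"
  obtains D where "\<And>n. (\<integral>\<tau>. \<bar>heat \<tau> f n\<bar> \<partial>riesz \<beta>) \<le> D * wt n powr (1 - 2 * \<beta>)"
proof -
  have q: "quad f" by (rule quad_ell_minus[OF assms \<beta>])
  obtain D where D: "0 \<le> D" "\<And>n. abs_potential \<beta> f n \<le> ennreal (D * wt n powr (1 - 2 * \<beta>))"
    using pot_abs_finite[OF assms] by blast
  have "(\<integral>\<tau>. \<bar>heat \<tau> f n\<bar> \<partial>riesz \<beta>) \<le> D * wt n powr (1 - 2 * \<beta>)" for n
  proof -
    have "ennreal (\<integral>\<tau>. \<bar>heat \<tau> f n\<bar> \<partial>riesz \<beta>) = (\<integral>\<^sup>+\<tau>. ennreal (norm (heat \<tau> f n)) \<partial>riesz \<beta>)"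
      using pot_integrable[OF assms, of n] by (subst nn_integral_eq_integral) auto
    also have "\<dots> \<le> ennreal (D * wt n powr (1 - 2 * \<beta>))"
      using pot_le_abs[OF q] D(2) by (rule order_trans)
    finally show ?thesis using D(1) by (subst (asm) ennreal_le_iff) auto
  qed
  then show ?thesis by (rule that)
qed

lemma quad_pot_abs:
  assumes "f \<in> ell_minus \<beta>" shows "quad (\<lambda>n. \<integral>\<tau>. \<bar>heat \<tau> f n\<bar> \<partial>riesz \<beta>)"
proof -
  obtain D where "\<And>n. (\<integral>\<tau>. \<bar>heat \<tau> f n\<bar> \<partial>riesz \<beta>) \<le> D * wt n powr (1 - 2 * \<beta>)"
    using pot_abs_le_wt[OF assms] by blast
  then show ?thesis using \<beta> by (intro quad_of_sublinear[where C = D and c = "1 - 2 * \<beta>"]) auto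
qed

lemma pot_abs_le: "\<bar>potential \<beta> f n\<bar> \<le> (\<integral>\<tau>. \<bar>heat \<tau> f n\<bar> \<partial>riesz \<beta>)"
  unfolding potential_def by (rule integral_abs_bound)

lemma quad_pot:
  assumes "f \<in> ell_minus \<beta>" shows "quad (potential \<beta> f)"
proof -
  obtain C where "\<And>n. \<bar>\<integral>\<tau>. \<bar>heat \<tau> f n\<bar> \<partial>riesz \<beta>\<bar> \<le> C * (1 + (real_of_int n)\<^sup>2)"
    using quad_pot_abs[OF assms] unfolding quad_def by blast
  then have "\<bar>potential \<beta> f n\<bar> \<le> C * (1 + (real_of_int n)\<^sup>2)" for n
    using pot_abs_le[of f n] by (meson abs_ge_self order_trans)
  then show ?thesis by (rule quadI)
qed

lemma pot_lap:
  assumes "f \<in> ell_minus \<beta>" shows "potential \<beta> (lap f) = lap (potential \<beta> f)"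
proof
  fix n
  have q: "quad f" by (rule quad_ell_minus[OF assms \<beta>])
  show "potential \<beta> (lap f) n = lap (potential \<beta> f) n"
    using pot_integrable[OF assms] by (simp add: potential_def heat_lap[OF q] lap_def)
qed

lemma pot_lap_pow:
  assumes "f \<in> ell_minus \<beta>" shows "potential \<beta> ((lap ^^ k) f) = (lap ^^ k) (potential \<beta> f)"
  by (induction k) (use assms \<beta> in \<open>auto simp: pot_lap ell_minus_lap_pow\<close>)

text \<open>
  Fubini's theorem and the semigroup law: the heat flow acts under the integral that defines the
  potential, where it merely shifts the time.
\<close>

lemma heat_pot:
  assumes "f \<in> ell_minus \<beta>" "0 \<le> t"
  shows "heat t (potential \<beta> f) n = (\<integral>\<tau>. heat (t + \<tau>) f n \<partial>riesz \<beta>)"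
proof -
  have q: "quad f" by (rule quad_ell_minus[OF assms(1) \<beta>])
  interpret pair_sigma_finite "count_space (UNIV :: int set)" "riesz \<beta>"
    by (intro pair_sigma_finite.intro sigma_finite_measure_count_space sigma_finite_riesz)
  define F where "F j \<tau> = heat t delta (n - j) * heat \<tau> f j" for j \<tau>
  have int: "integrable (count_space UNIV \<Otimes>\<^sub>M riesz \<beta>) (case_prod F)"
  proof (rule Fubini_integrable)
    show "case_prod F \<in> borel_measurable (count_space UNIV \<Otimes>\<^sub>M riesz \<beta>)"
      using heat_measurable[OF q] unfolding F_def
      by (intro measurable_pair_measure_countable1) auto
    have "(\<integral>\<tau>. norm (case (j, \<tau>) of (j, \<tau>) \<Rightarrow> F j \<tau>) \<partial>riesz \<beta>)
       = heat t delta (n - j) * (\<integral>\<tau>. \<bar>heat \<tau> f j\<bar> \<partial>riesz \<beta>)" for j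
      using heat_delta_nonneg[OF assms(2)] by (simp add: F_def abs_mult)
    then show "integrable (count_space UNIV) (\<lambda>j. \<integral>\<tau>. norm (case (j, \<tau>) of (j, \<tau>) \<Rightarrow> F j \<tau>) \<partial>riesz \<beta>)"
      using has_sum_count_space(1)[OF heat_has_sum[OF assms(2) quad_pot_abs[OF assms(1)]], of n] by simp
    show "AE j in count_space UNIV. integrable (riesz \<beta>) (\<lambda>\<tau>. case (j, \<tau>) of (j, \<tau>) \<Rightarrow> F j \<tau>)"
      using pot_integrable[OF assms(1)] by (simp add: F_def)
  qed
  have "heat t (potential \<beta> f) n = (\<integral>j. heat t delta (n - j) * potential \<beta> f j \<partial>count_space UNIV)"
    using has_sum_count_space(2)[OF heat_has_sum[OF assms(2) quad_pot[OF assms(1)]]] by simp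
  also have "\<dots> = (\<integral>j. \<integral>\<tau>. F j \<tau> \<partial>riesz \<beta> \<partial>count_space UNIV)"
    by (simp add: F_def potential_def)
  also have "\<dots> = (\<integral>\<tau>. \<integral>j. F j \<tau> \<partial>count_space UNIV \<partial>riesz \<beta>)"
    by (rule Fubini_integral[OF int, symmetric])
  also have "\<dots> = (\<integral>\<tau>. heat (t + \<tau>) f n \<partial>riesz \<beta>)"
  proof (rule integral_cong_AE)
    show "(\<lambda>\<tau>. heat (t + \<tau>) f n) \<in> borel_measurable (riesz \<beta>)"
      using measurable_compose[OF _ heat_measurable[OF q, of n], of "\<lambda>\<tau>. t + \<tau>" borel] by simp
    show "(\<lambda>\<tau>. \<integral>j. F j \<tau> \<partial>count_space UNIV) \<in> borel_measurable (riesz \<beta>)"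
      using integrable_snd[OF int] by (rule borel_measurable_integrable)
    show "AE \<tau> in riesz \<beta>. (\<integral>j. F j \<tau> \<partial>count_space UNIV) = heat (t + \<tau>) f n"
    proof (rule eventually_mono[OF AE_riesz_pos])
      fix \<tau> :: real assume t: "0 < \<tau>"
      then have qh: "quad (heat \<tau> f)" by (intro quad_heat q) simp
      show "(\<integral>j. F j \<tau> \<partial>count_space UNIV) = heat (t + \<tau>) f n"
        using has_sum_count_space(2)[OF heat_has_sum[OF assms(2) qh]] heat_semigroup_law[OF q assms(2), of \<tau>] t
        by (simp add: F_def)
    qed
  qed
  finally show ?thesis .
qed

end

section \<open>Growth of the potential\<close>

text \<open>
  Sums over \<open>\<int>\<close> of quantities controlled by \<open>\<bar>j\<bar>\<close> are bounded by twice a bound for the partial sums over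
  \<open>\<nat>\<close>.
\<close>

lemma nn_integral_int_le:
  fixes a :: "nat \<Rightarrow> real"
  assumes \<phi>: "\<And>j. \<phi> j \<le> ennreal (a (nat \<bar>j\<bar>))" and a: "\<And>k. 0 \<le> a k"
    and B: "\<And>N. (\<Sum>k<N. a k) \<le> B"
  shows "(\<Sum>\<^sub>\<int>j. \<phi> j) \<le> ennreal (2 * B)"
proof -
  have B0: "0 \<le> B" using B[of 0] by simp
  have 1: "(\<Sum>k. \<phi> (int k)) \<le> ennreal B"
  proof (rule suminf_le_const[OF summableI])
    fix N
    have "(\<Sum>k<N. \<phi> (int k)) \<le> (\<Sum>k<N. ennreal (a k))"
    proof (rule sum_mono)
      fix k show "\<phi> (int k) \<le> ennreal (a k)" using \<phi>[of "int k"] by simp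
    qed
    also have "\<dots> \<le> ennreal B" using a B by (simp add: sum_ennreal ennreal_leI)
    finally show "(\<Sum>k<N. \<phi> (int k)) \<le> ennreal B" .
  qed
  have 2: "(\<Sum>k. \<phi> (- 1 - int k)) \<le> ennreal B"
  proof (rule suminf_le_const[OF summableI])
    fix N
    have "(\<Sum>k<N. \<phi> (- 1 - int k)) \<le> (\<Sum>k<N. ennreal (a (Suc k)))"
    proof (rule sum_mono)
      fix k
      have "nat \<bar>- 1 - int k\<bar> = Suc k" by auto
      then show "\<phi> (- 1 - int k) \<le> ennreal (a (Suc k))" using \<phi>[of "- 1 - int k"] by (simp only:)
    qed
    also have "\<dots> = ennreal (\<Sum>k<N. a (Suc k))" using a by (simp add: sum_ennreal)
    also have "\<dots> \<le> ennreal B"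
      using B[of "Suc N"] a[of 0] unfolding sum.lessThan_Suc_shift by (intro ennreal_leI) linarith
    finally show "(\<Sum>k<N. \<phi> (- 1 - int k)) \<le> ennreal B" .
  qed
  have "(\<Sum>\<^sub>\<int>j. \<phi> j) \<le> ennreal B + ennreal B"
    unfolding nn_integral_int_split by (intro add_mono 1 2)
  then show ?thesis using B0 by (simp flip: ennreal_plus)
qed

lemma wt_nat: "wt j = real (nat \<bar>j\<bar>) + 1"
  by (simp add: wt_def)

text \<open>
  Concavity of \<open>x \<mapsto> x\<^sup>s\<close>, as a telescoping majorant for \<open>wt_sum_small\<close>.
\<close>

lemma powr_increment:
  assumes "0 < s" "s < 1"
  shows "s * (real k + 1) powr (s - 1) \<le> (real k + 1) powr s - real k powr s"
proof (cases "k = 0")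
  case True
  then show ?thesis using assms by simp
next
  case False
  let ?y = "real k + 1"
  have "real k powr s * ?y powr (1 - s) \<le> s * real k + (1 - s) * ?y"
    using assms False by (intro Youngs_inequality_0) auto
  also have "\<dots> = ?y - s" by (simp add: algebra_simps)
  finally have "real k powr s * ?y powr (1 - s) * ?y powr (s - 1) \<le> (?y - s) * ?y powr (s - 1)"
    by (rule mult_right_mono) simp
  moreover have "real k powr s * ?y powr (1 - s) * ?y powr (s - 1) = real k powr s"
    by (simp add: mult.assoc flip: powr_add)
  moreover have "(?y - s) * ?y powr (s - 1) = ?y powr s - s * ?y powr (s - 1)"
  proof -
    have "?y * ?y powr (s - 1) = ?y powr s" by (simp add: powr_diff)
    then show ?thesis by (simp only: left_diff_distrib)
  qed
  ultimately show ?thesis by linarith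
qed

lemma wt_sum_small:
  assumes s: "0 < s" "s < 1" and X: "1 \<le> X"
  shows "(\<Sum>\<^sub>\<int>j. ennreal (if wt j \<le> X then wt j powr (s - 1) else 0)) \<le> ennreal (2 * (X powr s / s))"
proof (rule nn_integral_int_le)
  let ?a = "\<lambda>k. if real k + 1 \<le> X then (real k + 1) powr (s - 1) else 0"
  fix N
  have "(\<Sum>k<N. ?a k) \<le> (min (real N) X) powr s / s"
  proof (induction N)
    case 0 then show ?case using X by simp
  next
    case (Suc N)
    show ?case
    proof (cases "real N + 1 \<le> X")
      case True
      have "(real N + 1) powr (s - 1) \<le> ((real N + 1) powr s - real N powr s) / s"
        using powr_increment[OF s, of N] s by (simp add: pos_le_divide_eq mult.commute)
      then show ?thesis using Suc.IH True by (simp add: min_def diff_divide_distrib add.commute)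
    next
      case False
      then have "(min (real N) X) powr s / s \<le> (min (real (Suc N)) X) powr s / s"
        using X s by (intro divide_right_mono powr_mono2) auto
      then show ?thesis using Suc.IH False by simp
    qed
  qed
  also have "\<dots> \<le> X powr s / s" using X s by (intro divide_right_mono powr_mono2) auto
  finally show "(\<Sum>k<N. ?a k) \<le> X powr s / s" .
qed (auto simp: wt_nat)

lemma wt_sum_large:
  assumes X: "1 \<le> X"
  shows "(\<Sum>\<^sub>\<int>j. ennreal (if X < wt j then wt j powr (- 2) else 0)) \<le> ennreal (2 * (2 / X))"
proof (rule nn_integral_int_le)
  let ?a = "\<lambda>k. if X < real k + 1 then (real k + 1) powr (- 2) else 0"
  fix N
  \<comment> \<open>The maximum makes the telescoping bound vanish as long as no term has been counted.\<close>
  have "(\<Sum>k<N. ?a k) \<le> 2 / X - 2 / max X (real N + 1)"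
  proof (induction N)
    case 0 then show ?case using X by (simp add: max_def)
  next
    case (Suc N)
    show ?case
    proof (cases "X < real N + 1")
      case True
      have "(real N + 1) powr (- 2) = 1 / ((real N + 1) * (real N + 1))"
        by (simp add: powr_minus_divide power2_eq_square)
      also have "\<dots> \<le> 2 / (real N + 1) - 2 / (real N + 2)"
        by (simp add: divide_simps)
      finally show ?thesis using Suc.IH True by (simp add: max_def add.commute)
    next
      case False
      have "2 / max X (real (Suc N) + 1) \<le> 2 / max X (real N + 1)"
        using X by (intro divide_left_mono mult_pos_pos) auto
      then show ?thesis using Suc.IH False by simp
    qed
  qed
  also have "\<dots> \<le> 2 / X" using X by simp
  finally show "(\<Sum>k<N. ?a k) \<le> 2 / X" .
qed (auto simp: wt_nat)

lemma wt_summable: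
  assumes "0 < s"
  shows "(\<Sum>\<^sub>\<int>j. ennreal (wt j powr (- 1 - s))) < top"
proof -
  have "summable (\<lambda>k. real k powr (- 1 - s))" using assms by (subst summable_real_powr_iff) simp
  then have *: "summable (\<lambda>k. (real k + 1) powr (- 1 - s))"
    by (subst (asm) summable_Suc_iff[symmetric]) (simp add: add.commute)
  have "(\<Sum>\<^sub>\<int>j. ennreal (wt j powr (- 1 - s))) \<le> ennreal (2 * (\<Sum>k. (real k + 1) powr (- 1 - s)))"
    by (rule nn_integral_int_le[where a = "\<lambda>k. (real k + 1) powr (- 1 - s)"])
       (auto simp: wt_nat intro!: sum_le_suminf *)
  then show ?thesis using ennreal_less_top le_less_trans by blast
qed

lemma mu_nn_integral:
  "(\<integral>\<^sup>+n. F n \<partial>mu) = (\<Sum>\<^sub>\<int>n. ennreal (1 / wt n) * F n)"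
  unfolding mu_def wt_def by (rule nn_integral_density) auto

lemma in_lq_mu_iff:
  assumes "1 \<le> q" "q \<noteq> top"
  shows "in_lq_mu q g \<longleftrightarrow> (\<Sum>\<^sub>\<int>n. ennreal (1 / wt n) * ennpowr (ennreal \<bar>g n\<bar>) (enn2real q)) < top"
  using assms by (simp add: in_lq_mu_def Lnorm_def mu_nn_integral)

text \<open>
  Every integer has positive mass, so \<open>\<mu>\<close> has no nonempty null sets.
\<close>

lemma AE_mu: "(AE n in mu. P n) \<longleftrightarrow> (\<forall>n. P n)"
  unfolding mu_def by (subst AE_density) (auto simp: AE_count_space intro!: divide_pos_pos)

lemma in_lq_mu_top: "in_lq_mu top g \<longleftrightarrow> (\<exists>C. \<forall>n. \<bar>g n\<bar> \<le> C)"
proof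
  assume a: "in_lq_mu top g"
  let ?s = "esssup mu (\<lambda>n. ennreal \<bar>g n\<bar>)"
  have "?s < top" using a by (simp add: in_lq_mu_def Lnorm_def)
  then obtain C where C: "0 \<le> C" "?s = ennreal C" by (cases ?s) auto
  have "\<forall>n. ennreal \<bar>g n\<bar> \<le> ?s" using esssup_AE[of "\<lambda>n. ennreal \<bar>g n\<bar>" mu] unfolding AE_mu .
  then show "\<exists>C. \<forall>n. \<bar>g n\<bar> \<le> C" using C by auto
next
  assume "\<exists>C. \<forall>n. \<bar>g n\<bar> \<le> C"
  then obtain C where "\<forall>n. \<bar>g n\<bar> \<le> C" by blast
  then have "esssup mu (\<lambda>n. ennreal \<bar>g n\<bar>) \<le> ennreal C"
    by (intro esssup_I) (auto simp: mu_def AE_mu[unfolded mu_def] intro!: ennreal_leI)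
  also have "\<dots> < top" by simp
  finally show "in_lq_mu top g" by (simp add: in_lq_mu_def Lnorm_def)
qed

text \<open>
  Schur's test. Jensen's inequality with respect to the row \<open>B n\<close> moves the power
  \<open>r\<close> onto \<open>h\<close>; then the order of summation is interchanged and the column bound is applied.
\<close>

lemma schur_finite:
  fixes B :: "int \<Rightarrow> int \<Rightarrow> ennreal"
  assumes r: "1 \<le> r" and R: "0 < R"
    and rows: "\<And>n. (\<Sum>\<^sub>\<int>m. B n m) \<le> ennreal R"
    and cols: "\<And>m. (\<Sum>\<^sub>\<int>n. v n * B n m) \<le> ennreal R' * v m"
    and h: "(\<Sum>\<^sub>\<int>m. v m * ennpowr (h m) r) < top"
  shows "(\<Sum>\<^sub>\<int>n. v n * ennpowr (\<Sum>\<^sub>\<int>m. B n m * h m) r) < top"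
proof -
  define c where "c = ennpowr (ennreal R) r * ennreal (1 / R)"
  have c: "c < top" using R by (simp add: c_def ennreal_mult_less_top)
  have "(\<Sum>\<^sub>\<int>n. v n * ennpowr (\<Sum>\<^sub>\<int>m. B n m * h m) r)
     \<le> (\<Sum>\<^sub>\<int>n. v n * (c * (\<Sum>\<^sub>\<int>m. B n m * ennpowr (h m) r)))"
    unfolding c_def by (intro nn_integral_mono mult_left_mono ennpowr_nn_integral_mass_le r R rows) auto
  also have "\<dots> = (\<Sum>\<^sub>\<int>n. (\<Sum>\<^sub>\<int>m. c * (v n * B n m * ennpowr (h m) r)))"
    by (simp add: nn_integral_cmult[symmetric] mult_ac)
  also have "\<dots> = (\<Sum>\<^sub>\<int>m. (\<Sum>\<^sub>\<int>n. c * (v n * B n m * ennpowr (h m) r)))"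
    by (rule nn_integral_count_space_nn_integral[where f = "\<lambda>m n. c * (v n * B n m * ennpowr (h m) r)"]) auto
  also have "\<dots> = (\<Sum>\<^sub>\<int>m. c * ((\<Sum>\<^sub>\<int>n. v n * B n m) * ennpowr (h m) r))"
    by (simp add: nn_integral_cmult nn_integral_multc)
  also have "\<dots> \<le> (\<Sum>\<^sub>\<int>m. c * ((ennreal R' * v m) * ennpowr (h m) r))"
    by (intro nn_integral_mono mult_left_mono mult_right_mono cols) auto
  also have "\<dots> = c * (ennreal R' * (\<Sum>\<^sub>\<int>m. v m * ennpowr (h m) r))"
    by (simp add: nn_integral_cmult mult.assoc)
  also have "\<dots> < top" using c h by (simp add: ennreal_mult_less_top)
  finally show ?thesis .
qed

context
  fixes \<beta> :: real
  assumes \<beta>: "0 < \<beta>" "\<beta> < 1 / 2"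
begin

text \<open>
  The part of the potential kernel that acts between \<open>m\<close> and a site \<open>n\<close> of at least comparable size. The
  growth allowed for the potential exceeds that of \<open>f\<close> by the order \<open>2\<beta>\<close>, which is divided out here. What
  remains is homogeneous of degree \<open>-1\<close>, the borderline for Schur's test with respect to \<open>\<mu>\<close>.
\<close>

definition near :: "int \<Rightarrow> int \<Rightarrow> real" where
  "near n m = (if wt m \<le> 2 * wt n then wt (n - m) powr (2 * \<beta> - 1) * wt n powr (- 2 * \<beta>) else 0)"

lemma near_nonneg: "0 \<le> near n m" by (simp add: near_def)

lemma near_rows:
  "(\<Sum>\<^sub>\<int>m. ennreal (near n m)) \<le> ennreal (3 powr (2 * \<beta>) / \<beta>)"
proof -
  let ?s = "\<lambda>j. ennreal (if wt j \<le> 3 * wt n then wt j powr (2 * \<beta> - 1) else 0)"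
  have b: "bij_betw (\<lambda>m. n - m) UNIV UNIV" by (rule bij_betwI[where g = "\<lambda>m. n - m"]) auto
  have "(\<Sum>\<^sub>\<int>m. ennreal (near n m))
    \<le> (\<Sum>\<^sub>\<int>m. ennreal (wt n powr (- 2 * \<beta>)) * ?s (n - m))"
  proof (rule nn_integral_mono)
    fix m
    have "wt (n - m) \<le> wt n + wt m" using wt_add_le[of n "- m"] by simp
    then show "ennreal (near n m) \<le> ennreal (wt n powr (- 2 * \<beta>)) * ?s (n - m)"
      by (simp add: near_def mult.commute flip: ennreal_mult)
  qed
  also have "\<dots> = ennreal (wt n powr (- 2 * \<beta>)) * (\<Sum>\<^sub>\<int>m. ?s (n - m))"
    by (rule nn_integral_cmult) simp
  also have "(\<Sum>\<^sub>\<int>m. ?s (n - m))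
     = (\<Sum>\<^sub>\<int>j. ?s j)"
    by (rule nn_integral_bij_count_space[OF b, of ?s])
  also have "\<dots> \<le> ennreal (2 * ((3 * wt n) powr (2 * \<beta>) / (2 * \<beta>)))"
    by (rule wt_sum_small) (use \<beta> wt_ge_1[of n] in \<open>auto simp del: wt_ge_1\<close>)
  also have "ennreal (wt n powr (- 2 * \<beta>)) * ennreal (2 * ((3 * wt n) powr (2 * \<beta>) / (2 * \<beta>))) = ennreal (3 powr (2 * \<beta>) / \<beta>)"
  proof -
    have "wt n powr (- 2 * \<beta>) * wt n powr (2 * \<beta>) = 1" by (simp flip: powr_add)
    then have "wt n powr (- 2 * \<beta>) * (2 * ((3 * wt n) powr (2 * \<beta>) / (2 * \<beta>))) = 3 powr (2 * \<beta>) / \<beta>"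
      using \<beta> by (simp add: powr_mult field_simps)
    then show ?thesis using \<beta> by (simp flip: ennreal_mult)
  qed
  finally show ?thesis by (simp add: mult_left_mono)
qed

text \<open>
  If \<open>n - m\<close> is at most of the order of \<open>D = wt m\<close>, then \<open>wt n\<close> is bounded below by \<open>D / 2\<close> and the sum
  of \<open>2\<beta> - 1\<close> powers over that range has order \<open>2\<beta>\<close> in \<open>D\<close>. Otherwise \<open>wt n\<close> is comparable to
  \<open>wt (n - m)\<close>, and the terms are dominated by the summable tail \<open>wt (n - m)\<^sup>-\<^sup>2\<close>.
\<close>

lemma near_cols:
  obtains R' where "\<And>m. (\<Sum>\<^sub>\<int>n. ennreal (1 / wt n) * ennreal (near n m)) \<le> ennreal R' * ennreal (1 / wt m)"
proof
  fix m
  define D where "D = wt m"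
  have D: "1 \<le> D" by (simp add: D_def)
  define c where "c = 2 powr (2 * \<beta> + 1)"
  have c: "0 < c" by (simp add: c_def)
  let ?s = "\<lambda>j. ennreal (if wt j \<le> 4 * D then wt j powr (2 * \<beta> - 1) else 0)"
  let ?l = "\<lambda>j. ennreal (if 4 * D < wt j then wt j powr (- 2) else 0)"
  have b: "bij_betw (\<lambda>n. n - m) UNIV UNIV" by (rule bij_betwI[where g = "\<lambda>n. n + m"]) auto
  have "(\<Sum>\<^sub>\<int>n. ennreal (1 / wt n) * ennreal (near n m))
    \<le> (\<Sum>\<^sub>\<int>n. ennreal (c * D powr (- 2 * \<beta> - 1)) * ?s (n - m) + ennreal c * ?l (n - m))"
  proof (rule nn_integral_mono)
    fix n
    show "ennreal (1 / wt n) * ennreal (near n m) \<le> ennreal (c * D powr (- 2 * \<beta> - 1)) * ?s (n - m) + ennreal c * ?l (n - m)"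
    proof (cases "D \<le> 2 * wt n")
      case True
      have "1 / wt n * wt n powr (- 2 * \<beta>) = wt n powr (- 2 * \<beta> - 1)"
        by (simp add: powr_diff)
      moreover have "1 / wt n * near n m = wt (n - m) powr (2 * \<beta> - 1) * (1 / wt n * wt n powr (- 2 * \<beta>))"
        using True by (simp add: near_def D_def)
      ultimately have e: "1 / wt n * near n m = wt (n - m) powr (2 * \<beta> - 1) * wt n powr (- 2 * \<beta> - 1)"
        by (simp only:)
      have low: "wt n powr (- 2 * \<beta> - 1) \<le> c * x powr (- 2 * \<beta> - 1)" if "0 < x" "x \<le> 2 * wt n" for x
      proof -
        have "wt n powr (- 2 * \<beta> - 1) \<le> (x / 2) powr (- 2 * \<beta> - 1)"
          using that \<beta> by (intro powr_mono2') auto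
        also have "\<dots> = c * x powr (- 2 * \<beta> - 1)"
        proof -
          have "2 powr (- 2 * \<beta> - 1) = 1 / c"
            using powr_minus_divide[of 2 "2 * \<beta> + 1"] by (simp add: c_def)
          then show ?thesis using that by (simp add: powr_divide)
        qed
        finally show ?thesis .
      qed
      show ?thesis
      proof (cases "wt (n - m) \<le> 4 * D")
        case le: True
        have "1 / wt n * near n m \<le> (c * D powr (- 2 * \<beta> - 1)) * wt (n - m) powr (2 * \<beta> - 1)"
          unfolding e using low[of D] True D by (subst mult.commute) (intro mult_right_mono, auto)
        then have "ennreal (1 / wt n) * ennreal (near n m) \<le> ennreal (c * D powr (- 2 * \<beta> - 1)) * ?s (n - m)"
          using c le near_nonneg[of n m] by (simp add: ennreal_leI flip: ennreal_mult)
        then show ?thesis by (rule order_trans) simp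
      next
        case False
        have "wt (n - m) \<le> wt n + D" using wt_add_le[of n "- m"] by (simp add: D_def)
        then have "wt (n - m) \<le> 2 * wt n" using False D by linarith
        then have "wt (n - m) powr (2 * \<beta> - 1) * wt n powr (- 2 * \<beta> - 1) \<le> wt (n - m) powr (2 * \<beta> - 1) * (c * wt (n - m) powr (- 2 * \<beta> - 1))"
          by (intro mult_left_mono low) auto
        also have "\<dots> = c * wt (n - m) powr (- 2)"
          by (simp add: powr_add[symmetric] mult.left_commute)
        finally have "1 / wt n * near n m \<le> c * wt (n - m) powr (- 2)" unfolding e .
        then have "ennreal (1 / wt n) * ennreal (near n m) \<le> ennreal c * ?l (n - m)"
          using c False near_nonneg[of n m] by (simp add: ennreal_leI flip: ennreal_mult)
        then show ?thesis by (rule order_trans) simp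
      qed
    qed (simp add: near_def D_def)
  qed
  also have "\<dots> = ennreal (c * D powr (- 2 * \<beta> - 1)) * (\<Sum>\<^sub>\<int>n. ?s (n - m)) + ennreal c * (\<Sum>\<^sub>\<int>n. ?l (n - m))"
    by (simp add: nn_integral_add nn_integral_cmult)
  also have "(\<Sum>\<^sub>\<int>n. ?s (n - m)) = (\<Sum>\<^sub>\<int>n. ?s n)"
    by (rule nn_integral_bij_count_space[OF b, of ?s])
  also have "(\<Sum>\<^sub>\<int>n. ?l (n - m)) = (\<Sum>\<^sub>\<int>n. ?l n)"
    by (rule nn_integral_bij_count_space[OF b, of ?l])
  also have "ennreal (c * D powr (- 2 * \<beta> - 1)) * (\<Sum>\<^sub>\<int>n. ?s n) + ennreal c * (\<Sum>\<^sub>\<int>n. ?l n)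
    \<le> ennreal (c * D powr (- 2 * \<beta> - 1)) * ennreal (2 * ((4 * D) powr (2 * \<beta>) / (2 * \<beta>))) + ennreal c * ennreal (2 * (2 / (4 * D)))"
    using \<beta> D by (intro add_mono mult_left_mono wt_sum_small wt_sum_large) auto
  also have "\<dots> = ennreal (c * D powr (- 2 * \<beta> - 1) * (2 * ((4 * D) powr (2 * \<beta>) / (2 * \<beta>))) + c * (2 * (2 / (4 * D))))"
    using c \<beta> D by (simp flip: ennreal_mult ennreal_plus)
  also have "c * D powr (- 2 * \<beta> - 1) * (2 * ((4 * D) powr (2 * \<beta>) / (2 * \<beta>))) + c * (2 * (2 / (4 * D)))
     = (c * 4 powr (2 * \<beta>) / \<beta> + c) * (1 / D)"
  proof -
    have "D powr (- 2 * \<beta> - 1) * D powr (2 * \<beta>) = 1 / D"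
      using D by (simp add: powr_minus_divide flip: powr_add)
    moreover have "c * D powr (- 2 * \<beta> - 1) * (2 * ((4 * D) powr (2 * \<beta>) / (2 * \<beta>)))
        = c * 4 powr (2 * \<beta>) / \<beta> * (D powr (- 2 * \<beta> - 1) * D powr (2 * \<beta>))"
      using D by (simp add: powr_mult mult_ac)
    ultimately have "c * D powr (- 2 * \<beta> - 1) * (2 * ((4 * D) powr (2 * \<beta>) / (2 * \<beta>))) = c * 4 powr (2 * \<beta>) / \<beta> * (1 / D)"
      by (simp only:)
    moreover have "c * (2 * (2 / (4 * D))) = c * (1 / D)" by simp
    ultimately show ?thesis by (simp only: distrib_right)
  qed
  also have "ennreal ((c * 4 powr (2 * \<beta>) / \<beta> + c) * (1 / D)) = ennreal (c * 4 powr (2 * \<beta>) / \<beta> + c) * ennreal (1 / D)"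
    using c \<beta> D by (intro ennreal_mult) auto
  finally show "(\<Sum>\<^sub>\<int>n. ennreal (1 / wt n) * ennreal (near n m))
     \<le> ennreal (2 powr (2 * \<beta> + 1) * 4 powr (2 * \<beta>) / \<beta> + 2 powr (2 * \<beta> + 1)) * ennreal (1 / wt m)"
    unfolding c_def D_def .
qed

text \<open>
  For \<open>wt m > 2 wt n\<close> the distance of \<open>n\<close> and \<open>m\<close> is comparable to \<open>\<bar>m\<bar>\<close>, and the sum over such \<open>m\<close> is at
  most twice the finite quantity \<open>ell_minus_norm\<close> of \<open>f\<close>. For the other \<open>m\<close> the factor \<open>1 + \<bar>m\<bar>\<^sup>\<alpha>\<close> lost in
  passing from \<open>f\<close> to the normalised sequence is of order \<open>wt n\<close> to the power \<open>\<alpha>\<close>.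
\<close>

lemma pot_growth_bound:
  assumes \<alpha>: "0 < \<alpha>" and f: "f \<in> ell_minus \<beta>"
  obtains c where "0 < c"
    "\<And>n. ennreal \<bar>potential \<beta> f n / (1 + \<bar>real_of_int n\<bar> powr (\<alpha> + 2 * \<beta>))\<bar>
       \<le> ennreal c * (ennreal (wt n powr (- (\<alpha> + 2 * \<beta>)))
          + (\<Sum>\<^sub>\<int>m. ennreal (near n m) * ennreal \<bar>f m / (1 + \<bar>real_of_int m\<bar> powr \<alpha>)\<bar>))"
proof -
  define a where "a = \<alpha> + 2 * \<beta>"
  have a: "0 < a" using \<alpha> \<beta> by (simp add: a_def)
  have q: "quad f" by (rule quad_ell_minus[OF f \<beta>])
  obtain C where C: "0 < C"
    "\<And>n. abs_potential \<beta> f n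
        \<le> ennreal C * wt_conv \<beta> f n"
    by (rule pot_abs_bound[OF \<beta>]) (rule that, assumption, use q in blast)
  obtain S where S: "0 \<le> S" "ell_minus_norm \<beta> f = ennreal S"
    using ell_minus_obtain[OF f] by blast
  define h where "h m = \<bar>f m / (1 + \<bar>real_of_int m\<bar> powr \<alpha>)\<bar>" for m
  have den: "0 < 1 + \<bar>real_of_int m\<bar> powr x" for m x by (smt (verit) powr_ge_zero)
  have fh: "\<bar>f m\<bar> = (1 + \<bar>real_of_int m\<bar> powr \<alpha>) * h m" for m
    using den[of m \<alpha>] by (simp add: h_def abs_mult)
  define k where "k = 2 * 2 powr \<alpha>"
  have k: "0 < k" by (simp add: k_def)
  have pt: "ennreal (wt (n - m) powr (2 * \<beta> - 1) * \<bar>f m\<bar>)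
     \<le> ennreal 2 * ennreal (wt m powr (2 * \<beta> - 1) * \<bar>f m\<bar>) + ennreal (k * wt n powr a) * (ennreal (near n m) * ennreal (h m))" for n m
  proof (cases "wt m \<le> 2 * wt n")
    case False
    have "wt m \<le> wt n + wt (n - m) - 1" using wt_add_le[of n "- (n - m)"] unfolding wt_minus by simp
    then have "wt m / 2 \<le> wt (n - m)" using False by linarith
    then have "wt (n - m) powr (2 * \<beta> - 1) \<le> (wt m / 2) powr (2 * \<beta> - 1)"
      using \<beta> by (intro powr_mono2') auto
    also have "\<dots> = wt m powr (2 * \<beta> - 1) * 2 powr (1 - 2 * \<beta>)"
      using powr_minus_divide[of 2 "1 - 2 * \<beta>"] by (simp add: powr_divide)
    also have "\<dots> \<le> wt m powr (2 * \<beta> - 1) * 2 powr 1"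
      using \<beta> by (intro mult_left_mono powr_mono) auto
    finally have "wt (n - m) powr (2 * \<beta> - 1) * \<bar>f m\<bar> \<le> (wt m powr (2 * \<beta> - 1) * 2) * \<bar>f m\<bar>"
      by (intro mult_right_mono) auto
    then have "ennreal (wt (n - m) powr (2 * \<beta> - 1) * \<bar>f m\<bar>) \<le> ennreal 2 * ennreal (wt m powr (2 * \<beta> - 1) * \<bar>f m\<bar>)"
      by (simp only: mult_ac flip: ennreal_mult' ennreal_mult'') (simp add: ennreal_leI mult_ac flip: ennreal_mult)
    then show ?thesis by (rule order_trans) simp
  next
    case True
    have "1 + \<bar>real_of_int m\<bar> powr \<alpha> \<le> 1 powr \<alpha> + wt m powr \<alpha>"
      using \<alpha> by (auto simp: wt_def intro!: powr_mono2)
    also have "\<dots> \<le> 2 * wt m powr \<alpha>" using \<alpha> powr_mono2[of \<alpha> 1 "wt m"] by simp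
    also have "\<dots> \<le> 2 * (2 * wt n) powr \<alpha>" using \<alpha> True by (intro mult_left_mono powr_mono2) auto
    also have "\<dots> = k * wt n powr \<alpha>" by (simp add: k_def powr_mult)
    finally have "\<bar>f m\<bar> \<le> k * wt n powr \<alpha> * h m" unfolding fh by (rule mult_right_mono) (simp add: h_def)
    then have "wt (n - m) powr (2 * \<beta> - 1) * \<bar>f m\<bar> \<le> wt (n - m) powr (2 * \<beta> - 1) * (k * wt n powr \<alpha> * h m)"
      by (rule mult_left_mono) simp
    also have "\<dots> = k * wt n powr a * (near n m * h m)"
    proof -
      have "wt n powr \<alpha> = wt n powr a * wt n powr (- 2 * \<beta>)" by (simp add: a_def flip: powr_add)
      then show ?thesis using True by (simp add: near_def mult_ac)
    qed
    finally have "ennreal (wt (n - m) powr (2 * \<beta> - 1) * \<bar>f m\<bar>) \<le> ennreal (k * wt n powr a) * (ennreal (near n m) * ennreal (h m))"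
      using k near_nonneg[of n m] by (simp add: h_def ennreal_leI flip: ennreal_mult)
    then show ?thesis by (rule order_trans) simp
  qed
  define c where "c = C * 2 powr a * (2 * S + k)"
  have c: "0 < c" using C S k by (simp add: c_def add_nonneg_pos)
  have "ennreal \<bar>potential \<beta> f n / (1 + \<bar>real_of_int n\<bar> powr a)\<bar>
       \<le> ennreal c * (ennreal (wt n powr (- a)) + (\<Sum>\<^sub>\<int>m. ennreal (near n m) * ennreal (h m)))" for n
  proof -
    let ?J = "\<Sum>\<^sub>\<int>m. ennreal (near n m) * ennreal (h m)"
    have "ennreal \<bar>potential \<beta> f n\<bar> \<le> ennreal (\<integral>\<tau>. \<bar>heat \<tau> f n\<bar> \<partial>riesz \<beta>)"
      by (rule ennreal_leI[OF pot_abs_le[OF \<beta>]])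
    also have "\<dots> = (\<integral>\<^sup>+\<tau>. ennreal (norm (heat \<tau> f n)) \<partial>riesz \<beta>)"
      using pot_integrable[OF \<beta> f, of n] by (subst nn_integral_eq_integral) auto
    also have "\<dots> \<le> ennreal C * wt_conv \<beta> f n"
      using pot_le_abs[OF \<beta> q] C(2) by (rule order_trans)
    also have "wt_conv \<beta> f n
       \<le> (\<Sum>\<^sub>\<int>m. ennreal 2 * ennreal (wt m powr (2 * \<beta> - 1) * \<bar>f m\<bar>) + ennreal (k * wt n powr a) * (ennreal (near n m) * ennreal (h m)))"
      by (rule nn_integral_mono) (rule pt)
    also have "\<dots> = ennreal 2 * ennreal S + ennreal (k * wt n powr a) * ?J"
      by (subst nn_integral_add) (auto simp: nn_integral_cmult S)
    finally have 1: "ennreal \<bar>potential \<beta> f n\<bar> \<le> ennreal C * (ennreal 2 * ennreal S + ennreal (k * wt n powr a) * ?J)"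
      by (simp add: mult_left_mono)
    have "wt n powr a \<le> 2 powr a * (1 + \<bar>real_of_int n\<bar> powr a)"
    proof -
      have "wt n powr a \<le> (2 * max 1 \<bar>real_of_int n\<bar>) powr a"
        using a by (intro powr_mono2) (auto simp: wt_def)
      also have "\<dots> = 2 powr a * (max 1 \<bar>real_of_int n\<bar>) powr a" by (simp add: powr_mult)
      also have "\<dots> \<le> 2 powr a * (1 + \<bar>real_of_int n\<bar> powr a)"
        by (intro mult_left_mono) (auto simp: max_def)
      finally show ?thesis .
    qed
    then have 2: "1 / (1 + \<bar>real_of_int n\<bar> powr a) \<le> 2 powr a * wt n powr (- a)"
      using den[of n a] by (simp add: powr_minus_divide divide_simps)
    have "ennreal \<bar>potential \<beta> f n / (1 + \<bar>real_of_int n\<bar> powr a)\<bar> = ennreal (1 / (1 + \<bar>real_of_int n\<bar> powr a)) * ennreal \<bar>potential \<beta> f n\<bar>"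
      using den[of n a] by (simp flip: ennreal_mult)
    also have "\<dots> \<le> ennreal (2 powr a * wt n powr (- a)) * (ennreal C * (ennreal 2 * ennreal S + ennreal (k * wt n powr a) * ?J))"
      by (intro mult_mono 1 ennreal_leI 2) auto
    also have "\<dots> = ennreal (C * 2 powr a) * (ennreal (2 * S) * ennreal (wt n powr (- a)) + ennreal (wt n powr (- a)) * ennreal (k * wt n powr a) * ?J)"
      using C S by (simp add: ennreal_mult distrib_left mult_ac)
    also have "ennreal (wt n powr (- a)) * ennreal (k * wt n powr a) = ennreal k"
    proof -
      have "wt n powr (- a) * wt n powr a = 1" by (simp flip: powr_add)
      then have "wt n powr (- a) * (k * wt n powr a) = k" by (metis mult.left_commute mult.right_neutral)
      then show ?thesis using k by (simp flip: ennreal_mult)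
    qed
    also have "ennreal (C * 2 powr a) * (ennreal (2 * S) * ennreal (wt n powr (- a)) + ennreal k * ?J)
       \<le> ennreal (C * 2 powr a) * (ennreal (2 * S + k) * ennreal (wt n powr (- a)) + ennreal (2 * S + k) * ?J)"
      using k S by (intro mult_left_mono add_mono mult_right_mono ennreal_leI) auto
    also have "\<dots> = ennreal c * (ennreal (wt n powr (- a)) + ?J)"
    proof -
      have "ennreal c = ennreal (C * 2 powr a) * ennreal (2 * S + k)"
        using C S k unfolding c_def by (intro ennreal_mult) auto
      then show ?thesis by (simp only: distrib_left mult.assoc)
    qed
    finally show ?thesis .
  qed
  then show ?thesis using that[OF c] by (simp only: a_def h_def)
qed

text \<open>
  Both terms of \<open>pot_growth_bound\<close> belong to \<open>\<ell>\<^sup>q(\<mu>)\<close>: the first because \<open>\<alpha> + 2\<beta> > 0\<close>, the second by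
  Schur's test.
\<close>

lemma pot_in_lq_mu:
  assumes \<alpha>: "0 < \<alpha>" and f: "f \<in> ell_minus \<beta>" and q: "1 \<le> q"
    and fq: "in_lq_mu q (\<lambda>n. f n / (1 + \<bar>real_of_int n\<bar> powr \<alpha>))"
  shows "in_lq_mu q (\<lambda>n. potential \<beta> f n / (1 + \<bar>real_of_int n\<bar> powr (\<alpha> + 2 * \<beta>)))"
proof -
  define a where "a = \<alpha> + 2 * \<beta>"
  have a: "0 < a" using \<alpha> \<beta> by (simp add: a_def)
  define h where "h m = ennreal \<bar>f m / (1 + \<bar>real_of_int m\<bar> powr \<alpha>)\<bar>" for m
  define J where "J n = (\<Sum>\<^sub>\<int>m. ennreal (near n m) * h m)" for n
  obtain c where c: "0 < c"
    "\<And>n. ennreal \<bar>potential \<beta> f n / (1 + \<bar>real_of_int n\<bar> powr a)\<bar> \<le> ennreal c * (ennreal (wt n powr (- a)) + J n)"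
    using pot_growth_bound[OF \<alpha> f] unfolding a_def J_def h_def by blast
  show ?thesis
  proof (cases "q = top")
    case True
    obtain H where H: "\<And>n. \<bar>f n / (1 + \<bar>real_of_int n\<bar> powr \<alpha>)\<bar> \<le> H"
      using fq unfolding True in_lq_mu_top by blast
    have H0: "0 \<le> H" using H[of 0] by linarith
    have "\<bar>potential \<beta> f n / (1 + \<bar>real_of_int n\<bar> powr a)\<bar> \<le> c * (1 + 3 powr (2 * \<beta>) / \<beta> * H)" for n
    proof -
      have "J n \<le> (\<Sum>\<^sub>\<int>m. ennreal (near n m) * ennreal H)"
        unfolding J_def h_def by (intro nn_integral_mono mult_left_mono ennreal_leI H) auto
      also have "\<dots> = (\<Sum>\<^sub>\<int>m. ennreal (near n m)) * ennreal H"
        by (rule nn_integral_multc) simp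
      also have "\<dots> \<le> ennreal (3 powr (2 * \<beta>) / \<beta>) * ennreal H" by (intro mult_right_mono near_rows) simp
      finally have J: "J n \<le> ennreal (3 powr (2 * \<beta>) / \<beta> * H)" using \<beta> H0 by (simp flip: ennreal_mult)
      have "wt n powr (- a) \<le> 1" using a powr_mono[of "- a" 0 "wt n"] by simp
      then have "ennreal (wt n powr (- a)) \<le> ennreal 1" by (rule ennreal_leI)
      then have "ennreal \<bar>potential \<beta> f n / (1 + \<bar>real_of_int n\<bar> powr a)\<bar> \<le> ennreal c * (ennreal 1 + ennreal (3 powr (2 * \<beta>) / \<beta> * H))"
        using c(2)[of n] J by (meson add_mono mult_left_mono order_trans zero_le)
      also have "\<dots> = ennreal (c * (1 + 3 powr (2 * \<beta>) / \<beta> * H))"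
        using c(1) \<beta> H0 by (simp add: ennreal_mult ennreal_plus)
      finally show ?thesis
        using c(1) \<beta> H0 by (subst (asm) ennreal_le_iff) auto
    qed
    then show ?thesis unfolding True in_lq_mu_top a_def by blast
  next
    case False
    define r where "r = enn2real q"
    have r: "1 \<le> r" unfolding r_def by (rule enn2real_ge_1[OF q False])
    obtain R' where R': "\<And>m. (\<Sum>\<^sub>\<int>n. ennreal (1 / wt n) * ennreal (near n m)) \<le> ennreal R' * ennreal (1 / wt m)"
      using near_cols by blast
    have fin: "(\<Sum>\<^sub>\<int>n. ennreal (1 / wt n) * ennpowr (J n) r) < top"
      unfolding J_def
    proof (rule schur_finite[OF r _ near_rows R'])
      show "0 < 3 powr (2 * \<beta>) / \<beta>" using \<beta> by simp
      show "(\<Sum>\<^sub>\<int>m. ennreal (1 / wt m) * ennpowr (h m) r) < top"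
        using fq unfolding in_lq_mu_iff[OF q False] h_def r_def .
    qed
    define c' where "c' = ennpowr (ennreal (2 * c)) r"
    have c': "c' < top" by (simp add: c'_def)
    have "(\<Sum>\<^sub>\<int>n. ennreal (1 / wt n) * ennpowr (ennreal \<bar>potential \<beta> f n / (1 + \<bar>real_of_int n\<bar> powr a)\<bar>) r)
      \<le> (\<Sum>\<^sub>\<int>n. c' * (ennreal (wt n powr (- 1 - a * r)) + ennreal (1 / wt n) * ennpowr (J n) r))"
    proof (rule nn_integral_mono)
      fix n
      let ?x = "ennreal (wt n powr (- a))" and ?y = "J n"
      have "ennpowr (ennreal \<bar>potential \<beta> f n / (1 + \<bar>real_of_int n\<bar> powr a)\<bar>) r \<le> ennpowr (ennreal (2 * c) * max ?x ?y) r"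
      proof (rule ennpowr_mono)
        have "ennreal c * (?x + ?y) \<le> ennreal c * (max ?x ?y + max ?x ?y)"
          by (intro mult_left_mono add_mono) auto
        also have "\<dots> = ennreal (2 * c) * max ?x ?y"
          using c(1) by (simp add: mult_2[symmetric] ennreal_mult mult_ac)
        finally show "ennreal \<bar>potential \<beta> f n / (1 + \<bar>real_of_int n\<bar> powr a)\<bar> \<le> ennreal (2 * c) * max ?x ?y"
          using c(2)[of n] by (rule order_trans[rotated])
      qed (use r in simp)
      also have "\<dots> = c' * ennpowr (max ?x ?y) r" using r by (simp add: ennpowr_mult c'_def)
      also have "ennpowr (max ?x ?y) r \<le> ennpowr ?x r + ennpowr ?y r"
        by (simp add: max_def)
      finally have "ennreal (1 / wt n) * ennpowr (ennreal \<bar>potential \<beta> f n / (1 + \<bar>real_of_int n\<bar> powr a)\<bar>) r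
         \<le> ennreal (1 / wt n) * (c' * (ennpowr ?x r + ennpowr ?y r))"
        by (simp add: mult_left_mono)
      also have "\<dots> = c' * (ennreal (1 / wt n) * ennpowr ?x r + ennreal (1 / wt n) * ennpowr ?y r)"
        by (simp add: distrib_left mult_ac)
      also have "ennreal (1 / wt n) * ennpowr ?x r = ennreal (wt n powr (- 1 - a * r))"
      proof -
        have "1 / wt n * wt n powr (- a * r) = wt n powr (- 1 - a * r)"
          by (simp add: powr_diff powr_minus_divide)
        then show ?thesis by (simp add: ennpowr_ennreal powr_powr flip: ennreal_mult)
      qed
      finally show "ennreal (1 / wt n) * ennpowr (ennreal \<bar>potential \<beta> f n / (1 + \<bar>real_of_int n\<bar> powr a)\<bar>) r
         \<le> c' * (ennreal (wt n powr (- 1 - a * r)) + ennreal (1 / wt n) * ennpowr (J n) r)" .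
    qed
    also have "\<dots> = c' * ((\<Sum>\<^sub>\<int>n. ennreal (wt n powr (- 1 - a * r)))
        + (\<Sum>\<^sub>\<int>n. ennreal (1 / wt n) * ennpowr (J n) r))"
      by (simp add: nn_integral_cmult nn_integral_add)
    also have "\<dots> < top" using c' fin wt_summable[of "a * r"] a r by (simp add: ennreal_mult_less_top)
    finally show ?thesis unfolding in_lq_mu_iff[OF q False] a_def r_def .
  qed
qed

end

section \<open>Norms over the half line with measure dt/t\<close>

lemma Lnorm_cong:
  assumes "\<And>x. x \<in> space M \<Longrightarrow> f x = g x" shows "Lnorm q M f = Lnorm q M g"
proof (cases "q = top")
  case True
  have "f \<in> borel_measurable M \<longleftrightarrow> g \<in> borel_measurable M" by (rule measurable_cong) (rule assms)
  moreover have "Limsup (ae_filter M) f = Limsup (ae_filter M) g"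
    by (rule Limsup_eq) (use assms in auto)
  ultimately show ?thesis by (simp add: True Lnorm_def esssup_def)
next
  case False
  have "(\<integral>\<^sup>+x. ennpowr (f x) (enn2real q) \<partial>M) = (\<integral>\<^sup>+x. ennpowr (g x) (enn2real q) \<partial>M)"
    by (rule nn_integral_cong) (simp add: assms)
  then show ?thesis using False by (simp add: Lnorm_def)
qed

lemma Lnorm_finite_iff:
  "q \<noteq> top \<Longrightarrow> Lnorm q M f < top \<longleftrightarrow> (\<integral>\<^sup>+x. ennpowr (f x) (enn2real q) \<partial>M) < top"
  by (simp add: Lnorm_def)

lemma Lnorm_top_finite_iff:
  assumes "f \<in> borel_measurable M"
  shows "Lnorm top M f < top \<longleftrightarrow> (\<exists>A. AE x in M. f x \<le> ennreal A)"
proof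
  assume "Lnorm top M f < top"
  then obtain A where A: "esssup M f = ennreal A" by (cases "esssup M f") (auto simp: Lnorm_def)
  have "AE x in M. f x \<le> ennreal A" using esssup_AE[of f M] unfolding A .
  then show "\<exists>A. AE x in M. f x \<le> ennreal A" by blast
next
  assume "\<exists>A. AE x in M. f x \<le> ennreal A"
  then obtain A where "AE x in M. f x \<le> ennreal A" by blast
  then have "esssup M f \<le> ennreal A" by (rule esssup_I[OF assms])
  then show "Lnorm top M f < top" using ennreal_less_top[of A] by (simp add: Lnorm_def le_less_trans)
qed

lemma Lnorm_finite_le:
  assumes q: "1 \<le> q" and [measurable]: "f \<in> borel_measurable M" "g \<in> borel_measurable M"
    and le: "\<And>x. x \<in> space M \<Longrightarrow> f x \<le> ennreal c * g x" and g: "Lnorm q M g < top"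
  shows "Lnorm q M f < top"
proof (cases "q = top")
  case True
  obtain A where A: "AE x in M. g x \<le> ennreal A"
    using g unfolding True by (subst (asm) Lnorm_top_finite_iff) auto
  have "AE x in M. f x \<le> ennreal (max 0 c * max 0 A)"
    using A AE_space
  proof eventually_elim
    case (elim x)
    have "f x \<le> ennreal c * g x" by (rule le[OF elim(2)])
    also have "\<dots> \<le> ennreal (max 0 c) * ennreal (max 0 A)"
      using elim(1) by (intro mult_mono) (auto simp: ennreal_max_0)
    finally show ?case by (simp add: ennreal_mult)
  qed
  then show ?thesis unfolding True by (subst Lnorm_top_finite_iff) auto
next
  case False
  define r where "r = enn2real q"
  have r: "1 \<le> r" unfolding r_def by (rule enn2real_ge_1[OF q False])
  have "(\<integral>\<^sup>+x. ennpowr (f x) r \<partial>M) \<le> (\<integral>\<^sup>+x. ennpowr (ennreal c) r * ennpowr (g x) r \<partial>M)"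
  proof (rule nn_integral_mono)
    fix x assume "x \<in> space M"
    then have "ennpowr (f x) r \<le> ennpowr (ennreal c * g x) r" using r by (intro ennpowr_mono le) auto
    then show "ennpowr (f x) r \<le> ennpowr (ennreal c) r * ennpowr (g x) r" using r by (simp add: ennpowr_mult)
  qed
  also have "\<dots> = ennpowr (ennreal c) r * (\<integral>\<^sup>+x. ennpowr (g x) r \<partial>M)" by (rule nn_integral_cmult) measurable
  also have "\<dots> < top" using g False by (simp add: Lnorm_finite_iff r_def ennreal_mult_less_top)
  finally show ?thesis using False by (simp add: Lnorm_finite_iff r_def)
qed

lemma space_dt [simp]: "space dt_over_t = {0<..}"
  by (simp add: dt_over_t_def space_restrict_space)

lemma measurable_dt: "w \<in> borel_measurable borel \<Longrightarrow> w \<in> borel_measurable dt_over_t"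
  by (simp add: dt_over_t_def measurable_restrict_space1)

lemma nn_integral_dt:
  assumes [measurable]: "w \<in> borel_measurable borel"
  shows "(\<integral>\<^sup>+t. w t \<partial>dt_over_t) = (\<integral>\<^sup>+t. ennreal (if 0 < t then 1 / t else 0) * w t \<partial>lborel)"
proof -
  have "(\<integral>\<^sup>+t. w t \<partial>dt_over_t) = (\<integral>\<^sup>+t. ennreal (1 / t) * w t \<partial>restrict_space lborel {0<..})"
    unfolding dt_over_t_def by (rule nn_integral_density) (auto intro!: measurable_restrict_space1)
  also have "\<dots> = (\<integral>\<^sup>+t. ennreal (1 / t) * w t * indicator {0<..} t \<partial>lborel)"
    by (rule nn_integral_restrict_space) simp
  also have "\<dots> = (\<integral>\<^sup>+t. ennreal (if 0 < t then 1 / t else 0) * w t \<partial>lborel)"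
    by (rule nn_integral_cong) (auto split: split_indicator)
  finally show ?thesis .
qed

lemma AE_dt: "(AE t in dt_over_t. P t) \<longleftrightarrow> (AE t in lborel. 0 < t \<longrightarrow> P t)"
proof -
  have "(AE t in dt_over_t. P t) \<longleftrightarrow> (AE t in restrict_space lborel {0<..}. 0 < ennreal (1 / t) \<longrightarrow> P t)"
    unfolding dt_over_t_def by (rule AE_density) (auto intro!: measurable_restrict_space1)
  also have "\<dots> \<longleftrightarrow> (AE t in lborel. t \<in> {0<..} \<longrightarrow> 0 < ennreal (1 / t) \<longrightarrow> P t)"
    by (rule AE_restrict_space_iff) simp
  also have "\<dots> \<longleftrightarrow> (AE t in lborel. 0 < t \<longrightarrow> P t)"
    by (rule AE_cong) auto
  finally show ?thesis .
qed

text \<open>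
  The measure \<open>dt/t\<close> is the Haar measure of the multiplicative group \<open>(0,\<infinity>)\<close>.
\<close>

lemma nn_integral_dt_scale:
  assumes [measurable]: "w \<in> borel_measurable borel" and c: "0 < c"
  shows "(\<integral>\<^sup>+t. w (t * c) \<partial>dt_over_t) = (\<integral>\<^sup>+t. w t \<partial>dt_over_t)"
proof -
  have "(\<integral>\<^sup>+t. w t \<partial>dt_over_t) = (\<integral>\<^sup>+t. ennreal (if 0 < t then 1 / t else 0) * w t \<partial>lborel)"
    by (rule nn_integral_dt) simp
  also have "\<dots> = ennreal \<bar>c\<bar> * (\<integral>\<^sup>+t. ennreal (if 0 < 0 + c * t then 1 / (0 + c * t) else 0) * w (0 + c * t) \<partial>lborel)"
    by (rule nn_integral_real_affine) (use c in auto)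
  also have "\<dots> = (\<integral>\<^sup>+t. ennreal \<bar>c\<bar> * (ennreal (if 0 < 0 + c * t then 1 / (0 + c * t) else 0) * w (0 + c * t)) \<partial>lborel)"
    by (rule nn_integral_cmult[symmetric]) measurable
  also have "\<dots> = (\<integral>\<^sup>+t. ennreal (if 0 < t then 1 / t else 0) * w (t * c) \<partial>lborel)"
  proof (rule nn_integral_cong)
    fix t :: real
    have "ennreal \<bar>c\<bar> * ennreal (if 0 < c * t then 1 / (c * t) else 0) = ennreal (if 0 < t then 1 / t else 0)"
      using c by (auto simp: zero_less_mult_iff simp flip: ennreal_mult)
    then show "ennreal \<bar>c\<bar> * (ennreal (if 0 < 0 + c * t then 1 / (0 + c * t) else 0) * w (0 + c * t))
       = ennreal (if 0 < t then 1 / t else 0) * w (t * c)"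
      unfolding add_0 mult.assoc[symmetric] by (simp only: mult.commute[of t c])
  qed
  also have "\<dots> = (\<integral>\<^sup>+t. w (t * c) \<partial>dt_over_t)"
    by (rule nn_integral_dt[symmetric]) measurable
  finally show ?thesis by simp
qed

lemma Lnorm_dt_scale:
  assumes w[measurable]: "w \<in> borel_measurable borel" and c: "0 < c" and fin: "Lnorm q dt_over_t w < top"
  shows "Lnorm q dt_over_t (\<lambda>t. w (t * c)) < top"
proof (cases "q = top")
  case True
  have m: "(\<lambda>t. w (t * c)) \<in> borel_measurable borel" by measurable
  obtain A where "AE t in lborel. 0 < t \<longrightarrow> w t \<le> ennreal A"
    using fin measurable_dt[OF w] unfolding True by (auto simp: Lnorm_top_finite_iff AE_dt)
  then have "AE t in lborel. 0 < 0 + c * t \<longrightarrow> w (0 + c * t) \<le> ennreal A"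
    by (rule AE_borel_affine[rotated 2]) (use c in auto)
  then have "AE t in lborel. 0 < t \<longrightarrow> w (t * c) \<le> ennreal A"
    using c by (auto simp: zero_less_mult_iff mult.commute elim!: eventually_mono)
  then show ?thesis using measurable_dt[OF m] unfolding True by (auto simp: Lnorm_top_finite_iff AE_dt)
next
  case False
  then show ?thesis using fin nn_integral_dt_scale[of "\<lambda>t. ennpowr (w t) (enn2real q)" c] c
    by (simp add: Lnorm_finite_iff)
qed

text \<open>
  An average of dilates with respect to a finite measure. All dilates of \<open>w\<close> have the same norm, so for
  finite \<open>q\<close> the claim follows from Jensen's inequality and the dilation invariance of \<open>dt/t\<close>. For infinite
  \<open>q\<close> the bound for \<open>w\<close> holds at almost every \<open>\<rho>\<close> for each fixed \<open>t\<close>, because \<open>\<rho> \<mapsto> t (1 + \<rho>)\<close> is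
  affine.
\<close>

lemma Lnorm_dt_average:
  assumes q: "1 \<le> q" and w[measurable]: "w \<in> borel_measurable borel" and \<kappa>[measurable]: "\<kappa> \<in> borel_measurable borel"
    and supp: "\<And>\<rho>. \<rho> \<le> 0 \<Longrightarrow> \<kappa> \<rho> = 0" and mass: "(\<integral>\<^sup>+\<rho>. \<kappa> \<rho> \<partial>lborel) < top"
    and fin: "Lnorm q dt_over_t w < top"
  shows "Lnorm q dt_over_t (\<lambda>t. \<integral>\<^sup>+\<rho>. \<kappa> \<rho> * w (t * (1 + \<rho>)) \<partial>lborel) < top"
proof -
  let ?U = "\<lambda>t. \<integral>\<^sup>+\<rho>. \<kappa> \<rho> * w (t * (1 + \<rho>)) \<partial>lborel"
  have U: "?U \<in> borel_measurable borel" by measurable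
  obtain R where R: "0 < R" "(\<integral>\<^sup>+\<rho>. \<kappa> \<rho> \<partial>lborel) \<le> ennreal R"
  proof -
    obtain R0 where "0 \<le> R0" "(\<integral>\<^sup>+\<rho>. \<kappa> \<rho> \<partial>lborel) = ennreal R0"
      using mass by (cases "\<integral>\<^sup>+\<rho>. \<kappa> \<rho> \<partial>lborel") auto
    then show ?thesis by (intro that[of "R0 + 1"]) (auto intro: ennreal_leI)
  qed
  show ?thesis
  proof (cases "q = top")
    case True
    obtain A where A: "AE t in lborel. 0 < t \<longrightarrow> w t \<le> ennreal A"
      using fin measurable_dt[OF w] unfolding True by (auto simp: Lnorm_top_finite_iff AE_dt)
    have "?U t \<le> ennreal (R * max 0 A)" if t: "0 < t" for t
    proof -
      have "AE \<rho> in lborel. 0 < t + t * \<rho> \<longrightarrow> w (t + t * \<rho>) \<le> ennreal A"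
        by (rule AE_borel_affine[rotated 2, OF A]) (use t in auto)
      then have "?U t \<le> (\<integral>\<^sup>+\<rho>. \<kappa> \<rho> * ennreal (max 0 A) \<partial>lborel)"
      proof (intro nn_integral_mono_AE, elim eventually_mono)
        fix \<rho> assume *: "0 < t + t * \<rho> \<longrightarrow> w (t + t * \<rho>) \<le> ennreal A"
        show "\<kappa> \<rho> * w (t * (1 + \<rho>)) \<le> \<kappa> \<rho> * ennreal (max 0 A)"
        proof (cases "0 < \<rho>")
          case True
          then have "w (t * (1 + \<rho>)) \<le> ennreal A" using * t by (simp add: distrib_left add_pos_pos)
          then show ?thesis by (intro mult_left_mono) (auto simp: ennreal_max_0)
        qed (simp add: supp)
      qed
      also have "\<dots> = (\<integral>\<^sup>+\<rho>. \<kappa> \<rho> \<partial>lborel) * ennreal (max 0 A)" by (rule nn_integral_multc) measurable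
      also have "\<dots> \<le> ennreal R * ennreal (max 0 A)" by (intro mult_right_mono R) auto
      finally show ?thesis using R(1) by (simp add: ennreal_mult)
    qed
    then show ?thesis using measurable_dt[OF U] unfolding True by (auto simp: Lnorm_top_finite_iff AE_dt)
  next
    case False
    define r where "r = enn2real q"
    have r: "1 \<le> r" unfolding r_def by (rule enn2real_ge_1[OF q False])
    define c where "c = ennpowr (ennreal R) r * ennreal (1 / R)"
    have c: "c < top" using R by (simp add: c_def ennreal_mult_less_top)
    have "(\<integral>\<^sup>+t. ennpowr (?U t) r \<partial>dt_over_t)
       \<le> (\<integral>\<^sup>+t. c * (\<integral>\<^sup>+\<rho>. \<kappa> \<rho> * ennpowr (w (t * (1 + \<rho>))) r \<partial>lborel) \<partial>dt_over_t)"
      unfolding c_def by (intro nn_integral_mono ennpowr_nn_integral_mass_le r R) auto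
    also have "\<dots> = c * (\<integral>\<^sup>+t. (\<integral>\<^sup>+\<rho>. \<kappa> \<rho> * ennpowr (w (t * (1 + \<rho>))) r \<partial>lborel) \<partial>dt_over_t)"
      by (rule nn_integral_cmult[OF measurable_dt]) measurable
    also have "(\<integral>\<^sup>+t. (\<integral>\<^sup>+\<rho>. \<kappa> \<rho> * ennpowr (w (t * (1 + \<rho>))) r \<partial>lborel) \<partial>dt_over_t)
      = (\<integral>\<^sup>+t. \<integral>\<^sup>+\<rho>. ennreal (if 0 < t then 1 / t else 0) * (\<kappa> \<rho> * ennpowr (w (t * (1 + \<rho>))) r) \<partial>lborel \<partial>lborel)"
      by (subst nn_integral_dt) (simp_all add: nn_integral_cmult)
    also have "\<dots> = (\<integral>\<^sup>+\<rho>. \<integral>\<^sup>+t. ennreal (if 0 < t then 1 / t else 0) * (\<kappa> \<rho> * ennpowr (w (t * (1 + \<rho>))) r) \<partial>lborel \<partial>lborel)"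
      by (rule lborel_pair.Fubini') measurable
    also have "\<dots> = (\<integral>\<^sup>+\<rho>. \<kappa> \<rho> * (\<integral>\<^sup>+t. ennpowr (w t) r \<partial>dt_over_t) \<partial>lborel)"
    proof (rule nn_integral_cong)
      fix \<rho> :: real
      show "(\<integral>\<^sup>+t. ennreal (if 0 < t then 1 / t else 0) * (\<kappa> \<rho> * ennpowr (w (t * (1 + \<rho>))) r) \<partial>lborel)
        = \<kappa> \<rho> * (\<integral>\<^sup>+t. ennpowr (w t) r \<partial>dt_over_t)"
      proof (cases "0 < \<rho>")
        case True
        have "(\<integral>\<^sup>+t. ennreal (if 0 < t then 1 / t else 0) * (\<kappa> \<rho> * ennpowr (w (t * (1 + \<rho>))) r) \<partial>lborel)
          = (\<integral>\<^sup>+t. \<kappa> \<rho> * (ennreal (if 0 < t then 1 / t else 0) * ennpowr (w (t * (1 + \<rho>))) r) \<partial>lborel)"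
          by (simp only: mult.left_commute)
        also have "\<dots> = \<kappa> \<rho> * (\<integral>\<^sup>+t. ennpowr (w (t * (1 + \<rho>))) r \<partial>dt_over_t)"
          by (subst nn_integral_cmult) (simp_all add: nn_integral_dt)
        finally show ?thesis using True by (subst (asm) nn_integral_dt_scale[where w = "\<lambda>t. ennpowr (w t) r"]) auto
      qed (simp add: supp)
    qed
    also have "\<dots> = (\<integral>\<^sup>+\<rho>. \<kappa> \<rho> \<partial>lborel) * (\<integral>\<^sup>+t. ennpowr (w t) r \<partial>dt_over_t)"
      by (rule nn_integral_multc) measurable
    also have "c * \<dots> < top"
      using c mass fin False by (auto simp: Lnorm_finite_iff r_def ennreal_mult_less_top intro: le_less_trans)
    finally show ?thesis using False by (simp add: Lnorm_finite_iff r_def)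
  qed
qed

abbreviation hardy_kernel :: "real \<Rightarrow> real \<Rightarrow> real \<Rightarrow> real" where
  "hardy_kernel \<beta> a \<rho> \<equiv> (if 0 < \<rho> then \<rho> powr (\<beta> - 1) * (1 + \<rho>) powr (- a) else 0)"

text \<open>
  A Beta integral: convergence at \<open>0\<close> is due to \<open>\<beta> > 0\<close>, convergence at infinity to \<open>\<beta> < a\<close>.
\<close>

lemma hardy_kernel_finite:
  assumes "0 < \<beta>" "\<beta> < a"
  shows "(\<integral>\<^sup>+\<rho>. ennreal (hardy_kernel \<beta> a \<rho>) \<partial>lborel) < top"
proof -
  have f: "((\<lambda>\<rho>. \<rho> powr (\<beta> - 1)) has_integral (1 powr (\<beta> - 1 + 1) / (\<beta> - 1 + 1))) {0..1}"
    using assms by (intro has_integral_powr_from_0) auto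
  have g: "((\<lambda>\<rho>. \<rho> powr (\<beta> - 1 - a)) has_integral - (1 powr (\<beta> - 1 - a + 1)) / (\<beta> - 1 - a + 1)) {1..}"
    using assms by (intro has_integral_powr_to_inf) auto
  have "(\<integral>\<^sup>+\<rho>. ennreal (hardy_kernel \<beta> a \<rho>) \<partial>lborel)
     \<le> (\<integral>\<^sup>+\<rho>. ennreal (\<rho> powr (\<beta> - 1)) * indicator {0..1} \<rho> + ennreal (\<rho> powr (\<beta> - 1 - a)) * indicator {1..} \<rho> \<partial>lborel)"
  proof (rule nn_integral_mono)
    fix \<rho> :: real
    show "ennreal (hardy_kernel \<beta> a \<rho>)
      \<le> ennreal (\<rho> powr (\<beta> - 1)) * indicator {0..1} \<rho> + ennreal (\<rho> powr (\<beta> - 1 - a)) * indicator {1..} \<rho>"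
    proof (cases "0 < \<rho>")
      case True
      show ?thesis
      proof (cases "\<rho> \<le> 1")
        case le: True
        have "(1 + \<rho>) powr (- a) \<le> 1" using True assms powr_mono[of "- a" 0 "1 + \<rho>"] by simp
        then have "\<rho> powr (\<beta> - 1) * (1 + \<rho>) powr (- a) \<le> \<rho> powr (\<beta> - 1) * 1" by (intro mult_left_mono) auto
        then have "ennreal (\<rho> powr (\<beta> - 1) * (1 + \<rho>) powr (- a)) \<le> ennreal (\<rho> powr (\<beta> - 1))" by (intro ennreal_leI) simp
        then show ?thesis using True le by (simp add: add_increasing2)
      next
        case False
        have "(1 + \<rho>) powr (- a) \<le> \<rho> powr (- a)" using True assms by (intro powr_mono2') auto
        then have "\<rho> powr (\<beta> - 1) * (1 + \<rho>) powr (- a) \<le> \<rho> powr (\<beta> - 1) * \<rho> powr (- a)" by (intro mult_left_mono) auto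
        also have "\<dots> = \<rho> powr (\<beta> - 1 - a)" by (simp flip: powr_add)
        finally have "ennreal (\<rho> powr (\<beta> - 1) * (1 + \<rho>) powr (- a)) \<le> ennreal (\<rho> powr (\<beta> - 1 - a))" by (rule ennreal_leI)
        then show ?thesis using True False by (simp add: add_increasing)
      qed
    qed simp
  qed
  also have "\<dots> = (\<integral>\<^sup>+\<rho>. ennreal (\<rho> powr (\<beta> - 1)) * indicator {0..1} \<rho> \<partial>lborel)
      + (\<integral>\<^sup>+\<rho>. ennreal (\<rho> powr (\<beta> - 1 - a)) * indicator {1..} \<rho> \<partial>lborel)"
    by (rule nn_integral_add) auto
  also have "\<dots> < top"
    by (subst nn_integral_has_integral_lebesgue'[OF _ f], simp) (subst nn_integral_has_integral_lebesgue'[OF _ g], auto)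
  finally show ?thesis .
qed

section \<open>Smoothing by the heat flow\<close>

definition heat_norm :: "ennreal \<Rightarrow> (int \<Rightarrow> real) \<Rightarrow> real \<Rightarrow> ennreal" where
  "heat_norm p h t = ell p (\<lambda>n. ennreal \<bar>heat t h n\<bar>)"

lemma measurable_heat_norm [measurable]: "quad h \<Longrightarrow> heat_norm p h \<in> borel_measurable borel"
  unfolding heat_norm_def[abs_def] using heat_measurable[of h]
  by (intro measurable_ell) measurable

text \<open>
  The difference of an evolution is convolution of the data with the difference of the kernel, whose
  \<open>\<ell>\<^sup>1\<close> norm is known from \<open>heat_delta_variation\<close>.
\<close>

lemma heat_difference_le:
  assumes p: "1 \<le> p" and h: "quad h" and t: "0 < t"
  shows "ell p (\<lambda>n. ennreal \<bar>heat t h (n + 1) - heat t h n\<bar>) \<le> ennreal (2 / sqrt (2 * t)) * ell p (\<lambda>n. ennreal \<bar>h n\<bar>)"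
proof -
  let ?G = "heat t delta"
  have "ell p (\<lambda>n. ennreal \<bar>heat t h (n + 1) - heat t h n\<bar>)
     \<le> ell p (\<lambda>n. \<Sum>\<^sub>\<int>i. ennreal \<bar>?G (i + 1) - ?G i\<bar> * ennreal \<bar>h (n - i)\<bar>)"
  proof (rule ell_mono)
    fix n :: int
    have b: "bij_betw (\<lambda>j. n - j) UNIV UNIV" by (rule bij_betwI[where g = "\<lambda>j. n - j"]) auto
    have "((\<lambda>j. ?G (n + 1 - j) * h j - ?G (n - j) * h j) has_sum (heat t h (n + 1) - heat t h n)) UNIV"
      using has_sum_add[OF heat_has_sum[of t h "n + 1"] has_sum_cmult_right[OF heat_has_sum[of t h n], of "-1"]] t h by simp
    note hs = has_sum_count_space[OF this]
    have "ennreal \<bar>heat t h (n + 1) - heat t h n\<bar> \<le> (\<Sum>\<^sub>\<int>j. ennreal (norm (?G (n + 1 - j) * h j - ?G (n - j) * h j)))"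
      using integral_norm_bound_ennreal[OF hs(1)] unfolding hs(2) by simp
    also have "\<dots> = (\<Sum>\<^sub>\<int>j. ennreal \<bar>?G ((n - j) + 1) - ?G (n - j)\<bar> * ennreal \<bar>h (n - (n - j))\<bar>)"
    proof (rule nn_integral_cong)
      fix j
      have "n + 1 - j = n - j + 1" by simp
      then have "\<bar>?G (n + 1 - j) * h j - ?G (n - j) * h j\<bar> = \<bar>?G (n - j + 1) - ?G (n - j)\<bar> * \<bar>h j\<bar>"
        by (simp only: left_diff_distrib[symmetric] abs_mult)
      then show "ennreal (norm (?G (n + 1 - j) * h j - ?G (n - j) * h j)) = ennreal \<bar>?G ((n - j) + 1) - ?G (n - j)\<bar> * ennreal \<bar>h (n - (n - j))\<bar>"
        by (simp add: ennreal_mult)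
    qed
    also have "\<dots> = (\<Sum>\<^sub>\<int>i. ennreal \<bar>?G (i + 1) - ?G i\<bar> * ennreal \<bar>h (n - i)\<bar>)"
      by (rule nn_integral_bij_count_space[OF b, of "\<lambda>i. ennreal \<bar>?G (i + 1) - ?G i\<bar> * ennreal \<bar>h (n - i)\<bar>"])
    finally show "ennreal \<bar>heat t h (n + 1) - heat t h n\<bar> \<le> (\<Sum>\<^sub>\<int>i. ennreal \<bar>?G (i + 1) - ?G i\<bar> * ennreal \<bar>h (n - i)\<bar>)" .
  qed
  also have "\<dots> \<le> (\<Sum>\<^sub>\<int>i. ennreal \<bar>?G (i + 1) - ?G i\<bar>) * ell p (\<lambda>n. ennreal \<bar>h n\<bar>)"
    by (rule ell_young[OF p])
  also have "\<dots> \<le> ennreal (2 / sqrt (2 * t)) * ell p (\<lambda>n. ennreal \<bar>h n\<bar>)"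
  proof (rule mult_right_mono)
    have "(\<Sum>\<^sub>\<int>i. ennreal \<bar>?G (i + 1) - ?G i\<bar>) \<le> ennreal (2 * ?G 0)"
      using t by (intro heat_delta_variation) simp
    also have "\<dots> \<le> ennreal (2 / sqrt (2 * t))" using heat_delta_0_le[OF t] by (intro ennreal_leI) simp
    finally show "(\<Sum>\<^sub>\<int>i. ennreal \<bar>?G (i + 1) - ?G i\<bar>) \<le> ennreal (2 / sqrt (2 * t))" .
  qed simp
  finally show ?thesis .
qed

text \<open>
  The time \<open>s\<close> is divided into \<open>s/4 + s/4 + s/2\<close>. The Laplacian is, up to a translation, the square of the
  forward difference, and each of the two differences is absorbed by one evolution of length \<open>s/4\<close> at the
  cost of a factor \<open>2 / sqrt (s/2)\<close>.
\<close>

lemma heat_norm_lap_le: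
  assumes p: "1 \<le> p" and h: "quad h" and s: "0 < s"
  shows "heat_norm p (lap h) s \<le> ennreal (8 / s) * heat_norm p h (s / 2)"
proof -
  define x where "x = heat (s / 2) h"
  define y where "y = heat (s / 4) x"
  define D where "D n = y (n + 1) - y n" for n
  have qx: "quad x" unfolding x_def using s by (intro quad_heat h) simp
  have qy: "quad y" unfolding y_def using s by (intro quad_heat qx) simp
  have qD: "quad D" unfolding D_def[abs_def] using quad_add[OF quad_shift[OF qy, of 1] quad_cmult[OF qy, of "-1"]] by simp
  have z: "heat s h n = heat (s / 4) y n" for n
  proof -
    have "heat (s / 4) y n = heat (s / 4 + s / 4) x n"
      unfolding y_def using s by (intro heat_semigroup_law qx) auto
    also have "\<dots> = heat (s / 4 + s / 4 + s / 2) h n"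
      unfolding x_def using s by (intro heat_semigroup_law h) auto
    finally show ?thesis by simp
  qed
  have hD: "heat (s / 4) D n = heat s h (n + 1) - heat s h n" for n
    unfolding D_def[abs_def] z using heat_diff[OF quad_shift[OF qy, of 1] qy, of "s / 4" n] by (simp add: heat_shift)
  have "heat s (lap h) n = heat (s / 4) D (n - 1 + 1) - heat (s / 4) D (n - 1)" for n
    unfolding hD heat_lap[OF h] by (simp add: lap_def)
  then have "heat_norm p (lap h) s = ell p (\<lambda>n. ennreal \<bar>heat (s / 4) D (n - 1 + 1) - heat (s / 4) D (n - 1)\<bar>)"
    by (simp only: heat_norm_def)
  also have "\<dots> = ell p (\<lambda>n. ennreal \<bar>heat (s / 4) D (n + 1) - heat (s / 4) D n\<bar>)"
    by (rule ell_shift[of p "\<lambda>n. ennreal \<bar>heat (s / 4) D (n + 1) - heat (s / 4) D n\<bar>" 1])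
  also have "\<dots> \<le> ennreal (2 / sqrt (2 * (s / 4))) * ell p (\<lambda>n. ennreal \<bar>D n\<bar>)"
    using s by (intro heat_difference_le p qD) simp
  also have "\<dots> \<le> ennreal (2 / sqrt (2 * (s / 4))) * (ennreal (2 / sqrt (2 * (s / 4))) * ell p (\<lambda>n. ennreal \<bar>x n\<bar>))"
    unfolding D_def y_def using s by (intro mult_left_mono heat_difference_le p qx) simp_all
  also have "\<dots> = ennreal (8 / s) * heat_norm p h (s / 2)"
  proof -
    have "2 / sqrt (2 * (s / 4)) * (2 / sqrt (2 * (s / 4))) = 8 / s" using s by simp
    then have "ennreal (2 / sqrt (2 * (s / 4))) * ennreal (2 / sqrt (2 * (s / 4))) = ennreal (8 / s)"
      using s by (simp flip: ennreal_mult)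
    then show ?thesis by (simp only: mult.assoc[symmetric] heat_norm_def x_def)
  qed
  finally show ?thesis .
qed

definition weighted_norm :: "real \<Rightarrow> ennreal \<Rightarrow> (int \<Rightarrow> real) \<Rightarrow> real \<Rightarrow> ennreal" where
  "weighted_norm a p h t = ennreal (t powr a) * heat_norm p h t"

lemma measurable_weighted [measurable]: "quad h \<Longrightarrow> weighted_norm a p h \<in> borel_measurable borel"
  unfolding weighted_norm_def[abs_def] by measurable

lemma mixed_norm_heat:
  assumes p: "1 \<le> p" and h: "quad h"
  shows "mixed_norm p q (\<lambda>t n. t powr a * heat_semigroup_deriv k t h n) = Lnorm q dt_over_t (weighted_norm a p ((lap ^^ k) h))"
  unfolding mixed_norm_def
proof (rule Lnorm_cong)
  fix t assume "t \<in> space dt_over_t"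
  then have t: "0 < t" by simp
  have "ennreal \<bar>t powr a * heat_semigroup_deriv k t h n\<bar> = ennreal (t powr a) * ennreal \<bar>heat t ((lap ^^ k) h) n\<bar>" for n
    by (simp add: heat_semigroup_deriv_eq[OF t h] abs_mult ennreal_mult)
  then show "lp_norm p (\<lambda>n. t powr a * heat_semigroup_deriv k t h n) = weighted_norm a p ((lap ^^ k) h) t"
    by (simp add: lp_norm_def weighted_norm_def heat_norm_def ell_cmult[OF p])
qed

text \<open>
  One more derivative in \<open>t\<close> is compensated by one more power of \<open>t\<close>; the halved time in
  \<open>heat_norm_lap_le\<close> is removed by dilation invariance.
\<close>

lemma weighted_lap_finite:
  assumes p: "1 \<le> p" and q: "1 \<le> q" and h: "quad h" and fin: "Lnorm q dt_over_t (weighted_norm a p h) < top"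
  shows "Lnorm q dt_over_t (weighted_norm (a + 1) p (lap h)) < top"
proof (rule Lnorm_finite_le[OF q])
  have m: "(\<lambda>t. weighted_norm a p h (t * (1 / 2))) \<in> borel_measurable borel"
    using measurable_compose[OF _ measurable_weighted[OF h], of "\<lambda>t. t * (1 / 2)"] by simp
  show "weighted_norm (a + 1) p (lap h) \<in> borel_measurable dt_over_t"
    by (intro measurable_dt measurable_weighted quad_lap h)
  show "(\<lambda>t. weighted_norm a p h (t * (1 / 2))) \<in> borel_measurable dt_over_t" by (rule measurable_dt[OF m])
  show "Lnorm q dt_over_t (\<lambda>t. weighted_norm a p h (t * (1 / 2))) < top"
    by (rule Lnorm_dt_scale[OF measurable_weighted[OF h] _ fin]) simp
  fix t assume "t \<in> space dt_over_t"
  then have t: "0 < t" by simp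
  have "weighted_norm (a + 1) p (lap h) t \<le> ennreal (t powr (a + 1)) * (ennreal (8 / t) * heat_norm p h (t / 2))"
    unfolding weighted_norm_def by (intro mult_left_mono heat_norm_lap_le p h t) simp
  also have "\<dots> = ennreal (8 * 2 powr a) * weighted_norm a p h (t * (1 / 2))"
  proof -
    have "t powr (a + 1) * (8 / t) = 8 * 2 powr a * (t * (1 / 2)) powr a"
      using t by (simp add: powr_add powr_divide)
    then have "ennreal (t powr (a + 1)) * ennreal (8 / t) = ennreal (8 * 2 powr a) * ennreal ((t * (1 / 2)) powr a)"
      using t by (simp flip: ennreal_mult)
    then show ?thesis by (simp add: weighted_norm_def mult.assoc[symmetric])
  qed
  finally show "weighted_norm (a + 1) p (lap h) t \<le> ennreal (8 * 2 powr a) * weighted_norm a p h (t * (1 / 2))" .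
qed

section \<open>The potential in weighted norms\<close>

lemma heat_norm_pot_le:
  assumes \<beta>: "0 < \<beta>" "\<beta> < 1 / 2" and p: "1 \<le> p" and h: "h \<in> ell_minus \<beta>" and t: "0 < t"
  shows "heat_norm p (potential \<beta> h) t \<le> (\<integral>\<^sup>+\<tau>. heat_norm p h (t + \<tau>) \<partial>riesz \<beta>)"
proof -
  have q: "quad h" by (rule quad_ell_minus[OF h \<beta>])
  have m: "(\<lambda>\<tau>. heat (t + \<tau>) h n) \<in> borel_measurable borel" for n
    using measurable_compose[OF _ heat_measurable[OF q, of n], of "\<lambda>\<tau>. t + \<tau>" borel] by simp
  have "heat_norm p (potential \<beta> h) t \<le> ell p (\<lambda>n. \<integral>\<^sup>+\<tau>. ennreal \<bar>heat (t + \<tau>) h n\<bar> \<partial>riesz \<beta>)"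
    unfolding heat_norm_def
  proof (rule ell_mono)
    fix n
    have "heat t (potential \<beta> h) n = (\<integral>\<tau>. heat (t + \<tau>) h n \<partial>riesz \<beta>)"
      using t by (intro heat_pot \<beta> h) simp
    moreover have "ennreal (norm (\<integral>\<tau>. heat (t + \<tau>) h n \<partial>riesz \<beta>)) \<le> (\<integral>\<^sup>+\<tau>. ennreal (norm (heat (t + \<tau>) h n)) \<partial>riesz \<beta>)"
    proof (cases "integrable (riesz \<beta>) (\<lambda>\<tau>. heat (t + \<tau>) h n)")
      case True then show ?thesis by (rule integral_norm_bound_ennreal)
    next
      case False then show ?thesis by (simp add: not_integrable_integral_eq)
    qed
    ultimately show "ennreal \<bar>heat t (potential \<beta> h) n\<bar> \<le> (\<integral>\<^sup>+\<tau>. ennreal \<bar>heat (t + \<tau>) h n\<bar> \<partial>riesz \<beta>)" by simp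
  qed
  also have "\<dots> \<le> (\<integral>\<^sup>+\<tau>. heat_norm p h (t + \<tau>) \<partial>riesz \<beta>)"
    unfolding heat_norm_def using m by (intro ell_minkowski p) simp
  finally show ?thesis .
qed

text \<open>
  The substitution \<open>\<tau> = t \<rho>\<close> gives a factor \<open>t\<^sup>\<beta>\<close>. Together with \<open>t\<^sup>a\<^sup>-\<^sup>\<beta>\<close> it is absorbed into the weight at
  time \<open>t (1 + \<rho>)\<close>, which leaves the power \<open>-a\<close> of \<open>1 + \<rho>\<close>.
\<close>

lemma weighted_pot_le:
  assumes \<beta>: "0 < \<beta>" "\<beta> < 1 / 2" and p: "1 \<le> p" and h: "h \<in> ell_minus \<beta>" and t: "0 < t"
  shows "weighted_norm (a - \<beta>) p (potential \<beta> h) t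
    \<le> (\<integral>\<^sup>+\<rho>. ennreal (hardy_kernel \<beta> a \<rho>) * weighted_norm a p h (t * (1 + \<rho>)) \<partial>lborel)"
proof -
  have [measurable]: "heat_norm p h \<in> borel_measurable borel"
    by (rule measurable_heat_norm[OF quad_ell_minus[OF h \<beta>]])
  let ?k = "\<lambda>\<tau>. if 0 < \<tau> then \<tau> powr (\<beta> - 1) else (0 :: real)"
  let ?F = "\<lambda>\<rho>. ennreal (t powr (a - \<beta>)) * (ennreal \<bar>t\<bar> * (ennreal (?k (0 + t * \<rho>)) * heat_norm p h (t + (0 + t * \<rho>))))"
  have "weighted_norm (a - \<beta>) p (potential \<beta> h) t \<le> ennreal (t powr (a - \<beta>)) * (\<integral>\<^sup>+\<tau>. heat_norm p h (t + \<tau>) \<partial>riesz \<beta>)"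
    unfolding weighted_norm_def by (intro mult_left_mono heat_norm_pot_le \<beta> p h t) simp
  also have "(\<integral>\<^sup>+\<tau>. heat_norm p h (t + \<tau>) \<partial>riesz \<beta>) = (\<integral>\<^sup>+\<tau>. ennreal (?k \<tau>) * heat_norm p h (t + \<tau>) \<partial>lborel)"
    by (rule nn_integral_riesz) measurable
  also have "\<dots> = ennreal \<bar>t\<bar> * (\<integral>\<^sup>+\<rho>. ennreal (?k (0 + t * \<rho>)) * heat_norm p h (t + (0 + t * \<rho>)) \<partial>lborel)"
    by (rule nn_integral_real_affine) (use t in auto)
  also have "ennreal (t powr (a - \<beta>)) * \<dots> = (\<integral>\<^sup>+\<rho>. ?F \<rho> \<partial>lborel)"
    by (simp add: nn_integral_cmult)
  also have "\<dots> = (\<integral>\<^sup>+\<rho>. ennreal (hardy_kernel \<beta> a \<rho>) * weighted_norm a p h (t * (1 + \<rho>)) \<partial>lborel)"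
  proof (rule nn_integral_cong)
    fix \<rho> :: real
    show "?F \<rho>
      = ennreal (hardy_kernel \<beta> a \<rho>) * weighted_norm a p h (t * (1 + \<rho>))"
    proof (cases "0 < \<rho>")
      case True
      have "t powr (a - \<beta>) * (t * (t * \<rho>) powr (\<beta> - 1)) = \<rho> powr (\<beta> - 1) * (t powr (a - \<beta>) * t powr 1 * t powr (\<beta> - 1))"
        using t by (simp add: powr_mult mult_ac)
      also have "t powr (a - \<beta>) * t powr 1 * t powr (\<beta> - 1) = t powr a"
        by (simp only: powr_add[symmetric]) simp
      also have "t powr a = (1 + \<rho>) powr (- a) * (t * (1 + \<rho>)) powr a"
      proof -
        have "(1 + \<rho>) powr (- a) * (1 + \<rho>) powr a = 1" using True by (simp flip: powr_add)
        then show ?thesis using t True by (simp add: powr_mult mult.left_commute)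
      qed
      finally have e: "t powr (a - \<beta>) * (t * (t * \<rho>) powr (\<beta> - 1)) = \<rho> powr (\<beta> - 1) * (1 + \<rho>) powr (- a) * (t * (1 + \<rho>)) powr a"
        by (simp only: mult.assoc)
      have "?F \<rho>
        = ennreal (t powr (a - \<beta>) * (t * (t * \<rho>) powr (\<beta> - 1))) * heat_norm p h (t * (1 + \<rho>))"
        using t True by (simp add: ennreal_mult mult.assoc distrib_left)
      also have "\<dots> = ennreal (\<rho> powr (\<beta> - 1) * (1 + \<rho>) powr (- a)) * weighted_norm a p h (t * (1 + \<rho>))"
        unfolding e weighted_norm_def by (simp add: ennreal_mult mult.assoc)
      finally show ?thesis using True by simp
    next
      case False
      then have "\<not> 0 < t * \<rho>" using t by (simp add: zero_less_mult_iff)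
      then show ?thesis using False by simp
    qed
  qed
  finally show ?thesis .
qed

lemma weighted_pot_finite:
  assumes \<beta>: "0 < \<beta>" "\<beta> < 1 / 2" and a: "\<beta> < a" and p: "1 \<le> p" and q: "1 \<le> q" and h: "h \<in> ell_minus \<beta>"
    and fin: "Lnorm q dt_over_t (weighted_norm a p h) < top"
  shows "Lnorm q dt_over_t (weighted_norm (a - \<beta>) p (potential \<beta> h)) < top"
proof -
  have qh: "quad h" by (rule quad_ell_minus[OF h \<beta>])
  have m[measurable]: "weighted_norm a p h \<in> borel_measurable borel" by (rule measurable_weighted[OF qh])
  let ?\<kappa> = "\<lambda>\<rho>. ennreal (hardy_kernel \<beta> a \<rho>)"
  let ?U = "\<lambda>t. \<integral>\<^sup>+\<rho>. ?\<kappa> \<rho> * weighted_norm a p h (t * (1 + \<rho>)) \<partial>lborel"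
  show ?thesis
  proof (rule Lnorm_finite_le[OF q, where c = 1 and g = ?U])
    show "weighted_norm (a - \<beta>) p (potential \<beta> h) \<in> borel_measurable dt_over_t"
      by (intro measurable_dt measurable_weighted quad_pot \<beta> h)
    show "?U \<in> borel_measurable dt_over_t" by (rule measurable_dt) measurable
    show "Lnorm q dt_over_t ?U < top"
      using hardy_kernel_finite[OF \<beta>(1) a] fin by (intro Lnorm_dt_average q m) auto
    show "weighted_norm (a - \<beta>) p (potential \<beta> h) t \<le> ennreal 1 * ?U t" if "t \<in> space dt_over_t" for t
      using weighted_pot_le[OF \<beta> p h, of t a] that by simp
  qed
qed

lemma lap_pow_cmult: "(lap ^^ k) (\<lambda>n. c * h n) = (\<lambda>n. c * (lap ^^ k) h n)"
  by (induction k) (auto simp: lap_def fun_eq_iff algebra_simps)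

lemma weighted_cmult:
  assumes "1 \<le> p" "quad h"
  shows "weighted_norm a p (\<lambda>n. c * h n) t = ennreal \<bar>c\<bar> * weighted_norm a p h t"
  by (simp add: weighted_norm_def heat_norm_def heat_cmult[OF assms(2)] abs_mult ennreal_mult ell_cmult[OF assms(1)] mult.left_commute)

theorem theorem1p3:
  fixes \<alpha> \<beta> :: real and p q :: ennreal and f :: "int \<Rightarrow> real"
  assumes "0 < \<alpha>"
    and "0 < \<beta>" and "\<beta> < 1 / 2"
    and "1 \<le> p" and "1 \<le> q"
    and "f \<in> Lambda_H \<alpha> p q \<inter> ell_minus \<beta>"
  shows "neg_frac_laplacian \<beta> f \<in> Lambda_H (\<alpha> + 2 * \<beta>) p q"
proof -
  note \<beta> = assms(2,3)
  have f: "f \<in> ell_minus \<beta>" and fH: "f \<in> Lambda_H \<alpha> p q" using assms(6) by auto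
  have qf: "quad f" by (rule quad_ell_minus[OF f \<beta>])
  define c where "c = 1 / Gamma \<beta>"
  have g: "neg_frac_laplacian \<beta> f = (\<lambda>n. c * potential \<beta> f n)"
    using neg_frac_laplacian_eq_pot[OF \<beta> f] by (auto simp: c_def)
  define k where "k = nat \<lfloor>\<alpha> / 2\<rfloor> + 1"
  define l where "l = nat \<lfloor>(\<alpha> + 2 * \<beta>) / 2\<rfloor> + 1"
  let ?b = "real l - (\<alpha> + 2 * \<beta>) / 2"
  have "in_lq_mu q (\<lambda>n. f n / (1 + \<bar>real_of_int n\<bar> powr \<alpha>))"
    and wk: "Lnorm q dt_over_t (weighted_norm (real k - \<alpha> / 2) p ((lap ^^ k) f)) < top"
    using fH mixed_norm_heat[OF assms(4) qf, of q "real k - \<alpha> / 2" k]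
    by (simp_all add: Lambda_H_def Let_def k_def)
  then have 1: "in_lq_mu q (\<lambda>n. potential \<beta> f n / (1 + \<bar>real_of_int n\<bar> powr (\<alpha> + 2 * \<beta>)))"
    by (intro pot_in_lq_mu \<beta> assms f)
  have growth: "in_lq_mu q (\<lambda>n. c * potential \<beta> f n / (1 + \<bar>real_of_int n\<bar> powr (\<alpha> + 2 * \<beta>)))"
    unfolding in_lq_mu_def infinity_ennreal_def
  proof (rule Lnorm_finite_le[OF assms(5) _ _ _ 1[unfolded in_lq_mu_def infinity_ennreal_def], where c = "\<bar>c\<bar>"])
    show "ennreal \<bar>c * potential \<beta> f n / (1 + \<bar>real_of_int n\<bar> powr (\<alpha> + 2 * \<beta>))\<bar>
      \<le> ennreal \<bar>c\<bar> * ennreal \<bar>potential \<beta> f n / (1 + \<bar>real_of_int n\<bar> powr (\<alpha> + 2 * \<beta>))\<bar>" for n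
      by (simp add: abs_mult flip: ennreal_mult)
  qed (simp_all add: mu_def)
  \<comment> \<open>This makes the Hardy kernel integrable.\<close>
  have l1: "(\<alpha> + 2 * \<beta>) / 2 < real l" unfolding l_def using assms(1) \<beta> by linarith
  \<comment> \<open>The smoothness increases by \<open>2\<beta> < 1\<close>, so at most one more derivative is required.\<close>
  have "l = k \<or> l = k + 1"
  proof -
    have "\<lfloor>\<alpha> / 2\<rfloor> \<le> \<lfloor>(\<alpha> + 2 * \<beta>) / 2\<rfloor>" "\<lfloor>(\<alpha> + 2 * \<beta>) / 2\<rfloor> \<le> \<lfloor>\<alpha> / 2\<rfloor> + 1"
      using \<beta> floor_mono[of "\<alpha> / 2" "(\<alpha> + 2 * \<beta>) / 2"] floor_mono[of "(\<alpha> + 2 * \<beta>) / 2" "\<alpha> / 2 + 1"] by simp_all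
    then have "\<lfloor>(\<alpha> + 2 * \<beta>) / 2\<rfloor> = \<lfloor>\<alpha> / 2\<rfloor> \<or> \<lfloor>(\<alpha> + 2 * \<beta>) / 2\<rfloor> = \<lfloor>\<alpha> / 2\<rfloor> + 1" by linarith
    moreover have "0 \<le> \<lfloor>\<alpha> / 2\<rfloor>" using assms(1) by simp
    ultimately show ?thesis unfolding l_def k_def by (auto simp: nat_add_distrib)
  qed
  then have wl: "Lnorm q dt_over_t (weighted_norm (real l - \<alpha> / 2) p ((lap ^^ l) f)) < top"
  proof
    assume "l = k" then show ?thesis using wk by simp
  next
    assume "l = k + 1"
    then show ?thesis using weighted_lap_finite[OF assms(4,5) quad_lap_pow[OF qf] wk] by (simp add: algebra_simps)
  qed
  have hl: "(lap ^^ l) f \<in> ell_minus \<beta>" by (rule ell_minus_lap_pow[OF f \<beta>(2)])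
  have qp: "quad (potential \<beta> f)" by (rule quad_pot[OF \<beta> f])
  have "Lnorm q dt_over_t (weighted_norm (real l - \<alpha> / 2 - \<beta>) p (potential \<beta> ((lap ^^ l) f))) < top"
    using l1 by (intro weighted_pot_finite \<beta> assms hl wl) (simp add: field_simps)
  then have 2: "Lnorm q dt_over_t (weighted_norm ?b p ((lap ^^ l) (potential \<beta> f))) < top"
    unfolding pot_lap_pow[OF \<beta> f] by (simp add: field_simps)
  have "Lnorm q dt_over_t (weighted_norm ?b p ((lap ^^ l) (\<lambda>n. c * potential \<beta> f n))) < top"
  proof (rule Lnorm_finite_le[OF assms(5) _ _ _ 2, where c = "\<bar>c\<bar>"])
    show "weighted_norm ?b p ((lap ^^ l) (\<lambda>n. c * potential \<beta> f n)) t
      \<le> ennreal \<bar>c\<bar> * weighted_norm ?b p ((lap ^^ l) (potential \<beta> f)) t" for t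
      unfolding lap_pow_cmult by (simp add: weighted_cmult[OF assms(4) quad_lap_pow[OF qp]])
  qed (intro measurable_dt measurable_weighted quad_lap_pow quad_cmult qp)+
  then have "mixed_norm p q (\<lambda>t n. t powr ?b * heat_semigroup_deriv l t (neg_frac_laplacian \<beta> f) n) < \<infinity>"
    unfolding g by (simp add: mixed_norm_heat[OF assms(4) quad_cmult[OF qp]])
  then show ?thesis using growth unfolding Lambda_H_def l_def Let_def g by simp
qed

end
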